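(* Let $b_1,b_2\in H^\infty_1$ be two non-extreme points of $H^\infty_1$, let $(a_1,b_1)$ and $(a_2,b_2)$ be the corresponding pythagorean pairs, and let $\Phi_j=b_j/a_j$ for $j=1,2$. Then $X_{b_1}\cong X_{b_2}$ (unitary equivalence of the backward shift operators on the de Branges-Rovnyak spaces $\mathcal H(b_1)$ and $\mathcal H(b_2)$) if and only if for every $\omega\in\mathbb D$, $$\frac{|\Phi_1'(\omega)|}{1+|\Phi_1(\omega)|^2}=\frac{|\Phi_2'(\omega)|}{1+|\Phi_2(\omega)|^2}.$$
   Context: $\mathbb D=\{z\in\mathbb C:|z|<1\}$, $\mathbb T=\partial\mathbb D$, $m$ is Lebesgue measure on $\mathbb T$. $H^2$ is the Hardy space of analytic functions on $\mathbb D$ with square-summable Taylor coefficients, $H^\infty$ is the algebra of bounded analytic functions on $\mathbb D$ with the supremum norm, and $H^\infty_1=\{b\in H^\infty:\|b\|_\infty\leq 1\}$. For $b\in H^\infty_1$, $T_b:H^2\to H^2$ is multiplication by $b$ and $T_{\overline b}=T_b^*$. The de Branges-Rovnyak space is $\mathcal H(b)=(I-T_bT_{\overline b})^{1/2}H^2$ with inner product $\langle (I-T_bT_{\overline b})^{1/2}f,(I-T_bT_{\overline b})^{1/2}g\rangle_b=\langle f,g\rangle_2$ for $f,g\in H^2\ominus\ker (I-T_bT_{\overline b})^{1/2}$, where $\langle\cdot,\cdot\rangle_2$ is the inner product of $H^2$. It is a reproducing kernel Hilbert space on $\mathbb D$ with kernel $k^b_\omega(z)=\frac{1-\overline{b(\omega)}b(z)}{1-\overline\omega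 z}$. The backward shift $S^*f(z)=(f(z)-f(0))/z$ maps $\mathcal H(b)$ into itself, and $X_b=S^*|_{\mathcal H(b)}$, which is a bounded operator (a contraction) on $\mathcal H(b)$. An extreme point of $H^\infty_1$ is an element of $H^\infty_1$ that does not lie in any open line segment connecting two distinct points of $H^\infty_1$; it is known that $b\in H^\infty_1$ is non-extreme (not an extreme point) if and only if $\int_{\mathbb T}\log(1-|b|^2)\,dm>-\infty$ (using radial boundary values of $b$). For non-extreme $b$, the pythagorean pair $(a,b)$ is formed with the unique outer function $a\in H^\infty_1$ such that $a(0)>0$ and $|a|^2+|b|^2=1$ almost everywhere on $\mathbb T$. Bounded operators $T_1$ on $\mathcal H_1$ and $T_2$ on $\mathcal H_2$ (Hilbert spaces) are unitarily equivalent, written $T_1\cong T_2$, if there is a unitary $U:\mathcal H_1\to\mathcal H_2$ with $UT_1=T_2U$. *)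

theory Defs
  imports "HOL-Complex_Analysis.Complex_Analysis"
begin

text \<open>
  A function on the open unit disc is represented by a function on the whole complex plane that
  vanishes off the disc, so that equality in HOL is equality on the disc and the
  spaces below are closed under pointwise operations.
\<close>

definition disc_analytic :: "(complex \<Rightarrow> complex) set" where
  "disc_analytic = {f. f holomorphic_on ball 0 1 \<and> (\<forall>z. z \<notin> ball 0 1 \<longrightarrow> f z = 0)}"

definition taylor_coeff :: "(complex \<Rightarrow> complex) \<Rightarrow> nat \<Rightarrow> complex" where
  "taylor_coeff f n = (deriv ^^ n) f 0 / fact n"

definition H2 :: "(complex \<Rightarrow> complex) set" where
  "H2 = {f \<in> disc_analytic. summable (\<lambda>n. (cmod (taylor_coeff f n))\<^sup>2)}"

definition H2_inner :: "(complex \<Rightarrow> complex) \<Rightarrow> (complex \<Rightarrow> complex) \<Rightarrow> complex" where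
  "H2_inner f g = (\<Sum>n. taylor_coeff f n * cnj (taylor_coeff g n))"

definition H2_norm :: "(complex \<Rightarrow> complex) \<Rightarrow> real" where
  "H2_norm f = sqrt (Re (H2_inner f f))"

definition Hinf :: "(complex \<Rightarrow> complex) set" where
  "Hinf = {f \<in> disc_analytic. bounded (f ` ball 0 1)}"

definition Hinf_norm :: "(complex \<Rightarrow> complex) \<Rightarrow> real" where
  "Hinf_norm f = (SUP z\<in>ball 0 1. cmod (f z))"

definition Hinf1 :: "(complex \<Rightarrow> complex) set" where
  "Hinf1 = {b \<in> Hinf. Hinf_norm b \<le> 1}"

definition extreme_Hinf1 :: "(complex \<Rightarrow> complex) \<Rightarrow> bool" where
  "extreme_Hinf1 b \<longleftrightarrow> b \<in> Hinf1 \<and>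
     \<not> (\<exists>f\<in>Hinf1. \<exists>g\<in>Hinf1. f \<noteq> g \<and>
          (\<exists>t::real. 0 < t \<and> t < 1 \<and> b = (\<lambda>z. (1 - of_real t) * f z + of_real t * g z)))"

subsection \<open>Operators on \<open>H2\<close> and the de Branges-Rovnyak spaces\<close>

text \<open>Only the values of operators on \<open>H2\<close> are relevant.\<close>

type_synonym fun_op = "(complex \<Rightarrow> complex) \<Rightarrow> (complex \<Rightarrow> complex)"

definition linear_op_on :: "(complex \<Rightarrow> complex) set \<Rightarrow> fun_op \<Rightarrow> bool" where
  "linear_op_on V A \<longleftrightarrow>
     (\<forall>f\<in>V. \<forall>g\<in>V. A (\<lambda>z. f z + g z) = (\<lambda>z. A f z + A g z)) \<and>
     (\<forall>c. \<forall>f\<in>V. A (\<lambda>z. c * f z) = (\<lambda>z. c * A f z))"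

definition mult_op :: "(complex \<Rightarrow> complex) \<Rightarrow> fun_op" where
  "mult_op b f = (\<lambda>z. b z * f z)"

definition H2_adjoint :: "fun_op \<Rightarrow> fun_op" where
  "H2_adjoint T g = (THE h. h \<in> H2 \<and> (\<forall>f\<in>H2. H2_inner (T f) g = H2_inner f h))"

definition positive_H2_op :: "fun_op \<Rightarrow> bool" where
  "positive_H2_op A \<longleftrightarrow>
     A ` H2 \<subseteq> H2 \<and> linear_op_on H2 A \<and>
     (\<exists>C. \<forall>f\<in>H2. H2_norm (A f) \<le> C * H2_norm f) \<and>
     (\<forall>f\<in>H2. H2_inner (A f) f \<in> \<real>\<^sub>\<ge>\<^sub>0)"

text \<open>
  The bounded positive square root of a bounded positive operator is unique on \<open>H2\<close>; the choice
  below only concerns the irrelevant values off \<open>H2\<close>.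
\<close>

definition H2_sqrt :: "fun_op \<Rightarrow> fun_op" where
  "H2_sqrt P = (SOME A. positive_H2_op A \<and> (\<forall>f\<in>H2. A (A f) = P f))"

definition defect_op :: "(complex \<Rightarrow> complex) \<Rightarrow> fun_op" where
  "defect_op b = H2_sqrt (\<lambda>f z. f z - mult_op b (H2_adjoint (mult_op b) f) z)"

definition H2_minus_ker :: "fun_op \<Rightarrow> (complex \<Rightarrow> complex) set" where
  "H2_minus_ker A = {f \<in> H2. \<forall>g\<in>H2. A g = (\<lambda>z. 0) \<longrightarrow> H2_inner f g = 0}"

definition dBR :: "(complex \<Rightarrow> complex) \<Rightarrow> (complex \<Rightarrow> complex) set" where
  "dBR b = defect_op b ` H2"

text \<open>
  \<open>defect_op b\<close> maps \<open>H2_minus_ker (defect_op b)\<close> bijectively onto \<open>dBR b\<close>, and the inner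
  product of \<open>dBR b\<close> is the one that makes this bijection isometric.
\<close>

definition dBR_inner :: "(complex \<Rightarrow> complex) \<Rightarrow> (complex \<Rightarrow> complex) \<Rightarrow> (complex \<Rightarrow> complex) \<Rightarrow> complex" where
  "dBR_inner b u v =
     H2_inner (the_inv_into (H2_minus_ker (defect_op b)) (defect_op b) u)
              (the_inv_into (H2_minus_ker (defect_op b)) (defect_op b) v)"

text \<open>At \<open>0\<close> the quotient \<open>(f z - f 0) / z\<close> is continued analytically by \<open>deriv f 0\<close>.\<close>

definition backward_shift :: fun_op where
  "backward_shift f =
     (\<lambda>z. if z = 0 then deriv f 0 else if z \<in> ball 0 1 then (f z - f 0) / z else 0)"

definition dBR_shift :: "(complex \<Rightarrow> complex) \<Rightarrow> fun_op" where
  "dBR_shift b = restrict backward_shift (dBR b)"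

text \<open>\<open>Vi\<close> are spaces of functions with inner products \<open>ipi\<close> and operators \<open>Ti\<close> on them.\<close>

definition unitarily_equivalent ::
  "(complex \<Rightarrow> complex) set \<Rightarrow> ((complex \<Rightarrow> complex) \<Rightarrow> (complex \<Rightarrow> complex) \<Rightarrow> complex) \<Rightarrow> fun_op \<Rightarrow>
   (complex \<Rightarrow> complex) set \<Rightarrow> ((complex \<Rightarrow> complex) \<Rightarrow> (complex \<Rightarrow> complex) \<Rightarrow> complex) \<Rightarrow> fun_op \<Rightarrow> bool" where
  "unitarily_equivalent V1 ip1 T1 V2 ip2 T2 \<longleftrightarrow>
     (\<exists>U. bij_betw U V1 V2 \<and> linear_op_on V1 U \<and>
          (\<forall>f\<in>V1. \<forall>g\<in>V1. ip2 (U f) (U g) = ip1 f g) \<and>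
          (\<forall>f\<in>V1. U (T1 f) = T2 (U f)))"

subsection \<open>Outer functions and pythagorean pairs\<close>

text \<open>The unit circle is parametrized by \<open>cis t\<close> with \<open>0 \<le> t \<le> 2 * pi\<close>; \<open>w\<close> is the modulus on it.\<close>

definition outer_function :: "(complex \<Rightarrow> complex) \<Rightarrow> bool" where
  "outer_function f \<longleftrightarrow>
     (\<exists>c w. cmod c = 1 \<and> (\<forall>t. 0 < w t) \<and>
        w \<in> borel_measurable (lebesgue_on {0..2 * pi}) \<and>
        integrable (lebesgue_on {0..2 * pi}) (\<lambda>t. ln (w t :: real)) \<and>
        (\<forall>z\<in>ball 0 1. f z = c * exp (1 / (2 * of_real pi) *
           (LINT t|lebesgue_on {0..2 * pi}. (cis t + z) / (cis t - z) * of_real (ln (w t))))))"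

definition has_radial_limit :: "(complex \<Rightarrow> complex) \<Rightarrow> complex \<Rightarrow> complex \<Rightarrow> bool" where
  "has_radial_limit f \<zeta> l \<longleftrightarrow> ((\<lambda>r::real. f (of_real r * \<zeta>)) \<longlongrightarrow> l) (at_left 1)"

text \<open>
  Radial limits of functions in \<open>Hinf\<close> exist almost everywhere (Fatou), so asking for their
  existence in the boundary identity is no restriction.
\<close>

definition pythagorean_pair :: "(complex \<Rightarrow> complex) \<Rightarrow> (complex \<Rightarrow> complex) \<Rightarrow> bool" where
  "pythagorean_pair a b \<longleftrightarrow>
     b \<in> Hinf1 \<and> \<not> extreme_Hinf1 b \<and>
     a \<in> Hinf1 \<and> outer_function a \<and> Im (a 0) = 0 \<and> 0 < Re (a 0) \<and>
     (AE t in lebesgue_on {0..2 * pi}.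
        \<exists>u v. has_radial_limit a (cis t) u \<and> has_radial_limit b (cis t) v \<and>
              (cmod u)\<^sup>2 + (cmod v)\<^sup>2 = 1)"

end

theory Submission
  imports Defs "HOL-Real_Asymp.Real_Asymp"
begin

text \<open>For a pythagorean pair \<open>(a, b)\<close> write \<open>\<Phi> = b / a\<close>, and let \<open>T\<^sub>a\<close>, \<open>T\<^sub>b\<close> be the
  multiplications on \<open>H\<^sup>2\<close>. Since \<open>|a|\<^sup>2 + |b|\<^sup>2 = 1\<close> on the circle, \<open>h \<mapsto> (b h, - a h)\<close>
  is an isometry of \<open>H\<^sup>2\<close> into \<open>H\<^sup>2 \<oplus> H\<^sup>2\<close>. The orthogonal complement of its range is the model
  space \<open>K = {(f, g). T\<^sub>b\<^sup>* f = T\<^sub>a\<^sup>* g}\<close>. Projecting \<open>(h, 0)\<close> to \<open>K\<close> gives a map whose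
  first coordinate is \<open>(I - T\<^sub>b T\<^sub>b\<^sup>*) h\<close>, and \<open>T\<^sub>a\<^sup>*\<close> is injective because \<open>a\<close> is outer. Hence
  \<open>(f, g) \<mapsto> f\<close> is a unitary map of \<open>K\<close> onto \<open>\<H>(b)\<close> (\<open>dBR_model\<close>), and it carries the
  restriction of \<open>S\<^sup>* \<oplus> S\<^sup>*\<close> to \<open>K\<close> into \<open>X\<^sub>b\<close>.

  In \<open>K\<close> everything is explicit. If \<open>k\<^sub>\<omega>\<close> is the Szego kernel, then
  \<open>(k\<^sub>\<omega>, cnj (\<Phi> \<omega>) k\<^sub>\<omega>)\<close> spans the eigenspace for \<open>cnj \<omega>\<close>; these vectors are total in \<open>K\<close>
  (\<open>closure_span_eigenvectors\<close>), and their Gram matrix is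
  \<open>(1 + \<Phi> z cnj (\<Phi> \<omega>)) / (1 - cnj \<omega> z)\<close>. An intertwining unitary has to rescale eigenvectors, and
  conversely a rescaling that matches the Gram matrices extends to an intertwining unitary. So
  the operators \<open>X\<^sub>b\<close> of two pairs are unitarily equivalent iff for some function \<open>d\<close>
  \<open>1 + \<Phi>\<^sub>1 z cnj (\<Phi>\<^sub>1 \<omega>) = d z cnj (d \<omega>) (1 + \<Phi>\<^sub>2 z cnj (\<Phi>\<^sub>2 \<omega>))\<close>,
  which is \<open>kernel_equivalent\<close>.

  The last step is a fact about maps into the Riemann sphere. By the identity above, \<open>\<Phi>\<^sub>1\<close> and
  \<open>\<Phi>\<^sub>2\<close> have the same chordal distances between values, and the spherical derivative is their
  infinitesimal form. Conversely, equality of the spherical derivatives polarizes to an identity in two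
  independent variables; freezing one of them at a point where both functions have been rotated to \<open>0\<close>
  leaves \<open>\<psi>\<^sub>1' = \<kappa> \<psi>\<^sub>2'\<close> with \<open>|\<kappa>| = 1\<close>, so \<open>\<Phi>\<^sub>1\<close> is a rotation of \<open>\<Phi>\<^sub>2\<close>
  (\<open>spherical_derivative_rotation\<close>), and \<open>d\<close> is read off from the matrix of the rotation.

  Two analytic inputs support this. The identity \<open>T\<^sub>a\<^sup>* T\<^sub>a + T\<^sub>b\<^sup>* T\<^sub>b = I\<close> comes from the radial limits by
  dominated convergence in Parseval's formula. Outerness of \<open>a\<close> enters through bounded \<open>p\<^sub>N\<close> with
  \<open>|a p\<^sub>N| \<le> 1\<close> and \<open>a p\<^sub>N \<rightarrow> 1\<close>, obtained from the Herglotz integral of \<open>min (- ln |a|) N\<close>; they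
  take over the part of division by \<open>a\<close> on the circle, both for the injectivity of \<open>T\<^sub>a\<^sup>*\<close> and for the
  totality of the eigenvectors.\<close>

section \<open>Closed subspaces of real Hilbert spaces\<close>

lemma closed_subspace_orthogonal_decomposition:
  fixes S :: "'a::{real_inner, complete_space} set"
  assumes "closed S" "subspace S"
  shows "\<exists>y z. x = y + z \<and> y \<in> S \<and> (\<forall>s\<in>S. inner z s = 0)"
proof -
  define d where "d = infdist x S"
  have ne: "S \<noteq> {}" using subspace_0[OF assms(2)] by blast
  have d0: "d \<ge> 0" by (simp add: d_def infdist_nonneg)
  have dle: "d \<le> norm (x - s)" if "s \<in> S" for s
    using infdist_le[OF that, of x] by (simp add: d_def dist_norm)
  have "\<exists>s\<in>S. norm (x - s) < d + 1 / (real n + 1)" for n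
  proof -
    have "infdist x S < d + 1 / (real n + 1)" by (simp add: d_def)
    then show ?thesis
      unfolding infdist_notempty[OF ne] dist_norm
      using cINF_less_iff[OF ne, of "\<lambda>s. norm (x - s)"]
      by (metis (no_types, lifting) bdd_below.I2 norm_ge_zero)
  qed
  then obtain s where sS: "\<And>n. s n \<in> S" and s: "\<And>n. norm (x - s n) < d + 1 / (real n + 1)"
    by metis
  have sq: "(norm (x - s n))\<^sup>2 \<le> d\<^sup>2 + (2 * d + 1) / (real n + 1)" for n
  proof -
    let ?e = "1 / (real n + 1)"
    have e: "0 \<le> ?e" "?e \<le> 1" by auto
    have "(norm (x - s n))\<^sup>2 \<le> (d + ?e)\<^sup>2"
      using s[of n] by (intro power_mono) auto
    also have "\<dots> = d\<^sup>2 + 2 * d * ?e + ?e * ?e" by (simp add: power2_eq_square algebra_simps)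
    also have "?e * ?e \<le> ?e" using e mult_left_mono[OF e(2) e(1)] by (simp only: mult_1_right)
    finally have "(norm (x - s n))\<^sup>2 \<le> d\<^sup>2 + 2 * d * ?e + ?e" by simp
    also have "\<dots> = d\<^sup>2 + (2 * d + 1) / (real n + 1)" by (simp add: add_divide_distrib)
    finally show ?thesis .
  qed
  \<comment> \<open>The midpoint of two members of \<open>S\<close> is at distance at least \<open>d\<close>, so the parallelogram
    law makes a minimizing sequence Cauchy.\<close>
  have par: "(norm (s m - s n))\<^sup>2 \<le> 2 * (2 * d + 1) / (real m + 1) + 2 * (2 * d + 1) / (real n + 1)" for m n
  proof -
    have "(1/2::real) *\<^sub>R (s m + s n) \<in> S"
      using sS assms(2) by (intro subspace_scale subspace_add)
    then have "d \<le> norm (x - (1/2::real) *\<^sub>R (s m + s n))" by (rule dle)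
    then have "d\<^sup>2 \<le> (norm (x - (1/2::real) *\<^sub>R (s m + s n)))\<^sup>2"
      using d0 by (intro power_mono) auto
    moreover have "(norm (s m - s n))\<^sup>2 = 2 * (norm (x - s m))\<^sup>2 + 2 * (norm (x - s n))\<^sup>2
        - 4 * (norm (x - (1/2::real) *\<^sub>R (s m + s n)))\<^sup>2"
      by (simp add: power2_norm_eq_inner inner_diff inner_add inner_commute algebra_simps)
    moreover have "2 * (2 * d + 1) / (real k + 1) = 2 * ((2 * d + 1) / (real k + 1))" for k by simp
    ultimately show ?thesis using sq[of m] sq[of n] by linarith
  qed
  have "Cauchy s"
  proof (rule metric_CauchyI)
    fix e :: real assume e: "e > 0"
    obtain N :: nat where N: "4 * (2 * d + 1) / e\<^sup>2 < real N" using reals_Archimedean2 by blast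
    have "dist (s m) (s n) < e" if "m \<ge> N" "n \<ge> N" for m n
    proof -
      have B: "2 * (2 * d + 1) / (real k + 1) < e\<^sup>2 / 2" if "k \<ge> N" for k
      proof -
        have "4 * (2 * d + 1) / e\<^sup>2 < real k + 1" using N that by linarith
        then show ?thesis using e by (simp add: field_simps)
      qed
      have "(norm (s m - s n))\<^sup>2 < e\<^sup>2"
        using par[of m n] B[OF that(1)] B[OF that(2)] by linarith
      then show ?thesis using e by (simp add: dist_norm power_less_imp_less_base)
    qed
    then show "\<exists>M. \<forall>m\<ge>M. \<forall>n\<ge>M. dist (s m) (s n) < e" by blast
  qed
  then obtain y where y: "s \<longlonglongrightarrow> y" using Cauchy_convergent_iff convergent_def by blast
  have yS: "y \<in> S" using closed_sequentially[OF assms(1) _ y] sS by blast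
  have "norm (x - y) \<le> d"
  proof (rule LIMSEQ_le)
    show "(\<lambda>n. norm (x - s n)) \<longlonglongrightarrow> norm (x - y)" by (intro tendsto_intros y)
    show "(\<lambda>n. d + 1 / (real n + 1)) \<longlonglongrightarrow> d" by real_asymp
    show "\<exists>N. \<forall>n\<ge>N. norm (x - s n) \<le> d + 1 / (real n + 1)" using s less_imp_le by blast
  qed
  with dle[OF yS] have dy: "norm (x - y) = d" by simp
  have "inner (x - y) t = 0" if t: "t \<in> S" for t
  proof (cases "t = 0")
    case False
    define c where "c = inner (x - y) t / inner t t"
    have tt: "inner t t > 0" using False by simp
    have "y + c *\<^sub>R t \<in> S" using yS t assms(2) by (intro subspace_add subspace_scale)
    then have "norm (x - y) \<le> norm (x - (y + c *\<^sub>R t))" using dle dy by simp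
    then have "(norm (x - y))\<^sup>2 \<le> (norm (x - (y + c *\<^sub>R t)))\<^sup>2" by (intro power_mono) auto
    also have "\<dots> = (norm ((x - y) - c *\<^sub>R t))\<^sup>2" by (simp add: algebra_simps)
    also have "\<dots> = (norm (x - y))\<^sup>2 - 2 * c * inner (x - y) t + c * c * inner t t"
      by (simp add: power2_norm_eq_inner inner_diff inner_commute algebra_simps)
    also have "c * c * inner t t = c * inner (x - y) t" using tt by (simp add: c_def)
    finally have "c * inner (x - y) t \<le> 0" by simp
    then have "(inner (x - y) t)\<^sup>2 / inner t t \<le> 0" by (simp add: c_def power2_eq_square)
    then show ?thesis using tt
      by (metis divide_le_0_iff not_less zero_less_power2)
  qed simp
  with yS show ?thesis by (intro exI[of _ y] exI[of _ "x - y"]) auto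
qed

lemma subspace_closure:
  fixes S :: "'a::real_normed_vector set"
  assumes S: "subspace S"
  shows "subspace (closure S)"
  unfolding subspace_def
proof (intro conjI allI ballI)
  show "0 \<in> closure S" using subspace_0[OF S] closure_subset by blast
  show "x + y \<in> closure S" if xy: "x \<in> closure S" "y \<in> closure S" for x y
  proof -
    obtain s where s: "\<forall>n. s n \<in> S" "s \<longlonglongrightarrow> x"
      using closure_sequential[THEN iffD1, OF xy(1)] by blast
    obtain t where t: "\<forall>n. t n \<in> S" "t \<longlonglongrightarrow> y"
      using closure_sequential[THEN iffD1, OF xy(2)] by blast
    from s t have "\<And>n. s n + t n \<in> S" "(\<lambda>n. s n + t n) \<longlonglongrightarrow> x + y"
      by (simp_all add: subspace_add[OF S] tendsto_add)
    then show ?thesis unfolding closure_sequential by (intro exI[of _ "\<lambda>n. s n + t n"]) auto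
  qed
  show "c *\<^sub>R x \<in> closure S" if x: "x \<in> closure S" for c x
  proof -
    obtain s where "\<forall>n. s n \<in> S" "s \<longlonglongrightarrow> x"
      using closure_sequential[THEN iffD1, OF x] by blast
    then have "\<And>n. c *\<^sub>R s n \<in> S" "(\<lambda>n. c *\<^sub>R s n) \<longlonglongrightarrow> c *\<^sub>R x"
      by (simp_all add: subspace_scale[OF S] tendsto_scaleR)
    then show ?thesis unfolding closure_sequential by (intro exI[of _ "\<lambda>n. c *\<^sub>R s n"]) auto
  qed
qed

lemma closed_subspace_orthogonal_complement:
  "subspace {f :: 'a::real_inner. \<forall>g. P g \<longrightarrow> inner f g = 0}"
  "closed {f :: 'a::real_inner. \<forall>g. P g \<longrightarrow> inner f g = 0}"
proof -
  show "subspace {f :: 'a. \<forall>g. P g \<longrightarrow> inner f g = 0}" by (auto simp: subspace_def inner_add_left)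
  have "{f :: 'a. \<forall>g. P g \<longrightarrow> inner f g = 0} = (\<Inter>g\<in>{g. P g}. {f. inner f g = 0})" by auto
  moreover have "closed {f. inner f g = 0}" for g :: 'a
    by (intro closed_Collect_eq continuous_intros)
  ultimately show "closed {f :: 'a. \<forall>g. P g \<longrightarrow> inner f g = 0}" by auto
qed

lemma closure_eq_closed_subspace:
  fixes S :: "'a::{real_inner, complete_space} set"
  assumes "closed S" "subspace R" "R \<subseteq> S"
    and orth: "\<And>x. x \<in> S \<Longrightarrow> (\<And>r. r \<in> R \<Longrightarrow> inner x r = 0) \<Longrightarrow> x = 0"
    and "subspace S"
  shows "closure R = S"
proof
  show "closure R \<subseteq> S" using assms by (simp add: closure_minimal)
  show "S \<subseteq> closure R"
  proof
    fix x assume x: "x \<in> S"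
    obtain y z where yz: "x = y + z" "y \<in> closure R" "\<forall>s\<in>closure R. inner z s = 0"
      using closed_subspace_orthogonal_decomposition
          [OF closed_closure[of R] subspace_closure[OF assms(2)], of x] by blast
    have "z = x - y" using yz by simp
    moreover have "y \<in> S" using yz \<open>closure R \<subseteq> S\<close> by blast
    ultimately have "z \<in> S" using x assms subspace_diff by blast
    then have "z = 0" using orth yz closure_subset by blast
    then show "x \<in> closure R" using yz by simp
  qed
qed

section \<open>Isometries given by their graphs\<close>

text \<open>An isometry between subspaces is represented by its graph. Closing the graph then extends the isometry
  to the closure of its domain and of its range at once, and every closed property of pairs
  (linearity, invariance under an operator, an intertwining relation) passes to the extension.\<close>

definition isometry_graph :: "('a::real_inner \<times> 'b::real_inner) set \<Rightarrow> bool" where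
  "isometry_graph G \<longleftrightarrow> subspace G \<and> (\<forall>(x, y) \<in> G. norm x = norm y)"

lemma isometry_graph_inner:
  assumes G: "isometry_graph G" and "(x, y) \<in> G" "(x', y') \<in> G"
  shows "inner x x' = inner y y'"
proof -
  have "(x + x', y + y') \<in> G"
    using subspace_add[of G "(x, y)" "(x', y')"] assms by (simp add: isometry_graph_def)
  then have "norm (x + x') = norm (y + y')" "norm x = norm y" "norm x' = norm y'"
    using assms by (auto simp: isometry_graph_def)
  then have "inner (x + x') (x + x') = inner (y + y') (y + y')" "inner x x = inner y y"
    "inner x' x' = inner y' y'"
    by (simp_all flip: power2_norm_eq_inner)
  then show ?thesis by (simp add: inner_add inner_commute)
qed

lemma isometry_graph_closure:
  assumes "isometry_graph G"
  shows "isometry_graph (closure G)"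
proof -
  have "closure G \<subseteq> {p. norm (fst p) = norm (snd p)}"
    using assms by (intro closure_minimal closed_Collect_eq continuous_intros)
      (auto simp: isometry_graph_def)
  then show ?thesis using assms by (auto simp: isometry_graph_def subspace_closure)
qed

lemma isometry_graph_converse:
  "isometry_graph G \<Longrightarrow> isometry_graph (prod.swap ` G)"
  unfolding isometry_graph_def
  by (auto intro!: linear_subspace_image simp: linear_iff)

text \<open>If first coordinates converge, the isometry makes the second coordinates Cauchy.\<close>

lemma fst_closure_isometry_graph:
  fixes G :: "('a::{real_inner, complete_space} \<times> 'b::{real_inner, complete_space}) set"
  assumes G: "isometry_graph G"
  shows "fst ` closure G = closure (fst ` G)"
proof
  show "fst ` closure G \<subseteq> closure (fst ` G)"
    by (intro image_closure_subset continuous_intros closed_closure closure_subset)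
  show "closure (fst ` G) \<subseteq> fst ` closure G"
  proof
    fix x assume "x \<in> closure (fst ` G)"
    then obtain s where s: "\<And>n. s n \<in> fst ` G" "s \<longlonglongrightarrow> x"
      using closure_sequential by metis
    have "\<exists>y. (s n, y) \<in> G" for n using s(1)[of n] by force
    then obtain t where t: "\<And>n. (s n, t n) \<in> G" by metis
    have "(s m - s n, t m - t n) \<in> G" for m n
      using subspace_diff[of G "(s m, t m)" "(s n, t n)"] t G by (auto simp: isometry_graph_def)
    then have "norm (s m - s n) = norm (t m - t n)" for m n
      using G unfolding isometry_graph_def by blast
    then have "dist (t m) (t n) = dist (s m) (s n)" for m n by (simp add: dist_norm)
    moreover have "Cauchy s" using s(2) by (rule LIMSEQ_imp_Cauchy)
    ultimately have "Cauchy t" by (simp add: Cauchy_def)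
    then obtain y where "t \<longlonglongrightarrow> y" using Cauchy_convergent_iff convergent_def by blast
    then have "(\<lambda>n. (s n, t n)) \<longlonglongrightarrow> (x, y)" using s(2) by (intro tendsto_intros)
    then have "(x, y) \<in> closure G" 
      unfolding closure_sequential using t by (intro exI[of _ "\<lambda>n. (s n, t n)"]) auto
    then show "x \<in> fst ` closure G" by force
  qed
qed

lemma snd_closure_isometry_graph:
  fixes G :: "('a::{real_inner, complete_space} \<times> 'b::{real_inner, complete_space}) set"
  assumes G: "isometry_graph G"
  shows "snd ` closure G = closure (snd ` G)"
proof -
  have sw: "prod.swap ` closure G = closure (prod.swap ` G)"
  proof
    have c: "continuous_on A (prod.swap :: 'x::topological_space \<times> 'y::topological_space \<Rightarrow> _)" for A
      unfolding prod.swap_def by (intro continuous_intros)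
    show *: "prod.swap ` closure G \<subseteq> closure (prod.swap ` G)"
      by (intro image_closure_subset c closed_closure closure_subset)
    have "prod.swap ` closure (prod.swap ` G) \<subseteq> closure (prod.swap ` prod.swap ` G)"
      by (intro image_closure_subset c closed_closure closure_subset)
    then have "prod.swap ` prod.swap ` closure (prod.swap ` G) \<subseteq> prod.swap ` closure G"
      by (auto simp: image_image)
    then show "closure (prod.swap ` G) \<subseteq> prod.swap ` closure G" by (simp add: image_image)
  qed
  have "fst ` prod.swap ` closure G = closure (fst ` prod.swap ` G)"
    unfolding sw by (intro fst_closure_isometry_graph isometry_graph_converse G)
  then show ?thesis by (simp add: image_image)
qed

section \<open>The sequence space \<open>\<ell>\<^sup>2\<close>\<close>

typedef ell2 = "{x :: nat \<Rightarrow> complex. summable (\<lambda>n. (cmod (x n))\<^sup>2)}"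
  morphisms coeff Abs_ell2
  by (rule exI[of _ "\<lambda>n. 0"]) simp

setup_lifting type_definition_ell2

lemma summable_coeff: "summable (\<lambda>n. (cmod (coeff x n))\<^sup>2)"
  using coeff[of x] by simp

lemma ell2_eqI: "(\<And>n. coeff x n = coeff y n) \<Longrightarrow> x = y"
  by (metis coeff_inject ext)

lemma summable_sq_add:
  fixes x y :: "nat \<Rightarrow> complex"
  assumes "summable (\<lambda>n. (cmod (x n))\<^sup>2)" "summable (\<lambda>n. (cmod (y n))\<^sup>2)"
  shows "summable (\<lambda>n. (cmod (x n + y n))\<^sup>2)"
proof (rule summable_comparison_test')
  show "summable (\<lambda>n. 2 * (cmod (x n))\<^sup>2 + 2 * (cmod (y n))\<^sup>2)"
    by (intro summable_add summable_mult assms)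
  fix n
  have "(cmod (x n + y n))\<^sup>2 \<le> (cmod (x n) + cmod (y n))\<^sup>2"
    by (intro power_mono norm_triangle_ineq) auto
  also have "\<dots> \<le> 2 * (cmod (x n))\<^sup>2 + 2 * (cmod (y n))\<^sup>2"
    using sum_squares_bound[of "cmod (x n)" "cmod (y n)"] by (simp add: power2_sum)
  finally show "norm ((cmod (x n + y n))\<^sup>2) \<le> 2 * (cmod (x n))\<^sup>2 + 2 * (cmod (y n))\<^sup>2"
    by simp
qed

lemma summable_coeff_mult: "summable (\<lambda>n. norm (coeff x n * cnj (coeff y n)))"
proof (rule summable_comparison_test')
  show "summable (\<lambda>n. (cmod (coeff x n))\<^sup>2 + (cmod (coeff y n))\<^sup>2)"
    by (intro summable_add summable_coeff)
  fix n
  show "norm (norm (coeff x n * cnj (coeff y n))) \<le> (cmod (coeff x n))\<^sup>2 + (cmod (coeff y n))\<^sup>2"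
    using sum_squares_bound[of "cmod (coeff x n)" "cmod (coeff y n)"]
      mult_nonneg_nonneg[OF norm_ge_zero norm_ge_zero, of "coeff x n" "coeff y n"]
    unfolding norm_mult real_norm_def abs_mult abs_norm_cancel complex_mod_cnj by linarith
qed

definition cinner :: "ell2 \<Rightarrow> ell2 \<Rightarrow> complex" where
  "cinner x y = (\<Sum>n. coeff x n * cnj (coeff y n))"

lemma cinner_sums: "(\<lambda>n. coeff x n * cnj (coeff y n)) sums cinner x y"
  unfolding cinner_def by (rule summable_sums[OF summable_norm_cancel[OF summable_coeff_mult]])

lift_definition scaleC :: "complex \<Rightarrow> ell2 \<Rightarrow> ell2" (infixr "*\<^sub>C" 75) is "\<lambda>c x n. c * x n"
  by (simp add: norm_mult power_mult_distrib summable_mult)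

instantiation ell2 :: real_inner
begin

lift_definition zero_ell2 :: ell2 is "\<lambda>n. 0" by simp
lift_definition plus_ell2 :: "ell2 \<Rightarrow> ell2 \<Rightarrow> ell2" is "\<lambda>x y n. x n + y n"
  by (rule summable_sq_add)
lift_definition uminus_ell2 :: "ell2 \<Rightarrow> ell2" is "\<lambda>x n. - x n" by simp
lift_definition minus_ell2 :: "ell2 \<Rightarrow> ell2 \<Rightarrow> ell2" is "\<lambda>x y n. x n - y n"
  using summable_sq_add[of _ "\<lambda>n. - _ n"] by force
lift_definition scaleR_ell2 :: "real \<Rightarrow> ell2 \<Rightarrow> ell2" is "\<lambda>c x n. c *\<^sub>R x n"
  by (simp add: power_mult_distrib summable_mult)
definition inner_ell2 :: "ell2 \<Rightarrow> ell2 \<Rightarrow> real" where "inner_ell2 x y = Re (cinner x y)"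
definition norm_ell2 :: "ell2 \<Rightarrow> real" where "norm_ell2 x = sqrt (inner x x)"
definition dist_ell2 :: "ell2 \<Rightarrow> ell2 \<Rightarrow> real" where "dist_ell2 x y = norm (x - y)"
definition sgn_ell2 :: "ell2 \<Rightarrow> ell2" where "sgn_ell2 x = scaleR (inverse (norm x)) x"
definition uniformity_ell2 :: "(ell2 \<times> ell2) filter" where
  "uniformity_ell2 = (INF e\<in>{0<..}. principal {(x, y). dist x y < e})"
definition open_ell2 :: "ell2 set \<Rightarrow> bool" where
  "open_ell2 U \<longleftrightarrow> (\<forall>x\<in>U. eventually (\<lambda>(x', y). x' = x \<longrightarrow> y \<in> U) uniformity)"

lemmas coeff_simps =
  zero_ell2.rep_eq plus_ell2.rep_eq uminus_ell2.rep_eq minus_ell2.rep_eq scaleR_ell2.rep_eq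
  scaleC.rep_eq

lemma inner_ell2_sums: "(\<lambda>n. inner (coeff x n) (coeff y n)) sums inner x y"
  using sums_Re[OF cinner_sums, of x y] by (simp add: inner_ell2_def inner_complex_def)

instance
proof
  fix x y z :: ell2 and r s :: real
  show "x + y + z = x + (y + z)" "x + y = y + x" "0 + x = x" "- x + x = 0" "x - y = x + - y"
    "r *\<^sub>R (x + y) = r *\<^sub>R x + r *\<^sub>R y" "(r + s) *\<^sub>R x = r *\<^sub>R x + s *\<^sub>R x"
    "r *\<^sub>R s *\<^sub>R x = (r * s) *\<^sub>R x" "1 *\<^sub>R x = x"
    by (auto intro!: ell2_eqI simp: coeff_simps algebra_simps)
  show "dist x y = norm (x - y)" "sgn x = scaleR (inverse (norm x)) x" "norm x = sqrt (inner x x)"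
    "uniformity = (INF e\<in>{0<..}. principal {(x, y). dist (x::ell2) y < e})"
    by (simp_all add: dist_ell2_def sgn_ell2_def norm_ell2_def uniformity_ell2_def)
  show "open U \<longleftrightarrow> (\<forall>x\<in>U. \<forall>\<^sub>F (x', y) in uniformity. x' = x \<longrightarrow> y \<in> U)" for U :: "ell2 set"
    by (simp add: open_ell2_def)
  show "inner x y = inner y x"
    using inner_ell2_sums[of y x] unfolding inner_commute[of "coeff y _"]
    by (rule sums_unique2[OF inner_ell2_sums])
  show "inner (x + y) z = inner x z + inner y z"
    using sums_add[OF inner_ell2_sums[of x z] inner_ell2_sums[of y z]]
    by (intro sums_unique2[OF inner_ell2_sums]) (simp add: coeff_simps inner_add_left)
  show "inner (r *\<^sub>R x) y = r * inner x y"
    using sums_mult[OF inner_ell2_sums[of x y], of r]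
    by (intro sums_unique2[OF inner_ell2_sums]) (simp add: coeff_simps)
  have sq: "(\<lambda>n. (cmod (coeff x n))\<^sup>2) sums inner x x"
    using inner_ell2_sums[of x x] by (simp add: power2_norm_eq_inner)
  show "0 \<le> inner x x" by (rule sums_le[OF _ sums_zero sq]) simp
  show "inner x x = 0 \<longleftrightarrow> x = 0"
  proof
    assume "inner x x = 0"
    then have "(\<lambda>n. (cmod (coeff x n))\<^sup>2) sums 0" using sq by simp
    then have "(cmod (coeff x n))\<^sup>2 = 0" for n
      using suminf_eq_zero_iff[OF summable_coeff, of x] sums_unique by fastforce
    then show "x = 0" by (auto intro!: ell2_eqI simp: coeff_simps)
  next
    assume "x = 0"
    then have "(\<lambda>n. (cmod (coeff x n))\<^sup>2) = (\<lambda>n. 0)" by (simp add: coeff_simps)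
    then show "inner x x = 0" using sq sums_unique2[OF _ sums_zero] by metis
  qed
qed

end

lemma norm_ell2_sums: "(\<lambda>n. (cmod (coeff x n))\<^sup>2) sums (norm x)\<^sup>2"
  using inner_ell2_sums[of x x] by (simp add: power2_norm_eq_inner)

lemma norm_coeff_le: "cmod (coeff x n) \<le> norm x"
proof -
  have "(cmod (coeff x n))\<^sup>2 \<le> (norm x)\<^sup>2"
    using sum_le_suminf[OF summable_coeff, of "{n}" x] sums_unique[OF norm_ell2_sums, of x] by simp
  then show ?thesis by (rule power2_le_imp_le) simp
qed

lemma ell2_from_bounded_sums:
  assumes "\<And>N. (\<Sum>n<N. (cmod (x n))\<^sup>2) \<le> C\<^sup>2" "0 \<le> C"
  shows "\<exists>y. coeff y = x \<and> norm y \<le> C"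
proof -
  have s: "summable (\<lambda>n. (cmod (x n))\<^sup>2)"
    by (rule bounded_imp_summable[of _ "C\<^sup>2"]) (use assms(1)[of "Suc _"] in \<open>auto simp: lessThan_Suc_atMost\<close>)
  then have c: "coeff (Abs_ell2 x) = x" by (simp add: Abs_ell2_inverse)
  have "(norm (Abs_ell2 x))\<^sup>2 \<le> C\<^sup>2"
    using norm_ell2_sums[of "Abs_ell2 x"] suminf_le_const[OF s assms(1)] unfolding c
    by (simp add: sums_iff)
  then have "norm (Abs_ell2 x) \<le> C" using assms(2) by (rule power2_le_imp_le)
  with c show ?thesis by blast
qed

lemma sum_coeff_le: "(\<Sum>n<N. (cmod (coeff x n))\<^sup>2) \<le> (norm x)\<^sup>2"
  using sum_le_suminf[OF summable_coeff, of "{..<N}" x] sums_unique[OF norm_ell2_sums, of x] by simp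

instance ell2 :: complete_space
proof
  fix X :: "nat \<Rightarrow> ell2"
  assume X: "Cauchy X"
  have "Cauchy (\<lambda>k. coeff (X k) n)" for n
  proof (rule metric_CauchyI)
    fix e :: real assume "e > 0"
    then obtain M where M: "\<forall>k\<ge>M. \<forall>l\<ge>M. dist (X k) (X l) < e" using X metric_CauchyD by blast
    have D: "dist (coeff (X k) n) (coeff (X l) n) \<le> dist (X k) (X l)" for k l
      using norm_coeff_le[of "X k - X l" n] by (simp add: dist_norm coeff_simps)
    then show "\<exists>M. \<forall>k\<ge>M. \<forall>l\<ge>M. dist (coeff (X k) n) (coeff (X l) n) < e"
      using M le_less_trans[OF D] by blast
  qed
  then have "\<forall>n. \<exists>l. (\<lambda>k. coeff (X k) n) \<longlonglongrightarrow> l"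
    by (simp add: Cauchy_convergent_iff convergent_def)
  then have "\<exists>L. \<forall>n. (\<lambda>k. coeff (X k) n) \<longlonglongrightarrow> L n" by (rule choice)
  then obtain L where L: "\<And>n. (\<lambda>k. coeff (X k) n) \<longlonglongrightarrow> L n" by blast
  have near: "\<exists>M. \<forall>k\<ge>M. \<exists>y. coeff y = (\<lambda>n. coeff (X k) n - L n) \<and> norm y \<le> e" if "e > 0" for e
  proof -
    from that obtain M where M: "\<forall>k\<ge>M. \<forall>l\<ge>M. dist (X k) (X l) < e" using X metric_CauchyD by blast
    have "(\<Sum>n<N. (cmod (coeff (X k) n - L n))\<^sup>2) \<le> e\<^sup>2" if "k \<ge> M" for k N
    proof (rule tendsto_upperbound)
      show "(\<lambda>l. \<Sum>n<N. (cmod (coeff (X k) n - coeff (X l) n))\<^sup>2) \<longlonglongrightarrow> (\<Sum>n<N. (cmod (coeff (X k) n - L n))\<^sup>2)"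
        by (intro tendsto_intros L)
      have "(\<Sum>n<N. (cmod (coeff (X k) n - coeff (X l) n))\<^sup>2) \<le> e\<^sup>2" if l: "l \<ge> M" for l
      proof -
        have "(\<Sum>n<N. (cmod (coeff (X k) n - coeff (X l) n))\<^sup>2) \<le> (norm (X k - X l))\<^sup>2"
          using sum_coeff_le[of "X k - X l" N] by (simp add: coeff_simps)
        also have "\<dots> \<le> e\<^sup>2" using M \<open>k \<ge> M\<close> l
          by (intro power_mono) (auto simp: dist_norm intro: less_imp_le)
        finally show ?thesis .
      qed
      then show "\<forall>\<^sub>F l in sequentially. (\<Sum>n<N. (cmod (coeff (X k) n - coeff (X l) n))\<^sup>2) \<le> e\<^sup>2"
        by (auto simp: eventually_sequentially)
    qed auto
    then show ?thesis using that by (intro exI[of _ M] allI impI ell2_from_bounded_sums) auto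
  qed
  obtain k y where "coeff y = (\<lambda>n. coeff (X k) n - L n)" using near[of 1] by auto
  then have Lc: "coeff (X k - y) = L" by (auto simp: coeff_simps)
  have "X \<longlonglongrightarrow> X k - y"
  proof (rule metric_LIMSEQ_I)
    fix e :: real assume e: "e > 0"
    obtain M where M: "\<forall>l\<ge>M. \<exists>z. coeff z = (\<lambda>n. coeff (X l) n - L n) \<and> norm z \<le> e / 2"
      using near[of "e/2"] e by auto
    have "dist (X l) (X k - y) < e" if l: "l \<ge> M" for l
    proof -
      obtain z where z: "coeff z = (\<lambda>n. coeff (X l) n - L n)" "norm z \<le> e / 2" using M l by blast
      have "X l - (X k - y) = z"
        by (rule ell2_eqI) (simp add: coeff_simps(4)[of "X l"] Lc z)
      then show ?thesis using z e by (simp add: dist_norm)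
    qed
    then show "\<exists>M. \<forall>l\<ge>M. dist (X l) (X k - y) < e" by blast
  qed
  then show "convergent X" by (auto simp: convergent_def)
qed

instance ell2 :: banach ..

subsection \<open>The complex structure\<close>

lemma Re_cinner: "Re (cinner x y) = inner x y" by (simp add: inner_ell2_def)

lemma scaleC_simps [simp]:
  "c *\<^sub>C (x + y) = c *\<^sub>C x + c *\<^sub>C y" "(c + d) *\<^sub>C x = c *\<^sub>C x + d *\<^sub>C x"
  "c *\<^sub>C d *\<^sub>C x = (c * d) *\<^sub>C x" "1 *\<^sub>C x = x" "0 *\<^sub>C x = 0" "c *\<^sub>C 0 = 0"
  "c *\<^sub>C (x - y) = c *\<^sub>C x - c *\<^sub>C y" "c *\<^sub>C (- x) = - (c *\<^sub>C x)"
  by (auto intro!: ell2_eqI simp: coeff_simps algebra_simps)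

lemma scaleR_eq_scaleC: "r *\<^sub>R x = complex_of_real r *\<^sub>C x"
  by (rule ell2_eqI) (simp add: coeff_simps scaleR_conv_of_real)

lemma cinner_scaleC_left [simp]: "cinner (c *\<^sub>C x) y = c * cinner x y"
  using sums_mult[OF cinner_sums, of c x y]
  by (intro sums_unique2[OF cinner_sums]) (simp add: coeff_simps mult.assoc)

lemma cinner_commute: "cinner x y = cnj (cinner y x)"
  using sums_cnj[THEN iffD2, OF cinner_sums[of y x]]
  by (intro sums_unique2[OF cinner_sums]) (simp add: mult.commute)

lemma cinner_scaleC_right [simp]: "cinner x (c *\<^sub>C y) = cnj c * cinner x y"
  by (metis cinner_commute cinner_scaleC_left complex_cnj_mult)

lemma cinner_eq_inner: "cinner x y = Complex (inner x y) (inner x (\<i> *\<^sub>C y))"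
  by (simp add: complex_eq_iff flip: Re_cinner)

lemma cinner_add_left: "cinner (x + y) z = cinner x z + cinner y z"
  by (simp add: cinner_eq_inner inner_add_left complex_eq_iff)

lemma cinner_add_right: "cinner x (y + z) = cinner x y + cinner x z"
  by (simp add: cinner_eq_inner inner_add_right complex_eq_iff)

lemma cinner_diff_left: "cinner (x - y) z = cinner x z - cinner y z"
  by (simp add: cinner_eq_inner inner_diff_left complex_eq_iff)

lemma cinner_diff_right: "cinner x (y - z) = cinner x y - cinner x z"
  by (simp add: cinner_eq_inner inner_diff_right complex_eq_iff)

lemma cinner_zero [simp]: "cinner 0 y = 0" "cinner x 0 = 0"
  by (simp_all add: cinner_eq_inner complex_eq_iff)

lemma cinner_self: "cinner x x = complex_of_real ((norm x)\<^sup>2)"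
proof -
  have "Im (cinner x x) = - Im (cinner x x)" using cinner_commute[of x x] by (metis cnj.simps(2))
  then have "Im (cinner x x) = 0" by simp
  then show ?thesis by (simp add: complex_eq_iff Re_cinner power2_norm_eq_inner)
qed

lemma norm_scaleC [simp]: "norm (c *\<^sub>C x) = cmod c * norm x"
proof -
  have "complex_of_real ((norm (c *\<^sub>C x))\<^sup>2) = cinner (c *\<^sub>C x) (c *\<^sub>C x)"
    by (rule cinner_self[symmetric])
  also have "\<dots> = (c * cnj c) * cinner x x" by simp
  also have "\<dots> = complex_of_real ((cmod c * norm x)\<^sup>2)"
    unfolding cinner_self complex_norm_square[symmetric] power_mult_distrib by simp
  finally have "complex_of_real ((norm (c *\<^sub>C x))\<^sup>2) = complex_of_real ((cmod c * norm x)\<^sup>2)" .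
  then have "(norm (c *\<^sub>C x))\<^sup>2 = (cmod c * norm x)\<^sup>2" by (simp only: of_real_eq_iff)
  then show ?thesis by (rule power2_eq_imp_eq) auto
qed

lemma cinner_Cauchy_Schwarz: "cmod (cinner x y) \<le> norm x * norm y"
proof (cases "cinner x y = 0")
  case False
  define c where "c = cnj (sgn (cinner x y))"
  have c: "cmod c = 1" using False by (simp add: c_def norm_sgn)
  have "c * cinner x y = complex_of_real (cmod (cinner x y))"
    using False complex_norm_square[of "cinner x y"]
    by (simp add: c_def sgn_eq field_simps power2_eq_square)
  then have "cmod (cinner x y) = Re (cinner (c *\<^sub>C x) y)" by simp
  also have "\<dots> \<le> norm (c *\<^sub>C x) * norm y"
    by (simp only: Re_cinner norm_cauchy_schwarz)
  finally show ?thesis by (simp add: c)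
qed simp

lemma cinner_nondegenerate: "(\<And>y. cinner y x = cinner y x') \<Longrightarrow> x = x'"
proof -
  assume "\<And>y. cinner y x = cinner y x'"
  then have "cinner (x - x') (x - x') = 0" by (simp add: cinner_diff_right)
  then show "x = x'" by (simp add: cinner_self)
qed

lemma bounded_linear_scaleC: "bounded_linear (scaleC c)"
  by (rule bounded_linear_intro[of _ "cmod c"]) (auto simp: scaleR_eq_scaleC mult.commute)

lemma tendsto_scaleC [tendsto_intros]:
  "(f \<longlongrightarrow> x) F \<Longrightarrow> ((\<lambda>n. c *\<^sub>C f n) \<longlongrightarrow> c *\<^sub>C x) F"
  by (rule bounded_linear.tendsto[OF bounded_linear_scaleC])

lemma continuous_on_scaleC [continuous_intros]:
  "continuous_on A f \<Longrightarrow> continuous_on A (\<lambda>x. c *\<^sub>C f x)"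
  by (rule bounded_linear.continuous_on[OF bounded_linear_scaleC])

lemma tendsto_cinner [tendsto_intros]:
  "(f \<longlongrightarrow> x) F \<Longrightarrow> (g \<longlongrightarrow> y) F \<Longrightarrow> ((\<lambda>n. cinner (f n) (g n)) \<longlongrightarrow> cinner x y) F"
  unfolding cinner_eq_inner by (intro tendsto_intros)

subsection \<open>Unit vectors\<close>

lift_definition unit_vec :: "nat \<Rightarrow> ell2" is "\<lambda>k n. if n = k then 1 else 0"
  by (rule summable_finite[of "{_}"]) auto

lemma cinner_unit_vec: "cinner x (unit_vec k) = coeff x k"
proof -
  have "(\<lambda>n. if n = k then coeff x n else 0) sums coeff x k" by (rule sums_single)
  then have "(\<lambda>n. coeff x n * cnj (coeff (unit_vec k) n)) sums coeff x k"
    by (rule sums_cong[THEN iffD1, rotated]) (auto simp: unit_vec.rep_eq)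
  then show ?thesis using cinner_sums sums_unique2 by blast
qed

lemma coeff_sum: "coeff (\<Sum>k\<in>A. f k) n = (\<Sum>k\<in>A. coeff (f k) n)"
  by (induction A rule: infinite_finite_induct) (auto simp: coeff_simps)

lemma coeff_truncation:
  "coeff (\<Sum>k<N. coeff x k *\<^sub>C unit_vec k) n = (if n < N then coeff x n else 0)"
  by (simp add: coeff_sum coeff_simps unit_vec.rep_eq if_distrib cong: if_cong)

lemma unit_vec_expansion: "(\<lambda>n. coeff x n *\<^sub>C unit_vec n) sums x"
proof -
  let ?t = "\<lambda>N. \<Sum>k<N. coeff x k *\<^sub>C unit_vec k"
  have n2: "(norm (x - ?t N))\<^sup>2 = (norm x)\<^sup>2 - (\<Sum>n<N. (cmod (coeff x n))\<^sup>2)" for N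
  proof -
    have "(\<lambda>n. (cmod (coeff x n))\<^sup>2 - (if n \<in> {..<N} then (cmod (coeff x n))\<^sup>2 else 0)) sums
        ((norm x)\<^sup>2 - (\<Sum>n<N. (cmod (coeff x n))\<^sup>2))"
      by (intro sums_diff norm_ell2_sums sums_If_finite_set) simp
    also have "(\<lambda>n. (cmod (coeff x n))\<^sup>2 - (if n \<in> {..<N} then (cmod (coeff x n))\<^sup>2 else 0))
      = (\<lambda>n. (cmod (coeff (x - ?t N) n))\<^sup>2)"
      by (auto simp: coeff_simps(4) coeff_truncation)
    finally show ?thesis using norm_ell2_sums sums_unique2 by blast
  qed
  have "(\<lambda>N. (norm x)\<^sup>2 - (\<Sum>n<N. (cmod (coeff x n))\<^sup>2)) \<longlonglongrightarrow> (norm x)\<^sup>2 - (norm x)\<^sup>2"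
    using norm_ell2_sums[of x] unfolding sums_def by (intro tendsto_intros)
  then have "(\<lambda>N. sqrt ((norm (x - ?t N))\<^sup>2)) \<longlonglongrightarrow> sqrt 0"
    unfolding n2 by (intro tendsto_real_sqrt) simp
  then have "(\<lambda>N. norm (x - ?t N)) \<longlonglongrightarrow> 0" by simp
  then have "(\<lambda>N. norm (?t N - x)) \<longlonglongrightarrow> 0" by (simp only: norm_minus_commute)
  then show ?thesis unfolding sums_def by (simp add: LIM_zero_iff tendsto_norm_zero_iff)
qed

subsection \<open>Bounded complex-linear operators and adjoints\<close>

definition bounded_clinear :: "(ell2 \<Rightarrow> ell2) \<Rightarrow> bool" where
  "bounded_clinear T \<longleftrightarrow> bounded_linear T \<and> (\<forall>c x. T (c *\<^sub>C x) = c *\<^sub>C T x)"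

lemma bounded_clinearD:
  assumes "bounded_clinear T"
  shows "bounded_linear T" "linear T" "T (c *\<^sub>C x) = c *\<^sub>C T x" "T (x + y) = T x + T y"
    "T (x - y) = T x - T y" "T 0 = 0"
proof -
  show b: "bounded_linear T" "T (c *\<^sub>C x) = c *\<^sub>C T x"
    using assms by (auto simp: bounded_clinear_def)
  show l: "linear T" using b(1) by (simp add: bounded_linear.linear)
  show "T (x + y) = T x + T y" "T (x - y) = T x - T y" "T 0 = 0"
    using l by (simp_all add: linear_add linear_diff linear_0)
qed

lemma bounded_clinearI:
  assumes "\<And>x y. T (x + y) = T x + T y" "\<And>c x. T (c *\<^sub>C x) = c *\<^sub>C T x"
    "\<And>x. norm (T x) \<le> C * norm x"
  shows "bounded_clinear T"
  unfolding bounded_clinear_def using assms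
  by (auto intro!: bounded_linear_intro[of _ C] simp: scaleR_eq_scaleC mult.commute)

text \<open>Testing \<open>cinner (T x) y = cinner x (adj T y)\<close> on the unit vectors forces the coefficients; that they are
  square-summable is part of \<open>coeff_adj_norm\<close>.\<close>

definition adj :: "(ell2 \<Rightarrow> ell2) \<Rightarrow> ell2 \<Rightarrow> ell2" where
  "adj T y = Abs_ell2 (\<lambda>n. cinner y (T (unit_vec n)))"

lemma coeff_adj_norm:
  assumes T: "bounded_clinear T" and C: "\<And>x. norm (T x) \<le> C * norm x" "C \<ge> 0"
  shows "coeff (adj T y) = (\<lambda>n. cinner y (T (unit_vec n))) \<and> norm (adj T y) \<le> C * norm y"
proof -
  let ?c = "\<lambda>n. cinner y (T (unit_vec n))"
  have "(\<Sum>n<N. (cmod (?c n))\<^sup>2) \<le> (C * norm y)\<^sup>2" for N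
  proof -
    \<comment> \<open>Test the functional against its own truncation \<open>h\<close>: this bounds the square of the norm
      of \<open>h\<close> by a multiple of that norm.\<close>
    define h where "h = (\<Sum>n<N. ?c n *\<^sub>C unit_vec n)"
    let ?S = "\<Sum>n<N. (cmod (?c n))\<^sup>2"
    have hc: "coeff h n = (if n \<in> {..<N} then ?c n else 0)" for n
      by (simp add: h_def coeff_sum coeff_simps unit_vec.rep_eq if_distrib cong: if_cong)
    have "(\<lambda>n. if n \<in> {..<N} then (cmod (?c n))\<^sup>2 else 0) sums ?S"
      by (intro sums_If_finite_set) simp
    also have "(\<lambda>n. if n \<in> {..<N} then (cmod (?c n))\<^sup>2 else 0) = (\<lambda>n. (cmod (coeff h n))\<^sup>2)"
      by (auto simp: hc)
    finally have nh: "(norm h)\<^sup>2 = ?S" using norm_ell2_sums sums_unique2 by blast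
    have "T h = (\<Sum>n<N. ?c n *\<^sub>C T (unit_vec n))"
      unfolding h_def using bounded_clinearD(2,3)[OF T] by (simp add: linear_sum)
    moreover have "cinner y (\<Sum>n\<in>A. f n) = (\<Sum>n\<in>A. cinner y (f n))" for f :: "nat \<Rightarrow> ell2" and A
      by (induction A rule: infinite_finite_induct) (auto simp: cinner_add_right)
    ultimately have "cinner y (T h) = (\<Sum>n<N. cnj (?c n) * ?c n)" by simp
    also have "\<dots> = complex_of_real ?S"
      by (simp add: complex_norm_square mult.commute del: of_real_power)
    finally have "?S = cmod (cinner y (T h))" by (simp add: sum_nonneg del: of_real_sum)
    also have "\<dots> \<le> norm y * norm (T h)" by (rule cinner_Cauchy_Schwarz)
    also have "\<dots> \<le> norm y * (C * norm h)" by (intro mult_left_mono C) simp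
    finally have "(norm h)\<^sup>2 \<le> (C * norm y) * norm h" by (simp add: nh mult_ac)
    then have "norm h \<le> C * norm y"
      by (cases "norm h = 0") (use C in \<open>auto simp: power2_eq_square\<close>)
    then have "(norm h)\<^sup>2 \<le> (C * norm y)\<^sup>2" by (intro power_mono) auto
    then show ?thesis by (simp add: nh)
  qed
  from ell2_from_bounded_sums[OF this] C obtain z where "coeff z = ?c" "norm z \<le> C * norm y" by auto
  moreover from this have "adj T y = z" by (metis adj_def coeff_inverse)
  ultimately show ?thesis by simp
qed

lemma bounded_clinear_bound:
  assumes "bounded_clinear T"
  shows "\<exists>C\<ge>0. \<forall>x. norm (T x) \<le> C * norm x"
  using bounded_linear.nonneg_bounded[OF bounded_clinearD(1)[OF assms]] by (simp add: mult.commute)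

lemma cinner_adj:
  assumes T: "bounded_clinear T"
  shows "cinner (T x) y = cinner x (adj T y)"
proof -
  obtain C where C: "C \<ge> 0" "\<And>x. norm (T x) \<le> C * norm x"
    using bounded_clinear_bound[OF T] by blast
  have "(\<lambda>n. T (coeff x n *\<^sub>C unit_vec n)) sums T x"
    by (intro bounded_linear.sums[OF bounded_clinearD(1)[OF T]] unit_vec_expansion)
  moreover have "bounded_linear (\<lambda>x. cinner x y)"
    by (rule bounded_linear_intro[of _ "norm y"])
      (auto simp: cinner_add_left scaleR_eq_scaleC scaleR_conv_of_real cinner_Cauchy_Schwarz)
  ultimately have "(\<lambda>n. cinner (T (coeff x n *\<^sub>C unit_vec n)) y) sums cinner (T x) y"
    using bounded_linear.sums by blast
  moreover have "cinner (T (coeff x n *\<^sub>C unit_vec n)) y = coeff x n * cnj (coeff (adj T y) n)" for n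
    using coeff_adj_norm[OF T C(2,1), of y]
    by (simp add: bounded_clinearD(3)[OF T] flip: cinner_commute)
  ultimately show ?thesis using cinner_sums sums_unique2 by (metis (no_types, lifting) sums_cong)
qed

lemma cinner_adj': "bounded_clinear T \<Longrightarrow> cinner (adj T x) y = cinner x (T y)"
  by (metis cinner_adj cinner_commute)

lemma inner_adj: "bounded_clinear T \<Longrightarrow> inner (T x) y = inner x (adj T y)"
  by (metis cinner_adj Re_cinner)

lemma adj_unique:
  assumes "bounded_clinear T" "\<And>x. cinner (T x) y = cinner x z"
  shows "adj T y = z"
  by (rule cinner_nondegenerate) (metis assms cinner_adj)

lemma bounded_clinear_adj:
  assumes T: "bounded_clinear T"
  shows "bounded_clinear (adj T)"
proof -
  obtain C where C: "C \<ge> 0" "\<And>x. norm (T x) \<le> C * norm x"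
    using bounded_clinear_bound[OF T] by blast
  show ?thesis
  proof (rule bounded_clinearI)
    show "norm (adj T x) \<le> C * norm x" for x using coeff_adj_norm[OF T C(2,1)] by blast
    show "adj T (x + y) = adj T x + adj T y" for x y
      by (rule adj_unique[OF T]) (simp add: cinner_add_right cinner_adj[OF T])
    show "adj T (c *\<^sub>C x) = c *\<^sub>C adj T x" for c x
      by (rule adj_unique[OF T]) (simp add: cinner_adj[OF T])
  qed
qed

lemma norm_adj_le:
  assumes "bounded_clinear T" "\<And>x. norm (T x) \<le> C * norm x" "C \<ge> 0"
  shows "norm (adj T y) \<le> C * norm y"
  using coeff_adj_norm[OF assms] by blast

lemma bounded_clinear_comp:
  "bounded_clinear S \<Longrightarrow> bounded_clinear T \<Longrightarrow> bounded_clinear (\<lambda>x. S (T x))"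
  unfolding bounded_clinear_def by (auto intro: bounded_linear_compose)

section \<open>The Hardy space as a sequence space\<close>

text \<open>Evaluation at a point of the disc is the inner product with the Szego kernel. Outside the disc the
  kernel is \<open>0\<close>, so that \<open>fun_of x\<close> vanishes there like every member of \<open>disc_analytic\<close>.\<close>

lift_definition szego :: "complex \<Rightarrow> ell2" is "\<lambda>\<omega> n. if cmod \<omega> < 1 then cnj \<omega> ^ n else 0"
proof -
  fix \<omega> :: complex
  show "summable (\<lambda>n. (cmod (if cmod \<omega> < 1 then cnj \<omega> ^ n else 0))\<^sup>2)"
  proof (cases "cmod \<omega> < 1")
    case True
    then have "(cmod \<omega>)\<^sup>2 < 1" by (simp add: power_less_one_iff)
    then have "summable (\<lambda>n. ((cmod \<omega>)\<^sup>2) ^ n)" by (intro summable_geometric) simp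
    then show ?thesis using True by (simp add: norm_power power_mult [symmetric] mult.commute)
  qed simp
qed

definition fun_of :: "ell2 \<Rightarrow> complex \<Rightarrow> complex" where
  "fun_of x z = cinner x (szego z)"

lemma fun_of_sums: "cmod z < 1 \<Longrightarrow> (\<lambda>n. coeff x n * z ^ n) sums fun_of x z"
  using cinner_sums[of x "szego z"] by (simp add: fun_of_def szego.rep_eq)

lemma fun_of_outside: "\<not> cmod z < 1 \<Longrightarrow> fun_of x z = 0"
proof -
  assume "\<not> cmod z < 1"
  then have "szego z = 0" by (intro ell2_eqI) (simp add: szego.rep_eq coeff_simps)
  then show ?thesis by (simp add: fun_of_def)
qed

lemma fun_of_simps [simp]:
  "fun_of (x + y) z = fun_of x z + fun_of y z" "fun_of (x - y) z = fun_of x z - fun_of y z"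
  "fun_of (c *\<^sub>C x) z = c * fun_of x z" "fun_of 0 z = 0"
  by (simp_all add: fun_of_def cinner_add_left cinner_diff_left)

lemma holomorphic_fun_of: "fun_of x holomorphic_on ball 0 1"
  by (rule power_series_holomorphic[of 0 1 "coeff x"]) (simp add: fun_of_sums)

lemma taylor_coeff_unique:
  assumes "\<And>z. cmod z < 1 \<Longrightarrow> (\<lambda>n. a n * z ^ n) sums f z"
  shows "taylor_coeff f n = a n"
proof -
  have "\<forall>\<^sub>F z in nhds 0. z \<in> ball (0::complex) 1" by (intro eventually_nhds_in_open) auto
  then have "f has_fps_expansion Abs_fps a"
    by (intro has_fps_expansionI) (auto elim!: eventually_mono simp: assms)
  from fps_nth_fps_expansion[OF this, of n] show ?thesis by (simp add: taylor_coeff_def)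
qed

lemma taylor_coeff_fun_of [simp]: "taylor_coeff (fun_of x) = coeff x"
  by (intro ext taylor_coeff_unique fun_of_sums)

lemma disc_analytic_sums:
  assumes "f \<in> disc_analytic" "cmod z < 1"
  shows "(\<lambda>n. taylor_coeff f n * z ^ n) sums f z"
  using holomorphic_power_series[of f 0 1 z] assms by (simp add: disc_analytic_def taylor_coeff_def)

lemma fun_of_disc_analytic: "fun_of x \<in> disc_analytic"
  by (simp add: disc_analytic_def holomorphic_fun_of fun_of_outside)

lemma fun_of_H2: "fun_of x \<in> H2"
  by (simp add: H2_def fun_of_disc_analytic summable_coeff)

lemma fun_of_inject: "fun_of x = fun_of y \<longleftrightarrow> x = y"
  by (metis taylor_coeff_fun_of coeff_inject)

lemma fun_of_eqI: "(\<And>z. cmod z < 1 \<Longrightarrow> fun_of x z = fun_of y z) \<Longrightarrow> x = y"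
  by (metis ext fun_of_inject fun_of_outside)

definition of_fun :: "(complex \<Rightarrow> complex) \<Rightarrow> ell2" where
  "of_fun f = Abs_ell2 (taylor_coeff f)"

lemma of_fun_fun_of [simp]: "of_fun (fun_of x) = x"
  by (simp add: of_fun_def coeff_inverse)

lemma disc_analytic_eqI:
  assumes "f \<in> disc_analytic" "g \<in> disc_analytic" "taylor_coeff f = taylor_coeff g"
  shows "f = g"
proof
  fix z
  show "f z = g z"
  proof (cases "cmod z < 1")
    case True
    then show ?thesis
      using disc_analytic_sums[OF assms(1)] disc_analytic_sums[OF assms(2)] assms(3) sums_unique2
      by metis
  qed (use assms(1,2) in \<open>simp add: disc_analytic_def\<close>)
qed

lemma fun_of_of_fun [simp]:
  assumes "f \<in> H2"
  shows "fun_of (of_fun f) = f"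
proof (rule disc_analytic_eqI)
  show "taylor_coeff (fun_of (of_fun f)) = taylor_coeff f"
    using assms by (simp add: of_fun_def H2_def Abs_ell2_inverse)
qed (use assms in \<open>auto simp: fun_of_disc_analytic H2_def\<close>)

lemma H2_eq_range: "H2 = range fun_of"
  using fun_of_H2 fun_of_of_fun by (metis UNIV_I image_eqI image_subset_iff subsetI subset_antisym)

lemma H2_inner_fun_of [simp]: "H2_inner (fun_of x) (fun_of y) = cinner x y"
  by (simp add: H2_inner_def cinner_def)

lemma H2_norm_fun_of [simp]: "H2_norm (fun_of x) = norm x"
  by (simp add: H2_norm_def cinner_self)

lemma fun_of_unit_vec: "cmod z < 1 \<Longrightarrow> fun_of (unit_vec k) z = z ^ k"
proof (rule sums_unique2)
  assume "cmod z < 1"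
  from fun_of_sums[OF this, of "unit_vec k"]
  show "(\<lambda>n. if n = k then z ^ n else 0) sums fun_of (unit_vec k) z"
    by (rule sums_cong[THEN iffD1, rotated]) (simp add: unit_vec.rep_eq)
  show "(\<lambda>n. if n = k then z ^ n else 0) sums z ^ k" by (rule sums_single)
qed

lemma fun_of_szego: "cmod \<omega> < 1 \<Longrightarrow> cmod z < 1 \<Longrightarrow> fun_of (szego \<omega>) z = 1 / (1 - cnj \<omega> * z)"
proof -
  assume *: "cmod \<omega> < 1" "cmod z < 1"
  then have "cmod (cnj \<omega> * z) < 1" using mult_strict_mono[of "cmod \<omega>" 1 "cmod z" 1] 
    by (simp add: norm_mult)
  then have "(\<lambda>n. (cnj \<omega> * z) ^ n) sums (1 / (1 - cnj \<omega> * z))" by (rule geometric_sums)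
  moreover have "(\<lambda>n. (cnj \<omega> * z) ^ n) sums fun_of (szego \<omega>) z"
    using fun_of_sums[OF *(2), of "szego \<omega>"] *(1) by (simp add: szego.rep_eq power_mult_distrib)
  ultimately show ?thesis by (rule sums_unique2[symmetric])
qed

section \<open>Means over circles\<close>

abbreviation circle_measure :: "real measure" where
  "circle_measure \<equiv> lebesgue_on {0..2 * pi}"

lemma circle_integrable:
  fixes f :: "real \<Rightarrow> 'b::euclidean_space"
  shows "continuous_on {0..2 * pi} f \<Longrightarrow> integrable circle_measure f"
  by (rule continuous_imp_integrable_real)

lemma circle_measurable:
  fixes f :: "real \<Rightarrow> 'b::euclidean_space"
  shows "continuous_on {0..2 * pi} f \<Longrightarrow> f \<in> borel_measurable circle_measure"
  by (rule borel_measurable_integrable[OF circle_integrable])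

lemma integral_cis_int:
  "(LINT t|circle_measure. cis (of_int k * t)) = (if k = 0 then 2 * pi else 0)"
proof -
  have "integrable circle_measure (\<lambda>t. cis (of_int k * t))"
    by (intro circle_integrable continuous_intros)
  then have eq: "(LINT t|circle_measure. cis (of_int k * t)) = integral {0..2 * pi} (\<lambda>t. cis (of_int k * t))"
    by (rule lebesgue_integral_eq_integral) simp
  show ?thesis
  proof (cases "k = 0")
    case False
    have "((\<lambda>t. cis (of_int k * t)) has_integral
        (cis (of_int k * (2 * pi)) / (\<i> * of_int k) - cis (of_int k * 0) / (\<i> * of_int k))) {0..2 * pi}"
    proof (rule fundamental_theorem_of_calculus)
      show "((\<lambda>t. cis (of_int k * t) / (\<i> * of_int k)) has_vector_derivative cis (of_int k * t))
          (at t within {0..2 * pi})" for t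
        unfolding cis_conv_exp using False
        by (auto intro!: derivative_eq_intros has_vector_derivative_real_field simp: field_simps)
    qed simp
    moreover have "cis (of_int k * (2 * pi)) = 1"
      using cis_multiple_2pi[of "of_int k"] by (simp add: mult_ac)
    ultimately have "integral {0..2 * pi} (\<lambda>t. cis (of_int k * t)) = 0"
      by (intro integral_unique) simp
    then show ?thesis using eq False by simp
  qed (use eq in \<open>simp add: content_real scaleR_conv_of_real\<close>)
qed

text \<open>Termwise integration against an integrable weight. It yields Fourier coefficients on circles,
  Parseval's formula (with the function itself as the weight) and the expansion of the Herglotz integral.\<close>

lemma integral_bounded_series:
  fixes c :: "nat \<Rightarrow> complex"
  assumes h: "integrable M h" and u: "\<And>n. u n \<in> borel_measurable M" "\<And>n t. cmod (u n t) \<le> 1"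
    and c: "summable (\<lambda>n. cmod (c n))"
  shows "(\<lambda>n. c n * (LINT t|M. h t * u n t)) sums (LINT t|M. h t * (\<Sum>n. c n * u n t))"
    "integrable M (\<lambda>t. h t * (\<Sum>n. c n * u n t))"
proof -
  have s: "summable (\<lambda>n. c n * u n t)" for t
    by (rule summable_norm_cancel, rule summable_comparison_test'[OF c])
      (simp add: norm_mult mult_left_le u)
  have hu: "integrable M (\<lambda>t. h t * u n t)" for n
  proof (rule Bochner_Integration.integrable_bound[OF h])
    show "(\<lambda>t. h t * u n t) \<in> borel_measurable M"
      using h u by (intro borel_measurable_times) auto
    show "AE t in M. norm (h t * u n t) \<le> norm (h t)"
      by (rule AE_I2) (simp add: norm_mult mult_left_le u)
  qed
  have int: "integrable M (\<lambda>t. c n * (h t * u n t))" for n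
    using hu by simp
  have S: "summable (\<lambda>n. LINT t|M. norm (c n * (h t * u n t)))"
  proof (rule summable_comparison_test'[OF summable_mult2[OF c]])
    fix n
    have "(LINT t|M. norm (c n * (h t * u n t))) \<le> (LINT t|M. cmod (c n) * norm (h t))"
      by (intro integral_mono integrable_norm int integrable_mult_right h)
        (auto simp: norm_mult intro!: mult_left_mono mult_left_le u)
    then show "norm (LINT t|M. norm (c n * (h t * u n t))) \<le> cmod (c n) * (LINT t|M. norm (h t))"
      by (simp add: integral_nonneg)
  qed
  have A: "AE t in M. summable (\<lambda>n. norm (c n * (h t * u n t)))"
  proof (rule AE_I2)
    fix t
    show "summable (\<lambda>n. norm (c n * (h t * u n t)))"
      by (rule summable_comparison_test'[OF summable_mult2[OF c, of "norm (h t)"]])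
        (auto simp: norm_mult intro!: mult_left_mono mult_left_le u)
  qed
  have eq: "(\<Sum>n. c n * (h t * u n t)) = h t * (\<Sum>n. c n * u n t)" for t
    using suminf_mult[OF s, of "h t" t] by (simp add: mult_ac)
  show "(\<lambda>n. c n * (LINT t|M. h t * u n t)) sums (LINT t|M. h t * (\<Sum>n. c n * u n t))"
    using sums_integral[OF int A S] by (simp add: eq)
  show "integrable M (\<lambda>t. h t * (\<Sum>n. c n * u n t))"
    using integrable_suminf[OF int A S] by (simp add: eq)
qed

lemma disc_analytic_summable_norm:
  assumes "f \<in> disc_analytic" "0 \<le> r" "r < 1"
  shows "summable (\<lambda>n. cmod (taylor_coeff f n * of_real (r ^ n)))"
proof -
  have "summable (\<lambda>n. taylor_coeff f n * of_real ((r + 1) / 2) ^ n)"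
    using assms disc_analytic_sums[OF assms(1), of "of_real ((r + 1) / 2)"]
    by (intro sums_summable) (auto simp: norm_of_real simp del: of_real_divide of_real_add)
  from powser_insidea[OF this, of "of_real r"] assms show ?thesis
    by (simp del: of_real_divide of_real_add)
qed

lemma cis_int_mult: "cis (of_int (int n) * t) = cis t ^ n"
  by (simp add: Complex.DeMoivre)

lemma disc_analytic_circle_series:
  assumes "f \<in> disc_analytic" "0 \<le> r" "r < 1"
  shows "f (of_real r * cis t) = (\<Sum>n. (taylor_coeff f n * of_real (r ^ n)) * cis (of_int (int n) * t))"
  using disc_analytic_sums[OF assms(1), of "of_real r * cis t"] assms
  by (intro sums_unique)
    (simp add: norm_mult power_mult_distrib cis_int_mult mult.assoc del: of_int_of_nat_eq)

lemma continuous_on_circle: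
  assumes "f \<in> disc_analytic" "0 \<le> r" "r < 1"
  shows "continuous_on A (\<lambda>t. f (of_real r * cis t))"
proof (rule continuous_on_compose2[of "ball 0 1" f])
  show "continuous_on (ball 0 1) f"
    using assms by (intro holomorphic_on_imp_continuous_on) (simp add: disc_analytic_def)
qed (use assms in \<open>auto intro!: continuous_intros simp: norm_mult\<close>)

lemma circle_fourier_coeff:
  assumes f: "f \<in> disc_analytic" and r: "0 \<le> r" "r < 1"
  shows "(LINT t|circle_measure. f (of_real r * cis t) * cis (- of_int (int m) * t))
    = 2 * pi * (taylor_coeff f m * of_real (r ^ m))"
proof -
  let ?c = "\<lambda>n. taylor_coeff f n * of_real (r ^ n)"
  have "(\<lambda>n. ?c n * (LINT t|circle_measure. cis (- of_int (int m) * t) * cis (of_int (int n) * t)))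
      sums (LINT t|circle_measure. cis (- of_int (int m) * t) * (\<Sum>n. ?c n * cis (of_int (int n) * t)))"
    by (intro integral_bounded_series circle_integrable circle_measurable continuous_intros
        disc_analytic_summable_norm f r) simp
  also have "(\<lambda>t. cis (- of_int (int m) * t) * (\<Sum>n. ?c n * cis (of_int (int n) * t)))
      = (\<lambda>t. f (of_real r * cis t) * cis (- of_int (int m) * t))"
    by (rule ext, subst mult.commute, subst disc_analytic_circle_series[OF f r], rule refl)
  also have "(\<lambda>n. ?c n * (LINT t|circle_measure. cis (- of_int (int m) * t) * cis (of_int (int n) * t)))
      = (\<lambda>n. if n = m then 2 * pi * ?c n else 0)"
  proof
    fix n
    have "cis (- of_int (int m) * t) * cis (of_int (int n) * t) = cis (of_int (int n - int m) * t)" for t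
      by (simp add: cis_mult algebra_simps)
    then show "?c n * (LINT t|circle_measure. cis (- of_int (int m) * t) * cis (of_int (int n) * t))
      = (if n = m then 2 * pi * ?c n else 0)"
      using integral_cis_int[of "int n - int m"] by simp
  qed
  finally show ?thesis by (rule sums_unique2) (rule sums_single)
qed

lemma circle_parseval:
  assumes f: "f \<in> disc_analytic" and r: "0 \<le> r" "r < 1"
  shows "(\<lambda>n. (cmod (taylor_coeff f n))\<^sup>2 * (r\<^sup>2) ^ n) sums
    ((LINT t|circle_measure. (cmod (f (of_real r * cis t)))\<^sup>2) / (2 * pi))"
proof -
  let ?c = "\<lambda>n. taylor_coeff f n * of_real (r ^ n)"
  have "(\<lambda>n. cnj (?c n) * (LINT t|circle_measure. f (of_real r * cis t) * cis (- of_int (int n) * t)))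
      sums (LINT t|circle_measure. f (of_real r * cis t) * (\<Sum>n. cnj (?c n) * cis (- of_int (int n) * t)))"
    using disc_analytic_summable_norm[OF f r]
    by (intro integral_bounded_series circle_integrable circle_measurable continuous_intros
        continuous_on_circle f r) (simp_all add: norm_mult)
  also have "(\<lambda>n. cnj (?c n) * (LINT t|circle_measure. f (of_real r * cis t) * cis (- of_int (int n) * t)))
    = (\<lambda>n. of_real ((cmod (taylor_coeff f n))\<^sup>2 * (r\<^sup>2) ^ n * (2 * pi)))"
  proof
    fix n
    have "cmod (of_real (r ^ n)) = r ^ n" using r by (simp only: norm_of_real abs_of_nonneg zero_le_power)
    then have n: "(cmod (?c n))\<^sup>2 = (cmod (taylor_coeff f n))\<^sup>2 * (r\<^sup>2) ^ n"
      by (simp only: norm_mult power_mult_distrib power_mult [symmetric] mult.commute[of n])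
    have "cnj (?c n) * (2 * pi * ?c n) = (?c n * cnj (?c n)) * complex_of_real (2 * pi)"
      by (simp only: mult_ac of_real_mult)
    also have "\<dots> = of_real ((cmod (?c n))\<^sup>2 * (2 * pi))"
      by (simp only: complex_norm_square [symmetric] of_real_mult)
    finally show "cnj (?c n) * (LINT t|circle_measure. f (of_real r * cis t) * cis (- of_int (int n) * t))
      = of_real ((cmod (taylor_coeff f n))\<^sup>2 * (r\<^sup>2) ^ n * (2 * pi))"
      unfolding circle_fourier_coeff[OF f r] n .
  qed
  also have "(\<lambda>t. f (of_real r * cis t) * (\<Sum>n. cnj (?c n) * cis (- of_int (int n) * t)))
    = (\<lambda>t. of_real ((cmod (f (of_real r * cis t)))\<^sup>2))"
  proof
    fix t
    have "summable (\<lambda>n. ?c n * cis (of_int (int n) * t))"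
      by (rule summable_norm_cancel) (use disc_analytic_summable_norm[OF f r] in \<open>simp add: norm_mult\<close>)
    from sums_cnj[THEN iffD2, OF summable_sums[OF this]]
    have "cnj (f (of_real r * cis t)) = (\<Sum>n. cnj (?c n) * cis (- of_int (int n) * t))"
      unfolding disc_analytic_circle_series[OF f r, of t]
      by (intro sums_unique) (simp add: cis_cnj)
    then show "f (of_real r * cis t) * (\<Sum>n. cnj (?c n) * cis (- of_int (int n) * t))
        = of_real ((cmod (f (of_real r * cis t)))\<^sup>2)"
      by (simp only: complex_norm_square)
  qed
  finally have "(\<lambda>n. (cmod (taylor_coeff f n))\<^sup>2 * (r\<^sup>2) ^ n * (2 * pi)) sums
      (LINT t|circle_measure. (cmod (f (of_real r * cis t)))\<^sup>2)"
    by (simp only: integral_complex_of_real sums_of_real_iff)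
  from sums_divide[OF this, of "2 * pi"] show ?thesis by simp
qed

section \<open>Multiplication operators\<close>

lemma HinfD:
  assumes "b \<in> Hinf"
  shows "b \<in> disc_analytic" "\<exists>C\<ge>0. \<forall>z. cmod (b z) \<le> C"
proof -
  show b: "b \<in> disc_analytic" using assms by (simp add: Hinf_def)
  from assms obtain C where C: "\<forall>z\<in>ball 0 1. cmod (b z) \<le> C"
    unfolding Hinf_def bounded_iff by blast
  then have "cmod (b z) \<le> max C 0" for z
    using b by (cases "z \<in> ball 0 1") (auto simp: disc_analytic_def le_max_iff_disj simp del: mem_ball)
  then show "\<exists>C\<ge>0. \<forall>z. cmod (b z) \<le> C" by (intro exI[of _ "max C 0"]) auto
qed

lemma Hinf1D:
  assumes "b \<in> Hinf1"
  shows "b \<in> Hinf" "cmod (b z) \<le> 1"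
proof -
  show b: "b \<in> Hinf" using assms by (simp add: Hinf1_def)
  show "cmod (b z) \<le> 1"
  proof (cases "z \<in> ball 0 1")
    case True
    have "cmod (b z) \<le> Hinf_norm b" unfolding Hinf_norm_def
    proof (rule cSUP_upper[OF True])
      show "bdd_above ((\<lambda>z. cmod (b z)) ` ball 0 1)"
        using HinfD(2)[OF b] by (auto simp: bdd_above_def)
    qed
    then show ?thesis using assms by (simp add: Hinf1_def)
  qed (use HinfD(1)[OF b] in \<open>auto simp: disc_analytic_def\<close>)
qed

lemma HinfI:
  assumes "b holomorphic_on ball 0 1" "\<And>z. \<not> cmod z < 1 \<Longrightarrow> b z = 0"
    "\<And>z. cmod z < 1 \<Longrightarrow> cmod (b z) \<le> C"
  shows "b \<in> Hinf"
  using assms by (auto simp: Hinf_def disc_analytic_def bounded_iff intro!: exI[of _ C])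

lemma disc_analytic_mult:
  "f \<in> disc_analytic \<Longrightarrow> g \<in> disc_analytic \<Longrightarrow> (\<lambda>z. f z * g z) \<in> disc_analytic"
  by (auto simp: disc_analytic_def intro: holomorphic_intros)

text \<open>By Parseval's formula the pointwise bound compares the sums of squares on every circle of radius
  \<open>r < 1\<close>; the limit \<open>r \<rightarrow> 1\<close> is taken in finite partial sums.\<close>

lemma exists_bounded_multiple:
  assumes b: "b \<in> disc_analytic" and C: "\<And>z. cmod (b z) \<le> C"
  shows "\<exists>y. fun_of y = (\<lambda>z. b z * fun_of x z) \<and> norm y \<le> C * norm x"
proof -
  have C0: "0 \<le> C" using C norm_ge_zero order_trans by blast
  let ?g = "\<lambda>z. b z * fun_of x z"
  have g: "?g \<in> disc_analytic" by (intro disc_analytic_mult b fun_of_disc_analytic)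
  have "(\<Sum>n<N. (cmod (taylor_coeff ?g n))\<^sup>2) \<le> (C * norm x)\<^sup>2" for N
  proof -
    have le: "(\<Sum>n<N. (cmod (taylor_coeff ?g n))\<^sup>2 * (r\<^sup>2) ^ n) \<le> (C * norm x)\<^sup>2" if r: "0 < r" "r < 1" for r :: real
    proof -
      let ?I = "\<lambda>f. (LINT t|circle_measure. (cmod (f (of_real r * cis t)))\<^sup>2)"
      have r': "0 \<le> r" using r by simp
      have "(\<Sum>n<N. (cmod (taylor_coeff ?g n))\<^sup>2 * (r\<^sup>2) ^ n) \<le> ?I ?g / (2 * pi)"
        using circle_parseval[OF g r' r(2)]
        by (metis (no_types, lifting) sums_unique sums_summable sum_le_suminf finite_lessThan
            mult_nonneg_nonneg zero_le_power2 zero_le_power)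
      also have "?I ?g \<le> (LINT t|circle_measure. C\<^sup>2 * (cmod (fun_of x (of_real r * cis t)))\<^sup>2)"
      proof (rule integral_mono)
        show "integrable circle_measure (\<lambda>t. (cmod (?g (of_real r * cis t)))\<^sup>2)"
          by (intro circle_integrable continuous_intros continuous_on_circle[OF g] r r')
        show "integrable circle_measure (\<lambda>t. C\<^sup>2 * (cmod (fun_of x (of_real r * cis t)))\<^sup>2)"
          by (intro circle_integrable continuous_intros continuous_on_circle[OF fun_of_disc_analytic] r r')
        show "(cmod (?g (of_real r * cis t)))\<^sup>2 \<le> C\<^sup>2 * (cmod (fun_of x (of_real r * cis t)))\<^sup>2" for t
          unfolding norm_mult power_mult_distrib by (intro mult_right_mono power_mono C) auto
      qed
      also have "\<dots> / (2 * pi) = C\<^sup>2 * (?I (fun_of x) / (2 * pi))" by simp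
      also have "?I (fun_of x) / (2 * pi) \<le> (norm x)\<^sup>2"
      proof (rule sums_le[OF _ circle_parseval[OF fun_of_disc_analytic r' r(2)] norm_ell2_sums])
        have "(r\<^sup>2) ^ n \<le> 1" for n using r by (intro power_le_one) (auto intro: power_le_one)
        then show "(cmod (taylor_coeff (fun_of x) n))\<^sup>2 * (r\<^sup>2) ^ n \<le> (cmod (coeff x n))\<^sup>2" for n
          by (simp add: mult_left_le)
      qed
      finally show ?thesis by (simp add: power_mult_distrib divide_right_mono mult_left_mono)
    qed
    show ?thesis
    proof (rule tendsto_upperbound)
      have "((\<lambda>r. \<Sum>n<N. (cmod (taylor_coeff ?g n))\<^sup>2 * (r\<^sup>2) ^ n) \<longlongrightarrow>
          (\<Sum>n<N. (cmod (taylor_coeff ?g n))\<^sup>2 * (1\<^sup>2) ^ n)) (at_left (1::real))"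
        by (intro tendsto_intros)
      then show "((\<lambda>r. \<Sum>n<N. (cmod (taylor_coeff ?g n))\<^sup>2 * (r\<^sup>2) ^ n) \<longlongrightarrow>
          (\<Sum>n<N. (cmod (taylor_coeff ?g n))\<^sup>2)) (at_left (1::real))" by simp
      show "\<forall>\<^sub>F r in at_left 1. (\<Sum>n<N. (cmod (taylor_coeff ?g n))\<^sup>2 * (r\<^sup>2) ^ n) \<le> (C * norm x)\<^sup>2"
        unfolding eventually_at_left_field using le by (intro exI[of _ 0]) simp
    qed simp
  qed
  from ell2_from_bounded_sums[OF this] C0 obtain y where
    y: "coeff y = taylor_coeff ?g" "norm y \<le> C * norm x" by auto
  then have "fun_of y = ?g"
    by (intro disc_analytic_eqI fun_of_disc_analytic g) simp
  with y show ?thesis by blast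
qed

definition mult :: "(complex \<Rightarrow> complex) \<Rightarrow> ell2 \<Rightarrow> ell2" where
  "mult b x = of_fun (\<lambda>z. b z * fun_of x z)"

lemma fun_of_mult [simp]:
  assumes "b \<in> Hinf"
  shows "fun_of (mult b x) z = b z * fun_of x z"
  using exists_bounded_multiple[OF HinfD(1)[OF assms]] HinfD(2)[OF assms]
  by (metis mult_def of_fun_fun_of)

lemma norm_mult_le:
  assumes "b \<in> Hinf" "\<And>z. cmod (b z) \<le> C"
  shows "norm (mult b x) \<le> C * norm x"
  using exists_bounded_multiple[OF HinfD(1)[OF assms(1)] assms(2)] by (metis mult_def of_fun_fun_of)

lemma bounded_clinear_mult:
  assumes b: "b \<in> Hinf"
  shows "bounded_clinear (mult b)"
proof -
  obtain C where C: "\<And>z. cmod (b z) \<le> C" using HinfD(2)[OF b] by blast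
  show ?thesis
    by (rule bounded_clinearI[of _ C])
      (auto intro!: fun_of_eqI norm_mult_le simp: b C algebra_simps)
qed

lemma mult_commute: "a \<in> Hinf \<Longrightarrow> b \<in> Hinf \<Longrightarrow> mult a (mult b x) = mult b (mult a x)"
  by (rule fun_of_eqI) simp

lemma adj_mult_szego:
  assumes "b \<in> Hinf"
  shows "adj (mult b) (szego \<omega>) = cnj (b \<omega>) *\<^sub>C szego \<omega>"
  by (rule adj_unique[OF bounded_clinear_mult[OF assms]])
    (use fun_of_mult[OF assms] in \<open>simp add: fun_of_def\<close>)

lemma adj_mult_commute:
  assumes "a \<in> Hinf" "b \<in> Hinf"
  shows "adj (mult a) (adj (mult b) x) = adj (mult b) (adj (mult a) x)"
  by (rule adj_unique) (metis assms bounded_clinear_mult cinner_adj mult_commute)+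

subsection \<open>The backward shift\<close>

text \<open>The backward shift is the adjoint of multiplication by the coordinate function, which makes it commute
  with all adjoints of multiplication operators.\<close>

abbreviation disc_id :: "complex \<Rightarrow> complex" where
  "disc_id \<equiv> \<lambda>z. if cmod z < 1 then z else 0"

lemma disc_id_Hinf: "disc_id \<in> Hinf"
proof (rule HinfI[of _ 1])
  show "disc_id holomorphic_on ball 0 1"
    by (rule holomorphic_transform[of "\<lambda>z. z"]) (auto intro: holomorphic_intros)
qed auto

lemma coeff_bshift: "coeff (adj (mult disc_id) x) n = coeff x (Suc n)"
proof -
  have "mult disc_id (unit_vec n) = unit_vec (Suc n)"
    by (rule fun_of_eqI) (simp add: disc_id_Hinf fun_of_unit_vec)
  then show ?thesis
    by (metis bounded_clinear_mult cinner_adj' cinner_unit_vec disc_id_Hinf)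
qed

lemma backward_shift_fun_of: "backward_shift (fun_of x) = fun_of (adj (mult disc_id) x)"
proof
  fix z
  let ?y = "adj (mult disc_id) x"
  have z0: "fun_of v 0 = coeff v 0" for v
    by (rule sums_unique2[OF fun_of_sums powser_sums_zero]) simp
  show "backward_shift (fun_of x) z = fun_of ?y z"
  proof (cases "z = 0 \<or> \<not> cmod z < 1")
    case True
    moreover have "deriv (fun_of x) 0 = coeff x 1"
      using fun_cong[OF taylor_coeff_fun_of[of x], of 1]
      by (simp add: taylor_coeff_def del: taylor_coeff_fun_of)
    ultimately show ?thesis by (auto simp: backward_shift_def fun_of_outside z0 coeff_bshift)
  next
    case False
    then have "(\<lambda>n. z * (coeff ?y n * z ^ n)) sums (z * fun_of ?y z)"
      by (intro sums_mult fun_of_sums) simp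
    moreover have "(\<lambda>n. coeff x (Suc n) * z ^ Suc n) sums (fun_of x z - coeff x 0)"
      using fun_of_sums[of z x] False by (subst sums_Suc_iff) simp
    ultimately have "z * fun_of ?y z = fun_of x z - coeff x 0"
      by (intro sums_unique2) (auto simp: coeff_bshift mult_ac)
    then show ?thesis using False by (simp add: backward_shift_def z0 field_simps)
  qed
qed

section \<open>The boundary identity as an operator identity\<close>

lemma circle_mean_tendsto_norm:
  assumes r: "\<And>k. 0 \<le> r k" "\<And>k. r k < 1" "r \<longlonglongrightarrow> 1"
  shows "(\<lambda>k. (LINT t|circle_measure. (cmod (fun_of x (of_real (r k) * cis t)))\<^sup>2) / (2 * pi))
    \<longlonglongrightarrow> (norm x)\<^sup>2"
proof -
  let ?a = "\<lambda>n k. (cmod (coeff x n))\<^sup>2 * ((r k)\<^sup>2) ^ n"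
  have "(\<lambda>k. \<Sum>n. ?a n k) \<longlonglongrightarrow> (\<Sum>n. (cmod (coeff x n))\<^sup>2)"
  proof (rule tannerys_theorem[THEN conjunct2, THEN conjunct2])
    fix n
    have "(\<lambda>k. ?a n k) \<longlonglongrightarrow> (cmod (coeff x n))\<^sup>2 * (1\<^sup>2) ^ n" by (intro tendsto_intros r)
    then show "(\<lambda>k. ?a n k) \<longlonglongrightarrow> (cmod (coeff x n))\<^sup>2" by simp
  next
    have "norm (?a n k) \<le> (cmod (coeff x n))\<^sup>2" for n k
    proof -
      have "(r k)\<^sup>2 \<le> 1" using r(1,2)[of k] by (simp add: power_le_one less_imp_le)
      then have "((r k)\<^sup>2) ^ n \<le> 1" by (simp add: power_le_one)
      then show ?thesis using r(1)[of k] by (simp add: mult_left_le abs_mult)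
    qed
    then show "\<forall>\<^sub>F (n, k) in sequentially \<times>\<^sub>F sequentially. norm (?a n k) \<le> (cmod (coeff x n))\<^sup>2"
      by (intro always_eventually) auto
  qed (auto intro: summable_coeff)
  moreover have "(\<Sum>n. ?a n k) = (LINT t|circle_measure. (cmod (fun_of x (of_real (r k) * cis t)))\<^sup>2) / (2 * pi)" for k
    using circle_parseval[OF fun_of_disc_analytic r(1,2)[of k], of x] by (simp add: sums_iff)
  ultimately show ?thesis using norm_ell2_sums[of x] by (simp add: sums_iff)
qed

text \<open>Parseval's formula turns the squared norms into limits of means over circles, and the radial limits
  make the integrand \<open>(|a|\<^sup>2 + |b|\<^sup>2 - 1) |f|\<^sup>2\<close> tend to \<open>0\<close> almost everywhere. Boundedness of \<open>f\<close> provides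
  the constant majorant for dominated convergence.\<close>

lemma boundary_modulus_identity_bounded:
  assumes a: "a \<in> Hinf1" and b: "b \<in> Hinf1"
    and AE: "AE t in circle_measure.
        \<exists>u v. has_radial_limit a (cis t) u \<and> has_radial_limit b (cis t) v \<and>
              (cmod u)\<^sup>2 + (cmod v)\<^sup>2 = 1"
    and x: "\<And>z. cmod (fun_of x z) \<le> K"
  shows "(norm (mult a x))\<^sup>2 + (norm (mult b x))\<^sup>2 = (norm x)\<^sup>2"
proof -
  define r where "r k = 1 - 1 / (real k + 2)" for k
  have r: "\<And>k. 0 \<le> r k" "\<And>k. r k < 1" "r \<longlonglongrightarrow> 1"
  proof -
    show "0 \<le> r k" "r k < 1" for k by (auto simp: r_def field_simps)
    show "r \<longlonglongrightarrow> 1" unfolding r_def by real_asymp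
  qed
  have K: "0 \<le> K" using x norm_ge_zero order_trans by blast
  have rl: "filterlim r (at_left 1) sequentially"
    using r by (auto simp: filterlim_at less_imp_neq)
  let ?f = "\<lambda>v k t. (cmod (fun_of v (of_real (r k) * cis t)))\<^sup>2"
  let ?A = "\<lambda>g k t. (cmod (g (of_real (r k) * cis t)))\<^sup>2"
  have int: "integrable circle_measure (?f v k)" for v k
    by (intro circle_integrable continuous_intros continuous_on_circle fun_of_disc_analytic r)
  have aH: "a \<in> Hinf" "b \<in> Hinf" using Hinf1D a b by auto
  have F: "?f (mult a x) k t + ?f (mult b x) k t - ?f x k t = (?A a k t + ?A b k t - 1) * ?f x k t" for k t
    by (simp add: aH norm_mult power_mult_distrib algebra_simps)
  have "(\<lambda>k. LINT t|circle_measure. (?f (mult a x) k t + ?f (mult b x) k t - ?f x k t))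
      \<longlonglongrightarrow> (LINT t|circle_measure. 0)"
  proof (rule integral_dominated_convergence[where w="\<lambda>t. K\<^sup>2"])
    show "AE t in circle_measure. (\<lambda>k. ?f (mult a x) k t + ?f (mult b x) k t - ?f x k t) \<longlonglongrightarrow> 0"
      using AE
    proof eventually_elim
      fix t assume "\<exists>u v. has_radial_limit a (cis t) u \<and> has_radial_limit b (cis t) v \<and>
              (cmod u)\<^sup>2 + (cmod v)\<^sup>2 = 1"
      then obtain u v where uv: "has_radial_limit a (cis t) u" "has_radial_limit b (cis t) v"
        "(cmod u)\<^sup>2 + (cmod v)\<^sup>2 = 1" by blast
      have "(\<lambda>k. a (of_real (r k) * cis t)) \<longlonglongrightarrow> u" "(\<lambda>k. b (of_real (r k) * cis t)) \<longlonglongrightarrow> v"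
        using uv(1,2) filterlim_compose[OF _ rl] unfolding has_radial_limit_def by blast+
      then have "(\<lambda>k. ?A a k t + ?A b k t - 1) \<longlonglongrightarrow> (cmod u)\<^sup>2 + (cmod v)\<^sup>2 - 1"
        by (intro tendsto_intros)
      then have "(\<lambda>k. ?A a k t + ?A b k t - 1) \<longlonglongrightarrow> 0" using uv(3) by simp
      then show "(\<lambda>k. ?f (mult a x) k t + ?f (mult b x) k t - ?f x k t) \<longlonglongrightarrow> 0"
        unfolding F
      proof (rule tendsto_0_le[where K="K\<^sup>2"])
        have "?f x k t \<le> K\<^sup>2" for k using x by (auto intro: power_mono)
        then show "\<forall>\<^sub>F k in sequentially. norm ((?A a k t + ?A b k t - 1) * ?f x k t)
            \<le> norm (?A a k t + ?A b k t - 1) * K\<^sup>2"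
          by (intro always_eventually) (auto simp: abs_mult intro!: mult_left_mono)
      qed
    qed
    show "AE t in circle_measure. norm (?f (mult a x) k t + ?f (mult b x) k t - ?f x k t) \<le> K\<^sup>2" for k
    proof (rule AE_I2)
      fix t
      have "(cmod (a z))\<^sup>2 \<le> 1" "(cmod (b z))\<^sup>2 \<le> 1" for z
        using Hinf1D[OF a] Hinf1D[OF b] by (auto simp: power_le_one)
      then have "\<bar>?A a k t + ?A b k t - 1\<bar> \<le> 1"
        by (smt (verit) zero_le_power2)
      moreover have "?f x k t \<le> K\<^sup>2" using x by (auto intro: power_mono)
      ultimately have "\<bar>?A a k t + ?A b k t - 1\<bar> * ?f x k t \<le> 1 * K\<^sup>2"
        by (intro mult_mono) auto
      then show "norm (?f (mult a x) k t + ?f (mult b x) k t - ?f x k t) \<le> K\<^sup>2"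
        unfolding F by (simp add: abs_mult)
    qed
  qed (auto intro!: borel_measurable_integrable int)
  then have "(\<lambda>k. (LINT t|circle_measure. (?f (mult a x) k t + ?f (mult b x) k t - ?f x k t)) / (2 * pi))
      \<longlonglongrightarrow> 0" by (auto intro: tendsto_divide_zero)
  moreover have "(LINT t|circle_measure. (?f (mult a x) k t + ?f (mult b x) k t - ?f x k t)) / (2 * pi)
     = (LINT t|circle_measure. ?f (mult a x) k t) / (2 * pi) + (LINT t|circle_measure. ?f (mult b x) k t) / (2 * pi)
       - (LINT t|circle_measure. ?f x k t) / (2 * pi)" for k
    using int by (simp add: add_divide_distrib diff_divide_distrib)
  moreover have "(\<lambda>k. (LINT t|circle_measure. ?f (mult a x) k t) / (2 * pi)
       + (LINT t|circle_measure. ?f (mult b x) k t) / (2 * pi)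
       - (LINT t|circle_measure. ?f x k t) / (2 * pi))
     \<longlonglongrightarrow> (norm (mult a x))\<^sup>2 + (norm (mult b x))\<^sup>2 - (norm x)\<^sup>2"
    by (intro tendsto_intros circle_mean_tendsto_norm r)
  ultimately show ?thesis using LIMSEQ_unique by fastforce
qed

lemma fun_of_truncation_bounded:
  "cmod (fun_of (\<Sum>k<N. c k *\<^sub>C unit_vec k) z) \<le> (\<Sum>k<N. cmod (c k))"
proof (cases "cmod z < 1")
  case True
  have "fun_of (\<Sum>k<N. c k *\<^sub>C unit_vec k) z = (\<Sum>k<N. c k * z ^ k)"
    using True by (induction N) (simp_all add: fun_of_unit_vec)
  also have "cmod \<dots> \<le> (\<Sum>k<N. cmod (c k * z ^ k))" by (rule norm_sum)
  also have "\<dots> \<le> (\<Sum>k<N. cmod (c k))"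
    using True by (intro sum_mono) (simp add: norm_mult norm_power mult_left_le power_le_one)
  finally show ?thesis .
qed (simp add: fun_of_outside sum_nonneg)

lemma boundary_modulus_identity:
  assumes a: "a \<in> Hinf1" and b: "b \<in> Hinf1"
    and AE: "AE t in circle_measure.
        \<exists>u v. has_radial_limit a (cis t) u \<and> has_radial_limit b (cis t) v \<and>
              (cmod u)\<^sup>2 + (cmod v)\<^sup>2 = 1"
  shows "(norm (mult a x))\<^sup>2 + (norm (mult b x))\<^sup>2 = (norm x)\<^sup>2"
proof -
  let ?t = "\<lambda>N. \<Sum>k<N. coeff x k *\<^sub>C unit_vec k"
  have t: "?t \<longlonglongrightarrow> x" using unit_vec_expansion[of x] by (simp add: sums_def)
  have "(\<lambda>N. mult c (?t N)) \<longlonglongrightarrow> mult c x" if "c \<in> Hinf1" for c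
    using bounded_linear.tendsto[OF bounded_clinearD(1)[OF bounded_clinear_mult] t] Hinf1D that by blast
  then have "(\<lambda>N. (norm (mult a (?t N)))\<^sup>2 + (norm (mult b (?t N)))\<^sup>2)
      \<longlonglongrightarrow> (norm (mult a x))\<^sup>2 + (norm (mult b x))\<^sup>2"
    using a b by (intro tendsto_intros) auto
  moreover have "(norm (mult a (?t N)))\<^sup>2 + (norm (mult b (?t N)))\<^sup>2 = (norm (?t N))\<^sup>2" for N
    by (rule boundary_modulus_identity_bounded[OF a b AE fun_of_truncation_bounded])
  moreover have "(\<lambda>N. (norm (?t N))\<^sup>2) \<longlonglongrightarrow> (norm x)\<^sup>2" by (intro tendsto_intros t)
  ultimately show ?thesis using LIMSEQ_unique by fastforce
qed

text \<open>The real part of the inner product determines an operator, so polarizing the norm identity is enough.\<close>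

lemma boundary_modulus_operator_identity:
  assumes a: "a \<in> Hinf" and b: "b \<in> Hinf"
    and id: "\<And>x. (norm (mult a x))\<^sup>2 + (norm (mult b x))\<^sup>2 = (norm x)\<^sup>2"
  shows "adj (mult a) (mult a x) + adj (mult b) (mult b x) = x"
proof -
  note A = bounded_clinear_mult[OF a] and B = bounded_clinear_mult[OF b]
  have re: "inner (mult a u) (mult a v) + inner (mult b u) (mult b v) = inner u v" for u v
    using id[of "u + v"] id[of u] id[of v]
    by (simp add: bounded_clinearD[OF A] bounded_clinearD[OF B] power2_norm_eq_inner inner_add inner_commute)
  have "inner u (adj (mult a) (mult a x) + adj (mult b) (mult b x)) = inner u x" for u
    using re[of u x] by (simp add: inner_add_right inner_adj[OF A] inner_adj[OF B])
  then have "inner (adj (mult a) (mult a x) + adj (mult b) (mult b x) - x)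
      (adj (mult a) (mult a x) + adj (mult b) (mult b x) - x) = 0"
    by (simp add: inner_diff_right)
  then show ?thesis by simp
qed

section \<open>Outer functions are cyclic\<close>

definition herglotz :: "(real \<Rightarrow> real) \<Rightarrow> complex \<Rightarrow> complex" where
  "herglotz u z = (LINT t|circle_measure. (cis t + z) / (cis t - z) * of_real (u t))"

lemma cis_minus_nonzero: "cmod z < 1 \<Longrightarrow> cis t - z \<noteq> 0"
  using norm_cis[of t] by (metis eq_iff_diff_eq_0 less_irrefl)

text \<open>The kernel is \<open>1 + 2 (q + q\<^sup>2 + \<dots>)\<close> with \<open>q = z / cis t\<close>.\<close>

lemma herglotz_kernel_series:
  assumes z: "cmod z < 1"
  shows "(\<Sum>n. ((if n = 0 then 1 else 2) * z ^ n) * cis (- of_int (int n) * t)) = (cis t + z) / (cis t - z)"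
proof -
  have q: "cis (- of_int (int n) * t) = inverse (cis t) ^ n" for n
    by (simp only: cis_inverse Complex.DeMoivre) simp
  let ?q = "z * inverse (cis t)"
  have "(\<lambda>n. ?q ^ n) sums (1 / (1 - ?q))"
    by (rule geometric_sums) (simp add: norm_mult norm_inverse z)
  then have "(\<lambda>n. 2 * ?q ^ n) sums (2 * (1 / (1 - ?q)))" by (rule sums_mult)
  from sums_diff[OF this sums_single[of 0 "\<lambda>n. 1"]]
  have "(\<lambda>n. ((if n = 0 then 1 else 2) * z ^ n) * cis (- of_int (int n) * t)) sums (2 * (1 / (1 - ?q)) - 1)"
    by (rule sums_cong[THEN iffD1, rotated]) (unfold q power_mult_distrib, auto)
  moreover have "2 * (1 / (1 - ?q)) - 1 = (cis t + z) / (cis t - z)"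
    using cis_minus_nonzero[OF z, of t] by (simp add: field_simps)
  ultimately show ?thesis by (simp add: sums_iff)
qed

lemma herglotz_series:
  assumes u: "integrable circle_measure u" and z: "cmod z < 1"
  shows "(\<lambda>n. ((if n = 0 then 1 else 2) * (LINT t|circle_measure. of_real (u t) * cis (- of_int (int n) * t))) * z ^ n)
      sums herglotz u z"
    and "integrable circle_measure (\<lambda>t. (cis t + z) / (cis t - z) * of_real (u t))"
proof -
  let ?c = "\<lambda>n::nat. ((if n = 0 then 1 else 2) * z ^ n) :: complex"
  have c: "summable (\<lambda>n. cmod (?c n))"
  proof (rule summable_comparison_test')
    show "summable (\<lambda>n. 2 * cmod z ^ n)" by (intro summable_mult summable_geometric) (use z in simp)
  qed (simp add: norm_mult norm_power)
  have m: "(\<lambda>t. cis (- of_int (int n) * t)) \<in> borel_measurable circle_measure" for n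
    by (intro circle_measurable continuous_intros)
  have uc: "integrable circle_measure (\<lambda>t. complex_of_real (u t))" using u by simp
  have m1: "cmod (cis (- of_int (int n) * t)) \<le> 1" for n t by simp
  note I = integral_bounded_series[where u="\<lambda>n t. cis (- of_int (int n) * t)", OF uc m m1 c, unfolded herglotz_kernel_series[OF z]]
  have coeffs: "(\<lambda>n. ?c n * (LINT t|circle_measure. of_real (u t) * cis (- of_int (int n) * t)))
    = (\<lambda>n. ((if n = 0 then 1 else 2) * (LINT t|circle_measure. of_real (u t) * cis (- of_int (int n) * t))) * z ^ n)"
    by (rule ext) (simp only: mult_ac)
  show "(\<lambda>n. ((if n = 0 then 1 else 2) * (LINT t|circle_measure. of_real (u t) * cis (- of_int (int n) * t))) * z ^ n)
      sums herglotz u z"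
    using I(1) unfolding coeffs herglotz_def mult.commute[of "of_real (u _)" "(cis _ + z) / (cis _ - z)"] .
  show "integrable circle_measure (\<lambda>t. (cis t + z) / (cis t - z) * of_real (u t))"
    using I(2) unfolding mult.commute[of "of_real (u _)" "(cis _ + z) / (cis _ - z)"] .
qed

lemma holomorphic_herglotz:
  assumes "integrable circle_measure u"
  shows "herglotz u holomorphic_on ball 0 1"
  by (rule power_series_holomorphic) (use herglotz_series(1)[OF assms] in auto)

lemma herglotz_add:
  assumes "integrable circle_measure u" "integrable circle_measure v" "cmod z < 1"
  shows "herglotz (\<lambda>t. u t + v t) z = herglotz u z + herglotz v z"
  using herglotz_series(2)[OF assms(1,3)] herglotz_series(2)[OF assms(2,3)]
  by (simp add: herglotz_def distrib_left)

lemma herglotz_const: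
  assumes "cmod z < 1"
  shows "herglotz (\<lambda>t. c) z = 2 * pi * c"
proof -
  have "(LINT t|circle_measure. complex_of_real c * cis (- of_int (int n) * t)) = (if n = 0 then 2 * pi * c else 0)" for n
    using integral_cis_int[of "- int n"] by (auto simp: mult.commute)
  then have eq: "((if n = 0 then 1 else 2) * (LINT t|circle_measure. of_real c * cis (- of_int (int n) * t))) * z ^ n
    = (if n = 0 then 2 * pi * c else 0)" for n :: nat by simp
  have "integrable circle_measure (\<lambda>t. c)" by simp
  from herglotz_series(1)[OF this assms]
  have "(\<lambda>n. if n = 0 then complex_of_real (2 * pi * c) else 0) sums herglotz (\<lambda>t. c) z"
    unfolding eq if_distrib[of complex_of_real] of_real_0 .
  then show ?thesis by (rule sums_unique2) (rule sums_single)
qed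

lemma herglotz_0: "herglotz u 0 = of_real (LINT t|circle_measure. u t)"
  unfolding herglotz_def integral_complex_of_real[symmetric]
  by (intro Bochner_Integration.integral_cong) simp_all

lemma Re_herglotz_kernel_nonneg:
  assumes "cmod z < 1"
  shows "0 \<le> Re ((cis t + z) / (cis t - z))"
proof -
  have "Re ((cis t + z) / (cis t - z)) = Re ((cis t + z) * cnj (cis t - z)) / (cmod (cis t - z))\<^sup>2"
    by (simp only: complex_div_cnj[of "cis t + z"] Re_divide_of_real)
  moreover have "Re ((cis t + z) * cnj (cis t - z)) = (cmod (cis t))\<^sup>2 - (cmod z)\<^sup>2"
    by (simp only: cmod_power2) (simp add: power2_eq_square algebra_simps)
  moreover have "(cmod z)\<^sup>2 \<le> 1" using assms by (simp add: power_le_one)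
  ultimately show ?thesis by simp
qed

lemma Re_herglotz_mono:
  assumes "integrable circle_measure u" "integrable circle_measure v" "cmod z < 1" "\<And>t. u t \<le> v t"
  shows "Re (herglotz u z) \<le> Re (herglotz v z)"
proof -
  have "(LINT t|circle_measure. Re ((cis t + z) / (cis t - z) * of_real (u t)))
      \<le> (LINT t|circle_measure. Re ((cis t + z) / (cis t - z) * of_real (v t)))"
  proof (rule integral_mono)
    show "Re ((cis t + z) / (cis t - z) * of_real (u t)) \<le> Re ((cis t + z) / (cis t - z) * of_real (v t))" for t
      using mult_left_mono[OF assms(4)[of t] Re_herglotz_kernel_nonneg[OF assms(3), of t]]
      by (simp only: times_complex.sel Re_complex_of_real Im_complex_of_real mult_zero_right diff_zero)
  qed (intro integrable_Re herglotz_series assms)+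
  then show ?thesis
    unfolding herglotz_def
    by (simp only: integral_Re[OF herglotz_series(2)[OF assms(1,3)]]
        integral_Re[OF herglotz_series(2)[OF assms(2,3)]])
qed

text \<open>The multiplier \<open>p\<^sub>N\<close> is the outer function with boundary modulus \<open>min (1 / w) (exp N)\<close>, where
  \<open>w\<close> is the boundary modulus of \<open>a\<close>. Positivity of the Poisson kernel turns the bounds for the
  boundary moduli of \<open>p\<^sub>N\<close> and \<open>a p\<^sub>N\<close> into bounds on the disc. At \<open>0\<close> the exponent of \<open>a p\<^sub>N\<close> is the mean of
  \<open>min 0 (ln w + N)\<close>, which tends to \<open>0\<close> because \<open>ln w\<close> is integrable.\<close>

lemma outer_function_approximate_inverse:
  assumes a: "outer_function a"
  shows "(\<forall>z. cmod z < 1 \<longrightarrow> a z \<noteq> 0) \<and>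
    (\<exists>p. (\<forall>N. p N \<in> Hinf \<and> (\<forall>z. cmod (a z * p N z) \<le> 1)) \<and> (\<lambda>N::nat. a 0 * p N 0) \<longlonglongrightarrow> 1)"
proof
  obtain c w where c: "cmod c = 1" and w: "\<And>t. 0 < w t" "w \<in> borel_measurable circle_measure"
    "integrable circle_measure (\<lambda>t. ln (w t :: real))"
    and az: "\<And>z. cmod z < 1 \<Longrightarrow> a z = c * exp (1 / (2 * of_real pi) * herglotz (\<lambda>t. ln (w t)) z)"
  proof -
    from a obtain c w where cw: "cmod c = 1" "\<forall>t. 0 < w t" "w \<in> borel_measurable circle_measure"
      "integrable circle_measure (\<lambda>t. ln (w t :: real))"
      "\<forall>z\<in>ball 0 1. a z = c * exp (1 / (2 * of_real pi) * herglotz (\<lambda>t. ln (w t)) z)"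
      unfolding outer_function_def herglotz_def by blast
    show thesis by (rule that[of c w]) (use cw in auto)
  qed
  have c': "c * cnj c = 1" using c by (simp add: complex_norm_square[symmetric])
  show "\<forall>z. cmod z < 1 \<longrightarrow> a z \<noteq> 0" using c az by auto
  define m where "m N t = min (- ln (w t)) (real N)" for N :: nat and t
  define p where "p N z = (if cmod z < 1 then cnj c * exp (1 / (2 * of_real pi) * herglotz (m N) z) else 0)" for N z
  have meas: "m N \<in> borel_measurable circle_measure" for N
    unfolding m_def using w by measurable
  have mint: "integrable circle_measure (m N)" for N
  proof (rule Bochner_Integration.integrable_bound[OF _ meas])
    show "integrable circle_measure (\<lambda>t. \<bar>ln (w t)\<bar> + real N)" using w(3) by simp
  qed (auto simp: m_def)
  have bound: "cmod (cnj c * exp (1 / (2 * of_real pi) * herglotz (m N) z)) \<le> exp (real N)"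
    if "cmod z < 1" for N z
  proof -
    have "Re (herglotz (m N) z) \<le> Re (herglotz (\<lambda>t. real N) z)"
      by (rule Re_herglotz_mono[OF mint _ that]) (auto simp: m_def)
    also have "\<dots> = 2 * pi * real N" using herglotz_const[OF that, of "real N"] by simp
    finally have "Re (herglotz (m N) z) / (2 * pi) \<le> real N" by (simp add: field_simps)
    moreover have "Re (1 / (2 * of_real pi) * herglotz (m N) z) = Re (herglotz (m N) z) / (2 * pi)"
      using Re_divide_of_real[of "herglotz (m N) z" "2 * pi"] by simp
    ultimately show ?thesis using c by (simp add: norm_mult)
  qed
  have ap: "a z * p N z = exp (1 / (2 * of_real pi) * herglotz (\<lambda>t. min 0 (ln (w t) + real N)) z)"
    if "cmod z < 1" for N z
  proof -
    have "herglotz (\<lambda>t. ln (w t)) z + herglotz (m N) z = herglotz (\<lambda>t. ln (w t) + m N t) z"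
      by (rule herglotz_add[symmetric, OF w(3) mint that])
    also have "(\<lambda>t. ln (w t) + m N t) = (\<lambda>t. min 0 (ln (w t) + real N))"
      by (auto simp: m_def min_def)
    finally have e: "herglotz (\<lambda>t. min 0 (ln (w t) + real N)) z = herglotz (\<lambda>t. ln (w t)) z + herglotz (m N) z" ..
    have "a z * p N z = (c * cnj c) * exp (1 / (2 * of_real pi) * herglotz (\<lambda>t. ln (w t)) z
        + 1 / (2 * of_real pi) * herglotz (m N) z)"
      using that by (simp add: az p_def exp_add)
    then show ?thesis unfolding e c' by (simp add: algebra_simps)
  qed
  have int': "integrable circle_measure (\<lambda>t. min 0 (ln (w t) + real N))" for N :: nat
    using w(3) by auto
  have "p N \<in> Hinf" for N
  proof (rule HinfI)
    have "(\<lambda>z. cnj c * exp (1 / (2 * of_real pi) * herglotz (m N) z)) holomorphic_on ball 0 1"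
      by (intro holomorphic_intros holomorphic_herglotz mint)
    then show "p N holomorphic_on ball 0 1"
      by (rule holomorphic_transform) (simp add: p_def)
    show "cmod (p N z) \<le> exp (real N)" if "cmod z < 1" for z
      using bound[OF that] that by (simp add: p_def)
  qed (simp add: p_def)
  moreover have "cmod (a z * p N z) \<le> 1" for N z
  proof (cases "cmod z < 1")
    case True
    have "Re (herglotz (\<lambda>t. min 0 (ln (w t) + real N)) z) \<le> Re (herglotz (\<lambda>t. 0) z)"
      by (rule Re_herglotz_mono[OF int' _ True]) auto
    also have "\<dots> = 0" by (simp add: herglotz_def)
    finally have "Re (herglotz (\<lambda>t. min 0 (ln (w t) + real N)) z) / (2 * pi) \<le> 0"
      by (simp add: divide_nonpos_pos)
    moreover have "Re (1 / (2 * of_real pi) * h) = Re h / (2 * pi)" for h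
      using Re_divide_of_real[of h "2 * pi"] by simp
    ultimately show ?thesis unfolding ap[OF True] by simp
  qed (simp add: p_def)
  moreover have "(\<lambda>N. a 0 * p N 0) \<longlonglongrightarrow> 1"
  proof -
    have "(\<lambda>N. LINT t|circle_measure. min 0 (ln (w t) + real N)) \<longlonglongrightarrow> (LINT t|circle_measure. 0)"
    proof (rule integral_dominated_convergence[where w="\<lambda>t. \<bar>ln (w t)\<bar>"])
      show "AE t in circle_measure. (\<lambda>N. min 0 (ln (w t) + real N)) \<longlonglongrightarrow> 0"
      proof (rule AE_I2)
        fix t
        obtain N0 :: nat where "- ln (w t) < real N0" using reals_Archimedean2 by blast
        then have "\<forall>N\<ge>N0. min 0 (ln (w t) + real N) = 0" by auto
        then show "(\<lambda>N. min 0 (ln (w t) + real N)) \<longlonglongrightarrow> 0"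
          by (intro tendsto_eventually) (auto simp: eventually_sequentially)
      qed
    qed (use w(3) in \<open>auto intro: borel_measurable_integrable[OF int'] simp: min_def\<close>)
    then have "(\<lambda>N. exp (1 / (2 * of_real pi) * complex_of_real (LINT t|circle_measure. min 0 (ln (w t) + real N))))
        \<longlonglongrightarrow> exp (1 / (2 * of_real pi) * complex_of_real 0)"
      by (intro tendsto_intros) simp
    then show ?thesis using ap[of 0] by (simp add: herglotz_0)
  qed
  ultimately show "\<exists>p. (\<forall>N. p N \<in> Hinf \<and> (\<forall>z. cmod (a z * p N z) \<le> 1)) \<and> (\<lambda>N. a 0 * p N 0) \<longlonglongrightarrow> 1"
    by (intro exI[of _ p]) auto
qed

lemma contractions_tendsto_identity:
  assumes lin: "\<And>N::nat. bounded_clinear (T N)" and contr: "\<And>N x. norm (T N x) \<le> norm x"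
    and e: "\<And>k. (\<lambda>N. T N (unit_vec k)) \<longlonglongrightarrow> unit_vec k"
  shows "(\<lambda>N. T N x) \<longlonglongrightarrow> x"
proof (rule metric_LIMSEQ_I)
  fix \<epsilon> :: real assume \<epsilon>: "\<epsilon> > 0"
  let ?t = "\<lambda>M. \<Sum>k<M. coeff x k *\<^sub>C unit_vec k"
  have "?t \<longlonglongrightarrow> x" using unit_vec_expansion[of x] by (simp add: sums_def)
  then have "\<exists>M. norm (?t M - x) < \<epsilon> / 3" using \<epsilon> LIMSEQ_D[of ?t x "\<epsilon> / 3"] by auto
  then obtain M where M: "norm (?t M - x) < \<epsilon> / 3" by blast
  have "T N (?t M) = (\<Sum>k<M. coeff x k *\<^sub>C T N (unit_vec k))" for N
    using bounded_clinearD(2,3)[OF lin[of N]] by (simp add: linear_sum)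
  then have "(\<lambda>N. T N (?t M)) \<longlonglongrightarrow> ?t M" by (auto intro!: tendsto_intros e)
  then obtain N0 where N0: "\<And>N. N \<ge> N0 \<Longrightarrow> norm (T N (?t M) - ?t M) < \<epsilon> / 3"
    using \<epsilon> LIMSEQ_D[of "\<lambda>N. T N (?t M)" "?t M" "\<epsilon> / 3"] by auto
  have "dist (T N x) x < \<epsilon>" if "N \<ge> N0" for N
  proof -
    have "T N x - x = T N (x - ?t M) + (T N (?t M) - ?t M) + (?t M - x)"
      using bounded_clinearD(5)[OF lin[of N]] by simp
    then have "norm (T N x - x) \<le> norm (T N (x - ?t M)) + norm (T N (?t M) - ?t M) + norm (?t M - x)"
      by (simp only:) (intro order_trans[OF norm_triangle_ineq] add_right_mono norm_triangle_ineq)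
    moreover have "norm (T N (x - ?t M)) < \<epsilon> / 3"
      using contr[of N "x - ?t M"] M by (simp add: norm_minus_commute)
    ultimately show ?thesis using M N0[OF that] by (simp add: dist_norm)
  qed
  then show "\<exists>N0. \<forall>N\<ge>N0. dist (T N x) x < \<epsilon>" by blast
qed

text \<open>For \<open>|q| \<le> 1\<close> the squared distance of \<open>q\<close> from \<open>1\<close> in \<open>H\<^sup>2\<close> is at most \<open>2 - 2 Re (q 0)\<close>, so the
  values at \<open>0\<close> alone control the convergence.\<close>

lemma mult_tendsto_identity:
  assumes q: "\<And>N::nat. q N \<in> Hinf" "\<And>N z. cmod (q N z) \<le> 1" and q0: "(\<lambda>N. q N 0) \<longlonglongrightarrow> 1"
  shows "(\<lambda>N. mult (q N) x) \<longlonglongrightarrow> x"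
proof (rule contractions_tendsto_identity)
  let ?e = unit_vec
  have bc: "bounded_clinear (mult (q N))" for N by (rule bounded_clinear_mult[OF q(1)])
  show "bounded_clinear (mult (q N))" for N by (rule bc)
  show contr: "norm (mult (q N) x) \<le> norm x" for N x using norm_mult_le[OF q(1,2)] by simp
  have n1: "(norm (?e 0))\<^sup>2 = 1" using cinner_self[of "?e 0"] by (simp add: cinner_unit_vec unit_vec.rep_eq flip: of_real_power)
  have "(norm (mult (q N) (?e 0) - ?e 0))\<^sup>2 \<le> 2 - 2 * Re (q N 0)" for N
  proof -
    have "szego 0 = ?e 0" by (rule ell2_eqI) (simp add: szego.rep_eq unit_vec.rep_eq)
    then have "cinner (mult (q N) (?e 0)) (?e 0) = q N 0"
      using fun_of_mult[OF q(1), of N "?e 0" 0] by (simp add: fun_of_def) (metis cinner_self mult.right_neutral n1 of_real_1)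
    then have "inner (mult (q N) (?e 0)) (?e 0) = Re (q N 0)" by (simp flip: Re_cinner)
    moreover have "(norm (mult (q N) (?e 0)))\<^sup>2 \<le> (norm (?e 0))\<^sup>2" by (intro power_mono contr) simp
    ultimately show ?thesis using n1
      by (simp add: power2_norm_eq_inner inner_diff inner_commute)
  qed
  then have e0: "norm (mult (q N) (?e 0) - ?e 0) \<le> sqrt (2 - 2 * Re (q N 0))" for N
    by (rule real_le_rsqrt)
  have lim: "(\<lambda>N. sqrt (2 - 2 * Re (q N 0))) \<longlonglongrightarrow> 0"
  proof -
    have "(\<lambda>N. sqrt (2 - 2 * Re (q N 0))) \<longlonglongrightarrow> sqrt (2 - 2 * Re 1)" by (intro tendsto_intros q0)
    then show ?thesis by simp
  qed
  have ek: "norm (mult (q N) (?e k) - ?e k) \<le> norm (mult (q N) (?e 0) - ?e 0)" for N k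
  proof -
    have g: "fun_of (?e k) \<in> Hinf"
      by (rule HinfI[OF holomorphic_fun_of, of _ 1])
        (auto simp: fun_of_outside fun_of_unit_vec norm_power power_le_one)
    have gb: "cmod (fun_of (?e k) z) \<le> 1" for z
      by (cases "cmod z < 1") (auto simp: fun_of_outside fun_of_unit_vec norm_power power_le_one)
    have "mult (q N) (?e k) - ?e k = mult (fun_of (?e k)) (mult (q N) (?e 0) - ?e 0)"
      by (rule fun_of_eqI) (simp add: q g fun_of_unit_vec algebra_simps)
    then show ?thesis using norm_mult_le[OF g gb, of "mult (q N) (?e 0) - ?e 0"] by simp
  qed
  have "\<forall>N. norm (mult (q N) (?e k) - ?e k) \<le> sqrt (2 - 2 * Re (q N 0))" for k
    using order_trans[OF ek e0] by blast
  then have "(\<lambda>N. mult (q N) (?e k) - ?e k) \<longlonglongrightarrow> 0" for k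
    by (rule Lim_null_comparison[OF always_eventually lim])
  then show "(\<lambda>N. mult (q N) (?e k)) \<longlonglongrightarrow> ?e k" for k
    by (simp add: LIM_zero_iff)
qed

text \<open>With \<open>p\<^sub>N\<close> as before, \<open>a p\<^sub>N\<close> tends to \<open>1\<close>; so the range of multiplication by \<open>a\<close> is dense.\<close>

lemma outer_mult_approximate_inverse:
  assumes a: "outer_function a" "a \<in> Hinf"
  obtains p where "\<And>N::nat. p N \<in> Hinf" "\<And>x. (\<lambda>N. mult a (mult (p N) x)) \<longlonglongrightarrow> x"
proof -
  obtain p where p: "\<And>N. p N \<in> Hinf" "\<And>N z. cmod (a z * p N z) \<le> 1" "(\<lambda>N::nat. a 0 * p N 0) \<longlonglongrightarrow> 1"
    using outer_function_approximate_inverse[OF a(1)] by blast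
  have q: "(\<lambda>z. a z * p N z) \<in> Hinf" for N
    using HinfD(1)[OF a(2)] HinfD(1)[OF p(1)[of N]] p(2)[of _ N]
    by (intro HinfI[of _ 1]) (auto simp: disc_analytic_def intro: holomorphic_intros)
  have "mult (\<lambda>z. a z * p N z) x = mult a (mult (p N) x)" for N x
    by (rule fun_of_eqI) (simp add: q a p mult.assoc)
  then have "(\<lambda>N. mult a (mult (p N) x)) \<longlonglongrightarrow> x" for x
    using mult_tendsto_identity[OF q p(2,3), of x] by simp
  with p(1) show thesis by (rule that)
qed

lemma adj_mult_outer_injective:
  assumes a: "outer_function a" "a \<in> Hinf" and g: "adj (mult a) g = 0"
  shows "g = 0"
proof -
  obtain p where p: "\<And>N::nat. p N \<in> Hinf" "\<And>x. (\<lambda>N. mult a (mult (p N) x)) \<longlonglongrightarrow> x"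
    using outer_mult_approximate_inverse[OF a] by blast
  have "(\<lambda>N. cinner (mult a (mult (p N) g)) g) \<longlonglongrightarrow> cinner g g" by (intro tendsto_intros p)
  then have "(\<lambda>N. 0) \<longlonglongrightarrow> cinner g g"
    by (simp add: cinner_adj[OF bounded_clinear_mult[OF a(2)]] g)
  then have "cinner g g = 0" using LIMSEQ_unique by blast
  then show ?thesis by (simp add: cinner_self)
qed

text \<open>On the circle, \<open>a f + b g = 0\<close> gives \<open>cnj b f - cnj a g = - g / a\<close>. The projection of the left-hand
  side to \<open>H\<^sup>2\<close> is \<open>T\<^sub>b\<^sup>* f - T\<^sub>a\<^sup>* g = 0\<close>, while \<open>g / a\<close> should already be analytic, so \<open>g = 0\<close>.
  To make sense of \<open>g / a\<close>, it is replaced by \<open>p\<^sub>N g\<close> with the approximate inverses \<open>p\<^sub>N\<close> of \<open>a\<close>: the operator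
  identity expresses \<open>p\<^sub>N g\<close> as \<open>T\<^sub>a\<^sup>* (a p\<^sub>N g) - T\<^sub>b\<^sup>* (a p\<^sub>N f)\<close>, which tends to \<open>0\<close>.\<close>

lemma annihilator_of_eigenvectors_trivial:
  assumes a: "outer_function a" "a \<in> Hinf" and b: "b \<in> Hinf"
    and id: "\<And>x. adj (mult a) (mult a x) + adj (mult b) (mult b x) = x"
    and fg: "adj (mult b) f = adj (mult a) g" and orth: "mult a f + mult b g = 0"
  shows "f = 0" "g = 0"
proof -
  note A = bounded_clinear_mult[OF a(2)] and B = bounded_clinear_mult[OF b]
  note A' = bounded_clinear_adj[OF A] and B' = bounded_clinear_adj[OF B]
  obtain p where p: "\<And>N::nat. p N \<in> Hinf" "\<And>x. (\<lambda>N. mult a (mult (p N) x)) \<longlonglongrightarrow> x"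
    using outer_mult_approximate_inverse[OF a] by blast
  have bg: "mult b g = - mult a f" using orth by (simp add: eq_neg_iff_add_eq_0 add.commute)
  have bp: "mult b (mult (p N) g) = - mult a (mult (p N) f)" for N
  proof -
    have "mult b (mult (p N) g) = mult (p N) (mult b g)" by (rule mult_commute[OF b p(1)])
    also have "\<dots> = - mult (p N) (mult a f)"
      unfolding bg by (rule linear_neg[OF bounded_clinearD(2)[OF bounded_clinear_mult[OF p(1)]]])
    also have "mult (p N) (mult a f) = mult a (mult (p N) f)" by (rule mult_commute[OF p(1) a(2)])
    finally show ?thesis .
  qed
  have Tg: "mult (p N) g = adj (mult a) (mult a (mult (p N) g)) - adj (mult b) (mult a (mult (p N) f))" for N
    using id[of "mult (p N) g"] unfolding bp
    by (simp add: linear_neg[OF bounded_clinearD(2)[OF B']])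
  have "(\<lambda>N. adj (mult a) (mult a (mult (p N) g)) - adj (mult b) (mult a (mult (p N) f)))
      \<longlonglongrightarrow> adj (mult a) g - adj (mult b) f"
    by (intro tendsto_intros bounded_linear.tendsto[OF bounded_clinearD(1)[OF A']]
        bounded_linear.tendsto[OF bounded_clinearD(1)[OF B']] p)
  then have "(\<lambda>N. mult (p N) g) \<longlonglongrightarrow> 0" using fg by (simp flip: Tg)
  then have "(\<lambda>N. mult a (mult (p N) g)) \<longlonglongrightarrow> mult a 0"
    by (rule bounded_linear.tendsto[OF bounded_clinearD(1)[OF A]])
  then show g: "g = 0" using p(2)[of g] LIMSEQ_unique bounded_clinearD(6)[OF A] by metis
  have "mult a (mult (p N) f) = 0" for N
    using bp[of N] by (simp add: g bounded_clinearD(6)[OF B] bounded_clinearD(6)[OF bounded_clinear_mult[OF p(1)]])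
  then have "(\<lambda>N. 0) \<longlonglongrightarrow> f" using p(2)[of f] by simp
  then show "f = 0" using LIMSEQ_unique by blast
qed

section \<open>Square roots of defect operators\<close>

text \<open>The Taylor coefficients of \<open>sqrt (1 - x)\<close>.\<close>

definition sqrt_coeff :: "nat \<Rightarrow> real" where
  "sqrt_coeff n = (-1) ^ n * ((1/2) gchoose n)"

lemma sqrt_coeff_0 [simp]: "sqrt_coeff 0 = 1" by (simp add: sqrt_coeff_def)

lemma sqrt_coeff_Suc_nonpos: "sqrt_coeff (Suc n) \<le> 0"
proof (induction n)
  case (Suc n)
  have "(1/2::real) gchoose Suc (Suc n) = ((1/2) gchoose Suc n) * ((1/2 - real (Suc n)) / real (Suc (Suc n)))"
    using gbinomial_mult_1[of "1/2::real" "Suc n"] by (simp add: field_simps)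
  moreover have "(real (Suc n) - 1/2) / real (Suc (Suc n)) = - ((1/2 - real (Suc n)) / real (Suc (Suc n)))"
    by (simp only: minus_divide_left minus_diff_eq)
  ultimately have "sqrt_coeff (Suc (Suc n)) = sqrt_coeff (Suc n) * ((real (Suc n) - 1/2) / real (Suc (Suc n)))"
    by (simp only: sqrt_coeff_def power_Suc mult_minus_left mult_minus_right mult_1_left mult.assoc)
  moreover have "0 \<le> (real (Suc n) - 1/2) / real (Suc (Suc n))" by simp
  ultimately show ?case using mult_nonpos_nonneg[OF Suc] by metis
qed (simp add: sqrt_coeff_def)

lemma sqrt_coeff_convolution:
  "(\<Sum>i\<le>n. sqrt_coeff i * sqrt_coeff (n - i)) = (if n = 0 then 1 else if n = 1 then -1 else 0)"
proof -
  have "(\<Sum>i\<le>n. sqrt_coeff i * sqrt_coeff (n - i))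
      = (\<Sum>i\<le>n. (-1) ^ n * (((1/2) gchoose i) * ((1/2) gchoose (n - i))))"
  proof (rule sum.cong)
    fix i assume "i \<in> {..n}"
    then have "(-1::real) ^ n = (-1) ^ i * (-1) ^ (n - i)" by (simp flip: power_add)
    then show "sqrt_coeff i * sqrt_coeff (n - i) = (-1) ^ n * (((1/2) gchoose i) * ((1/2) gchoose (n - i)))"
      by (simp add: sqrt_coeff_def)
  qed simp
  also have "\<dots> = (-1) ^ n * (1 gchoose n)"
    using gbinomial_Vandermonde[of "1/2::real" "1/2" n]
    unfolding sum_distrib_left[symmetric] by (simp add: atLeast0AtMost)
  also have "(1::real) gchoose n = real (1 choose n)" by (simp add: binomial_gbinomial)
  also have "(1::nat) choose n = (if n \<le> 1 then 1 else 0)" by (cases n) (auto simp: binomial_eq_0)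
  finally show ?thesis by auto
qed

text \<open>For \<open>0 < x < 1\<close> the partial sums of \<open>1 - sqrt (1 - x)\<close> have nonnegative terms and are at most \<open>1\<close>;
  let \<open>x \<rightarrow> 1\<close>.\<close>

lemma sqrt_coeff_sum_le: "(\<Sum>n<N. - sqrt_coeff (Suc n)) \<le> 1"
proof (rule tendsto_upperbound)
  have "((\<lambda>x. \<Sum>n<N. - sqrt_coeff (Suc n) * x ^ Suc n) \<longlongrightarrow> (\<Sum>n<N. - sqrt_coeff (Suc n) * 1 ^ Suc n)) (at_left 1)"
    by (intro tendsto_intros)
  then show "((\<lambda>x. \<Sum>n<N. - sqrt_coeff (Suc n) * x ^ Suc n) \<longlongrightarrow> (\<Sum>n<N. - sqrt_coeff (Suc n))) (at_left 1)"
    by simp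
  have "(\<Sum>n<N. - sqrt_coeff (Suc n) * x ^ Suc n) \<le> 1" if x: "0 < x" "x < 1" for x
  proof -
    have "(\<lambda>n. ((1/2) gchoose n) * (- x) ^ n) sums sqrt (1 + (- x))"
      using x by (intro sqrt_series) simp
    moreover have "((1/2) gchoose n) * (- x) ^ n = sqrt_coeff n * x ^ n" for n
      unfolding sqrt_coeff_def power_minus[of x n] by simp
    ultimately have "(\<lambda>n. sqrt_coeff n * x ^ n) sums sqrt (1 - x)" by simp
    then have "(\<lambda>n. sqrt_coeff (Suc n) * x ^ Suc n) sums (sqrt (1 - x) - 1)"
      by (subst sums_Suc_iff) simp
    from sums_minus[OF this] have S: "(\<lambda>n. - sqrt_coeff (Suc n) * x ^ Suc n) sums (1 - sqrt (1 - x))"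
      by simp
    have "(\<Sum>n<N. - sqrt_coeff (Suc n) * x ^ Suc n) \<le> 1 - sqrt (1 - x)"
      unfolding sums_unique[OF S]
      by (rule sum_le_suminf[OF sums_summable[OF S]])
        (use x sqrt_coeff_Suc_nonpos in \<open>auto intro!: mult_nonpos_nonneg simp del: power_Suc\<close>)
    then show ?thesis using x by (smt (verit) real_sqrt_ge_zero)
  qed
  then show "\<forall>\<^sub>F x in at_left 1. (\<Sum>n<N. - sqrt_coeff (Suc n) * x ^ Suc n) \<le> 1"
    unfolding eventually_at_left_field by (intro exI[of _ 0]) simp
qed simp

lemma sqrt_coeff_summable:
  "summable (\<lambda>n. \<bar>sqrt_coeff n\<bar>)" "(\<Sum>n. \<bar>sqrt_coeff (Suc n)\<bar>) \<le> 1"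
proof -
  have e: "\<bar>sqrt_coeff (Suc n)\<bar> = - sqrt_coeff (Suc n)" for n using sqrt_coeff_Suc_nonpos[of n] by simp
  have s: "summable (\<lambda>n. \<bar>sqrt_coeff (Suc n)\<bar>)"
  proof (rule bounded_imp_summable)
    show "(\<Sum>k\<le>n. \<bar>sqrt_coeff (Suc k)\<bar>) \<le> 1" for n
      using sqrt_coeff_sum_le[of "Suc n"] by (simp only: e lessThan_Suc_atMost)
  qed simp
  then show "summable (\<lambda>n. \<bar>sqrt_coeff n\<bar>)" by (subst (asm) summable_Suc_iff)
  show "(\<Sum>n. \<bar>sqrt_coeff (Suc n)\<bar>) \<le> 1"
    by (rule suminf_le_const[OF s]) (simp only: e sqrt_coeff_sum_le)
qed

text \<open>The Cauchy product for a series in powers of an operator, with \<open>u n\<close> in the role of \<open>T\<^sup>n x\<close>.\<close>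

lemma double_series_convolution:
  fixes u :: "nat \<Rightarrow> 'a::banach" and s :: "nat \<Rightarrow> real"
  assumes s: "summable (\<lambda>n. \<bar>s n\<bar>)" and u: "\<And>n. norm (u n) \<le> B"
  shows "(\<Sum>n. s n *\<^sub>R (\<Sum>m. s m *\<^sub>R u (n + m))) = (\<Sum>k. (\<Sum>i\<le>k. s i * s (k - i)) *\<^sub>R u k)"
proof -
  have B: "0 \<le> B" using u norm_ge_zero order_trans by blast
  define F where "F p = (s (fst p) * s (snd p)) *\<^sub>R u (fst p + snd p)" for p
  have as: "(\<lambda>n. norm (s n)) summable_on UNIV" using s by (simp add: summable_on_UNIV_nonneg_real_iff)
  have "(\<lambda>p. norm (s (fst p) * s (snd p))) summable_on (UNIV \<times> UNIV)"
    unfolding Infinite_Sum.abs_summable_on_Sigma_iff using as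
    by (auto simp: abs_mult infsum_cmult_right' infsum_nonneg
        intro!: summable_on_cmult_right summable_on_cmult_left)
  then have "(\<lambda>p. norm (B * (s (fst p) * s (snd p)))) summable_on (UNIV \<times> UNIV)"
    by (auto simp: abs_mult intro!: summable_on_cmult_right)
  then have "(\<lambda>p. norm (F p)) summable_on (UNIV \<times> UNIV)"
  proof (rule Infinite_Sum.abs_summable_on_comparison_test)
    show "norm (F p) \<le> norm (B * (s (fst p) * s (snd p)))" for p
      using mult_left_mono[OF u[of "fst p + snd p"], of "\<bar>s (fst p) * s (snd p)\<bar>"] B
      by (simp add: F_def abs_mult mult_ac)
  qed
  then have F: "F summable_on (UNIV \<times> UNIV)" by (rule abs_summable_summable)
  have usum: "summable (\<lambda>m. norm (s m *\<^sub>R u (n + m)))" for n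
  proof (rule summable_comparison_test'[OF summable_mult[OF s, of B]])
    show "norm (norm (s m *\<^sub>R u (n + m))) \<le> B * \<bar>s m\<bar>" for m
      using mult_left_mono[OF u[of "n + m"], of "\<bar>s m\<bar>"] by (simp add: mult.commute)
  qed
  have inner: "s n *\<^sub>R (\<Sum>m. s m *\<^sub>R u (n + m)) = (\<Sum>\<^sub>\<infinity>m. F (n, m))" for n
  proof -
    have "((\<lambda>m. s m *\<^sub>R u (n + m)) has_sum (\<Sum>m. s m *\<^sub>R u (n + m))) UNIV"
      by (intro norm_summable_imp_has_sum usum summable_sums summable_norm_cancel[OF usum])
    then have "((\<lambda>m. s n *\<^sub>R (s m *\<^sub>R u (n + m))) has_sum (s n *\<^sub>R (\<Sum>m. s m *\<^sub>R u (n + m)))) UNIV"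
      by (rule has_sum_scaleR)
    then show ?thesis by (simp add: F_def infsumI)
  qed
  have conv: "(\<Sum>\<^sub>\<infinity>n. g n) = (\<Sum>n. g n)" if "g summable_on UNIV" for g :: "nat \<Rightarrow> 'a"
    using that has_sum_infsum has_sum_imp_sums sums_unique by blast
  have "(\<Sum>n. s n *\<^sub>R (\<Sum>m. s m *\<^sub>R u (n + m))) = (\<Sum>n. \<Sum>\<^sub>\<infinity>m. F (n, m))"
    by (simp only: inner)
  also have "\<dots> = (\<Sum>\<^sub>\<infinity>n. \<Sum>\<^sub>\<infinity>m. F (n, m))"
    by (rule conv[symmetric])
      (use summable_on_Sigma_banach[of "\<lambda>n m. F (n, m)" UNIV "\<lambda>_. UNIV"] F in simp)
  also have "\<dots> = infsum F (UNIV \<times> UNIV)" by (rule infsum_Sigma_banach[OF F])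
  also have "\<dots> = infsum (\<lambda>q. F (snd q, fst q - snd q)) (Sigma UNIV (\<lambda>k. {..k}))"
    by (rule infsum_reindex_bij_witness[of _ "\<lambda>q. (snd q, fst q - snd q)" "\<lambda>p. (fst p + snd p, fst p)"]) auto
  finally have eq: "(\<Sum>n. s n *\<^sub>R (\<Sum>m. s m *\<^sub>R u (n + m)))
      = infsum (\<lambda>q. F (snd q, fst q - snd q)) (Sigma UNIV (\<lambda>k. {..k}))" .
  have "bij_betw (\<lambda>q. (snd q, fst q - snd q)) (Sigma UNIV (\<lambda>k::nat. {..k})) (UNIV \<times> UNIV)"
    by (rule bij_betw_byWitness[of _ "\<lambda>p. (fst p + snd p, fst p)"]) auto
  then have F': "(\<lambda>q. F (snd q, fst q - snd q)) summable_on (Sigma UNIV (\<lambda>k. {..k}))"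
    using F by (subst summable_on_reindex_bij_betw)
  have row: "(\<Sum>\<^sub>\<infinity>i\<in>{..k}. F (i, k - i)) = (\<Sum>i\<le>k. s i * s (k - i)) *\<^sub>R u k" for k
    by (simp add: F_def scaleR_left.sum)
  have "infsum (\<lambda>q. F (snd q, fst q - snd q)) (Sigma UNIV (\<lambda>k. {..k}))
      = (\<Sum>\<^sub>\<infinity>k. \<Sum>\<^sub>\<infinity>i\<in>{..k}. F (i, k - i))"
    using infsum_Sigma_banach[OF F'] by simp
  also have "\<dots> = (\<Sum>k. \<Sum>\<^sub>\<infinity>i\<in>{..k}. F (i, k - i))"
    by (rule conv)
      (use summable_on_Sigma_banach[of "\<lambda>k i. F (i, k - i)" UNIV "\<lambda>k. {..k}"] F' in
        \<open>simp add: case_prod_unfold\<close>)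
  finally show ?thesis unfolding eq row .
qed

text \<open>The square root of \<open>I - T\<close> is the power series of \<open>sqrt (1 - x)\<close> at \<open>T\<close>, which converges absolutely for a
  contraction. It is positive because its terms after the identity add up to an operator of norm at most \<open>1\<close>.\<close>

lemma exists_positive_square_root:
  assumes T: "bounded_clinear T" and contr: "\<And>x. norm (T x) \<le> norm x"
    and sym: "\<And>x y. cinner (T x) y = cinner x (T y)"
  shows "\<exists>A. bounded_clinear A \<and> (\<forall>x. A (A x) = x - T x) \<and> (\<forall>x. cinner (A x) x \<in> \<real>\<^sub>\<ge>\<^sub>0)"
proof -
  define P where "P n = (T ^^ n)" for n
  have P0: "P 0 x = x" and PS: "P (Suc n) x = T (P n x)" for n x by (simp_all add: P_def)
  have Padd: "P n (P m x) = P (n + m) x" for n m x by (simp add: P_def funpow_add)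
  have Pl: "bounded_clinear (P n)" for n
    by (induction n) (auto simp: P_def o_def intro!: bounded_clinear_comp[OF T]
        bounded_clinearI[of _ 1])
  have Pn: "norm (P n x) \<le> norm x" for n x
    by (induction n) (auto simp: P0 PS intro: order_trans[OF contr])
  have Psym: "cinner (P n x) y = cinner x (P n y)" for n x y
  proof (induction n arbitrary: y)
    case (Suc n)
    have "P n (T y) = T (P n y)" using Padd[of n 1 y] Padd[of 1 n y] PS[of 0] by (simp add: P0)
    then show ?case using Suc by (simp add: PS sym)
  qed (simp add: P0)
  note s = sqrt_coeff_summable
  let ?s = sqrt_coeff
  have sm: "summable (\<lambda>n. norm (?s n *\<^sub>R P n x))" for x
  proof (rule summable_comparison_test'[OF summable_mult2[OF s(1), of "norm x"]])
    show "norm (norm (?s n *\<^sub>R P n x)) \<le> \<bar>?s n\<bar> * norm x" for n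
      using mult_left_mono[OF Pn[of n x], of "\<bar>?s n\<bar>"] by simp
  qed
  define A where "A x = (\<Sum>n. ?s n *\<^sub>R P n x)" for x
  have As: "(\<lambda>n. ?s n *\<^sub>R P n x) sums A x" for x
    unfolding A_def by (rule summable_sums[OF summable_norm_cancel[OF sm]])
  have A: "bounded_clinear A"
  proof (rule bounded_clinearI)
    show "A (x + y) = A x + A y" for x y
      using sums_add[OF As[of x] As[of y]] As[of "x + y"]
      by (simp add: bounded_clinearD(4)[OF Pl] scaleR_add_right sums_unique2)
    show "A (c *\<^sub>C x) = c *\<^sub>C A x" for c x
      using bounded_linear.sums[OF bounded_linear_scaleC[of c] As[of x]] As[of "c *\<^sub>C x"]
      by (simp add: bounded_clinearD(3)[OF Pl] scaleR_eq_scaleC mult.commute sums_unique2)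
    show "norm (A x) \<le> (\<Sum>n. \<bar>?s n\<bar>) * norm x" for x
    proof -
      have "norm (A x) \<le> (\<Sum>n. norm (?s n *\<^sub>R P n x))" unfolding A_def by (rule summable_norm[OF sm])
      also have "\<dots> \<le> (\<Sum>n. \<bar>?s n\<bar> * norm x)"
        by (intro suminf_le sm summable_mult2 s(1)) (auto intro: mult_left_mono Pn)
      also have "\<dots> = (\<Sum>n. \<bar>?s n\<bar>) * norm x" by (rule suminf_mult2[OF s(1), symmetric])
      finally show ?thesis .
    qed
  qed
  have "A (A x) = x - T x" for x
  proof -
    have "P n (A x) = (\<Sum>m. ?s m *\<^sub>R P (n + m) x)" for n
      using bounded_linear.sums[OF bounded_clinearD(1)[OF Pl[of n]] As[of x]]
      by (simp add: linear_scale[OF bounded_clinearD(2)[OF Pl]] Padd sums_iff)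
    then have "A (A x) = (\<Sum>n. ?s n *\<^sub>R (\<Sum>m. ?s m *\<^sub>R P (n + m) x))"
      by (simp add: A_def[of "A x"])
    also have "\<dots> = (\<Sum>k. (\<Sum>i\<le>k. ?s i * ?s (k - i)) *\<^sub>R P k x)"
      by (rule double_series_convolution[OF s(1) Pn])
    also have "\<dots> = (\<Sum>k. if k \<in> {0, 1} then (if k = 0 then 1 else -1) *\<^sub>R P k x else 0)"
      unfolding sqrt_coeff_convolution by (rule suminf_cong) auto
    also have "\<dots> = (\<Sum>k\<in>{0, 1}. (if k = 0 then 1 else -1) *\<^sub>R P k x)"
      by (rule sums_unique[OF sums_If_finite_set, symmetric]) simp
    also have "\<dots> = x - T x" by (simp add: P0 PS[of 0, simplified])
    finally show ?thesis .
  qed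
  moreover have "cinner (A x) x \<in> \<real>\<^sub>\<ge>\<^sub>0" for x
  proof -
    have "(\<lambda>N. cinner (\<Sum>n<N. ?s n *\<^sub>R P n x) x) \<longlonglongrightarrow> cinner (A x) x"
      using As[of x] unfolding sums_def by (intro tendsto_intros)
    moreover have "cinner (\<Sum>n<N. ?s n *\<^sub>R P n x) x = cinner x (\<Sum>n<N. ?s n *\<^sub>R P n x)" for N
      by (induction N) (simp_all add: cinner_add_left cinner_add_right scaleR_eq_scaleC Psym)
    moreover have "(\<lambda>N. cinner x (\<Sum>n<N. ?s n *\<^sub>R P n x)) \<longlonglongrightarrow> cinner x (A x)"
      using As[of x] unfolding sums_def by (intro tendsto_intros)
    ultimately have "cinner (A x) x = cinner x (A x)" using LIMSEQ_unique by (simp only:)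
    then have "cinner (A x) x = cnj (cinner (A x) x)" by (simp only: cinner_commute[of x "A x"])
    then have Im0: "Im (cinner (A x) x) = 0" by (simp add: complex_eq_iff)
    have T1: "(\<lambda>n. ?s (Suc n) *\<^sub>R P (Suc n) x) sums (A x - x)"
      using As[of x] by (subst sums_Suc_iff) (simp add: P0)
    have sumS: "summable (\<lambda>n. \<bar>?s (Suc n)\<bar>)" using s(1) by (subst summable_Suc_iff)
    have "norm (A x - x) \<le> (\<Sum>n. \<bar>?s (Suc n)\<bar> * norm x)"
      unfolding sums_unique[OF T1]
    proof (rule norm_suminf_le)
      show "norm (?s (Suc n) *\<^sub>R P (Suc n) x) \<le> \<bar>?s (Suc n)\<bar> * norm x" for n
        using mult_left_mono[OF Pn[of "Suc n" x], of "\<bar>?s (Suc n)\<bar>"] by simp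
    qed (rule summable_mult2[OF sumS])
    also have "\<dots> = (\<Sum>n. \<bar>?s (Suc n)\<bar>) * norm x" by (rule suminf_mult2[OF sumS, symmetric])
    also have "\<dots> \<le> 1 * norm x" by (rule mult_right_mono[OF s(2)]) simp
    finally have "\<bar>inner (A x - x) x\<bar> \<le> norm x * norm x"
      using Cauchy_Schwarz_ineq2[of "A x - x" x] mult_right_mono[of "norm (A x - x)" "norm x" "norm x"] by simp
    then have "0 \<le> Re (cinner (A x) x)"
      by (simp add: Re_cinner inner_diff_left power2_norm_eq_inner flip: power2_eq_square)
    with Im0 show ?thesis by (simp add: complex_nonneg_Reals_iff)
  qed
  ultimately show ?thesis using A by blast
qed

section \<open>The defect operator\<close>

lemma symmetric_if_real_form:
  assumes D: "bounded_clinear D" and real: "\<And>x. Im (cinner (D x) x) = 0"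
  shows "cinner (D x) y = cinner x (D y)"
proof -
  have 1: "Im (cinner (D x) y) + Im (cinner (D y) x) = 0"
    using real[of "x + y"] real[of x] real[of y]
    by (simp add: bounded_clinearD[OF D] cinner_add_left cinner_add_right)
  have 2: "Re (cinner (D x) y) = Re (cinner (D y) x)"
    using real[of "x + \<i> *\<^sub>C y"] real[of x] real[of y]
    by (simp add: bounded_clinearD[OF D] cinner_add_left cinner_add_right)
  have "cinner (D x) y = cnj (cinner (D y) x)" using 1 2 by (simp add: complex_eq_iff)
  then show ?thesis by (metis cinner_commute)
qed

lemma H2_adjoint_mult:
  assumes b: "b \<in> Hinf"
  shows "H2_adjoint (mult_op b) (fun_of y) = fun_of (adj (mult b) y)"
  unfolding H2_adjoint_def
proof (rule the_equality)
  have m: "mult_op b (fun_of x) = fun_of (mult b x)" for x by (auto simp: mult_op_def b)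
  note B = bounded_clinear_mult[OF b]
  show "fun_of (adj (mult b) y) \<in> H2 \<and>
      (\<forall>f\<in>H2. H2_inner (mult_op b f) (fun_of y) = H2_inner f (fun_of (adj (mult b) y)))"
    by (auto simp: H2_eq_range m cinner_adj[OF B])
  fix h assume h: "h \<in> H2 \<and> (\<forall>f\<in>H2. H2_inner (mult_op b f) (fun_of y) = H2_inner f h)"
  then obtain z where z: "h = fun_of z" by (auto simp: H2_eq_range)
  have "adj (mult b) y = z"
    by (rule adj_unique[OF B]) (use h in \<open>simp add: z H2_eq_range m\<close>)
  with z show "h = fun_of (adj (mult b) y)" by simp
qed

lemma linear_op_on_H2_iff:
  assumes A: "\<And>x. A (fun_of x) = fun_of (A' x)"
  shows "linear_op_on H2 A \<longleftrightarrow> (\<forall>x y. A' (x + y) = A' x + A' y) \<and> (\<forall>c x. A' (c *\<^sub>C x) = c *\<^sub>C A' x)"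
proof -
  have s: "(\<lambda>z. fun_of x z + fun_of y z) = fun_of (x + y)" "(\<lambda>z. c * fun_of x z) = fun_of (c *\<^sub>C x)" for x y c
    by auto
  show ?thesis unfolding linear_op_on_def H2_eq_range by (simp add: s A fun_of_inject)
qed

definition defect :: "(complex \<Rightarrow> complex) \<Rightarrow> ell2 \<Rightarrow> ell2" where
  "defect b x = of_fun (defect_op b (fun_of x))"

text \<open>With a positive square root at hand, the choice operator in \<open>H2_sqrt\<close> picks some positive square root;
  positivity makes it symmetric.\<close>

lemma defect_properties:
  assumes b: "b \<in> Hinf1"
  shows "defect_op b (fun_of x) = fun_of (defect b x)"
    and "bounded_clinear (defect b)"
    and "cinner (defect b x) y = cinner x (defect b y)"
    and "defect b (defect b x) = x - mult b (adj (mult b) x)"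
proof -
  have bH: "b \<in> Hinf" by (rule Hinf1D(1)[OF b])
  note B = bounded_clinear_mult[OF bH]
  note B' = bounded_clinear_adj[OF B]
  let ?T = "\<lambda>x. mult b (adj (mult b) x)"
  have nb: "norm (mult b x) \<le> 1 * norm x" for x by (rule norm_mult_le[OF bH Hinf1D(2)[OF b]])
  let ?P = "\<lambda>f z. f z - mult_op b (H2_adjoint (mult_op b) f) z"
  have P: "?P (fun_of x) = fun_of (x - ?T x)" for x
    by (auto simp: H2_adjoint_mult[OF bH] mult_op_def bH)
  obtain A where A: "bounded_clinear A" "\<And>x. A (A x) = x - ?T x" "\<And>x. cinner (A x) x \<in> \<real>\<^sub>\<ge>\<^sub>0"
  proof -
    have "\<exists>A. bounded_clinear A \<and> (\<forall>x. A (A x) = x - ?T x) \<and> (\<forall>x. cinner (A x) x \<in> \<real>\<^sub>\<ge>\<^sub>0)"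
    proof (rule exists_positive_square_root[OF bounded_clinear_comp[OF B B']])
      show "norm (?T x) \<le> norm x" for x
        using nb[of "adj (mult b) x"] norm_adj_le[OF B nb, of x] by simp
      show "cinner (?T x) y = cinner x (?T y)" for x y
        by (simp add: cinner_adj[OF B] cinner_adj'[OF B])
    qed
    then show thesis using that by blast
  qed
  let ?A = "\<lambda>f. fun_of (A (of_fun f))"
  have "positive_H2_op ?A \<and> (\<forall>f\<in>H2. ?A (?A f) = ?P f)"
    unfolding positive_H2_op_def
  proof (intro conjI)
    show "linear_op_on H2 ?A"
      by (subst linear_op_on_H2_iff[of _ A]) (auto simp: bounded_clinearD[OF A(1)])
    show "\<exists>C. \<forall>f\<in>H2. H2_norm (?A f) \<le> C * H2_norm f"
      using bounded_clinear_bound[OF A(1)] by (auto simp: H2_eq_range)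
    show "\<forall>f\<in>H2. ?A (?A f) = ?P f" unfolding H2_eq_range by (auto simp: A(2) P)
  qed (auto simp: H2_eq_range A(3) fun_of_H2)
  then have "positive_H2_op (defect_op b) \<and> (\<forall>f\<in>H2. defect_op b (defect_op b f) = ?P f)"
    unfolding defect_op_def H2_sqrt_def 
    by (rule someI[where P="\<lambda>A. positive_H2_op A \<and> (\<forall>f\<in>H2. A (A f) = ?P f)"])
  then have D: "\<And>f. f \<in> H2 \<Longrightarrow> defect_op b f \<in> H2" "linear_op_on H2 (defect_op b)"
    "\<exists>C. \<forall>f\<in>H2. H2_norm (defect_op b f) \<le> C * H2_norm f"
    "\<forall>f\<in>H2. H2_inner (defect_op b f) f \<in> \<real>\<^sub>\<ge>\<^sub>0"
    "\<forall>f\<in>H2. defect_op b (defect_op b f) = ?P f"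
    unfolding positive_H2_op_def by auto
  show ds: "defect_op b (fun_of x) = fun_of (defect b x)" for x
    unfolding defect_def by (rule fun_of_of_fun[symmetric]) (rule D(1)[OF fun_of_H2])
  show bc: "bounded_clinear (defect b)"
  proof -
    obtain C where "\<forall>f\<in>H2. H2_norm (defect_op b f) \<le> C * H2_norm f" using D(3) by blast
    then have "norm (defect b x) \<le> C * norm x" for x
      by (metis H2_norm_fun_of ds fun_of_H2)
    then show ?thesis
      using D(2)[unfolded linear_op_on_H2_iff[of "defect_op b", OF ds]] by (intro bounded_clinearI) auto
  qed
  have "cinner (defect b x) x \<in> \<real>\<^sub>\<ge>\<^sub>0" for x
    using D(4) by (metis H2_inner_fun_of ds fun_of_H2)
  then have "Im (cinner (defect b x) x) = 0" for x by (simp add: complex_nonneg_Reals_iff)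
  then show "cinner (defect b x) y = cinner x (defect b y)" by (rule symmetric_if_real_form[OF bc])
  have "fun_of (defect b (defect b x)) = fun_of (x - ?T x)"
    using D(5) fun_of_H2[of x] by (simp only: P flip: ds)
  then show "defect b (defect b x) = x - ?T x" by (simp only: fun_of_inject)
qed

section \<open>The space \<open>\<H>(b)\<close> for non-extreme \<open>b\<close>\<close>

definition pair_scaleC :: "complex \<Rightarrow> ell2 \<times> ell2 \<Rightarrow> ell2 \<times> ell2" where
  "pair_scaleC c p = (c *\<^sub>C fst p, c *\<^sub>C snd p)"

lemma continuous_on_pair_scaleC [continuous_intros]:
  "continuous_on A f \<Longrightarrow> continuous_on A (\<lambda>x. pair_scaleC c (f x))"
  unfolding pair_scaleC_def by (intro continuous_intros)

definition pair_cinner :: "ell2 \<times> ell2 \<Rightarrow> ell2 \<times> ell2 \<Rightarrow> complex" where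
  "pair_cinner p q = cinner (fst p) (fst q) + cinner (snd p) (snd q)"

lemma pair_cinner_eq_inner:
  "pair_cinner p q = Complex (inner p q) (inner p (pair_scaleC \<i> q))"
  by (simp add: pair_cinner_def pair_scaleC_def inner_prod_def cinner_eq_inner complex_eq_iff)

text \<open>The model space is the orthogonal complement of the range of the isometry
  \<open>h \<mapsto> (b h, - a h)\<close>.\<close>

definition model_space :: "(complex \<Rightarrow> complex) \<Rightarrow> (complex \<Rightarrow> complex) \<Rightarrow> (ell2 \<times> ell2) set" where
  "model_space a b = {p. adj (mult b) (fst p) = adj (mult a) (snd p)}"

lemma pythagorean_pairD:
  assumes "pythagorean_pair a b"
  shows "a \<in> Hinf1" "b \<in> Hinf1" "a \<in> Hinf" "b \<in> Hinf" "outer_function a"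
    "adj (mult a) (mult a x) + adj (mult b) (mult b x) = x"
proof -
  show ab: "a \<in> Hinf1" "b \<in> Hinf1" "outer_function a" "a \<in> Hinf" "b \<in> Hinf"
    using assms Hinf1D(1) by (auto simp: pythagorean_pair_def)
  have "AE t in circle_measure.
        \<exists>u v. has_radial_limit a (cis t) u \<and> has_radial_limit b (cis t) v \<and>
              (cmod u)\<^sup>2 + (cmod v)\<^sup>2 = 1"
    using assms by (simp add: pythagorean_pair_def)
  from boundary_modulus_operator_identity[OF ab(4,5) boundary_modulus_identity[OF ab(1,2) this]]
  show "adj (mult a) (mult a x) + adj (mult b) (mult b x) = x" .
qed

lemma bounded_clinear_continuous_on:
  "bounded_clinear T \<Longrightarrow> continuous_on S f \<Longrightarrow> continuous_on S (\<lambda>x. T (f x))"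
  by (rule bounded_linear.continuous_on[OF bounded_clinearD(1)])

lemma model_space_subspace:
  assumes "a \<in> Hinf" "b \<in> Hinf"
  shows "subspace (model_space a b)" "closed (model_space a b)"
proof -
  note A = bounded_clinear_adj[OF bounded_clinear_mult[OF assms(1)]]
  note B = bounded_clinear_adj[OF bounded_clinear_mult[OF assms(2)]]
  show "subspace (model_space a b)"
    by (auto simp: subspace_def model_space_def bounded_clinearD[OF A] bounded_clinearD[OF B] scaleR_eq_scaleC)
  show "closed (model_space a b)" unfolding model_space_def
    by (intro closed_Collect_eq bounded_clinear_continuous_on[OF A] bounded_clinear_continuous_on[OF B]
        continuous_on_fst continuous_on_snd continuous_on_id)
qed

text \<open>Let \<open>D\<close> be the defect operator and \<open>Q h\<close> the projection of \<open>(h, 0)\<close> to the model space. Both \<open>D\<close> and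
  \<open>Q\<close> have the Gram operator \<open>I - T\<^sub>b T\<^sub>b\<^sup>*\<close>, so \<open>D h \<mapsto> Q h\<close> is isometric. The first coordinate of
  \<open>Q h\<close> is \<open>D (D h)\<close>; hence the closure \<open>G\<close> of this isometry satisfies \<open>D f = fst k\<close> for \<open>(f, k)\<close> in \<open>G\<close>.
  The range of \<open>D\<close> is dense in the complement \<open>M\<close> of its kernel by symmetry, and the range of \<open>Q\<close> is
  dense in the model space because \<open>T\<^sub>a\<^sup>*\<close> is injective.\<close>

lemma model_space_graph:
  assumes pp: "pythagorean_pair a b"
  defines "M \<equiv> {f. \<forall>g. defect b g = 0 \<longrightarrow> inner f g = 0}"
  shows "\<exists>G. isometry_graph G \<and> fst ` G = M \<and> snd ` G = model_space a b \<and>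
    (\<forall>(f, k) \<in> G. defect b f = fst k) \<and> (\<forall>(f, k) \<in> G. (\<i> *\<^sub>C f, pair_scaleC \<i> k) \<in> G)"
proof -
  note ab = pythagorean_pairD[OF pp]
  note A = bounded_clinear_mult[OF ab(3)] and B = bounded_clinear_mult[OF ab(4)]
  note A' = bounded_clinear_adj[OF A] and B' = bounded_clinear_adj[OF B]
  note D = defect_properties(2)[OF ab(2)] and Dsym = defect_properties(3)[OF ab(2)]
    and DD = defect_properties(4)[OF ab(2)]
  have Dsym': "inner (defect b x) y = inner x (defect b y)" for x y
    using Dsym by (simp flip: Re_cinner)
  define Q where "Q h = (defect b (defect b h), mult a (adj (mult b) h))" for h
  have QK: "Q h \<in> model_space a b" for h
  proof -
    have "adj (mult b) (defect b (defect b h)) = adj (mult b) h - adj (mult b) (mult b (adj (mult b) h))"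
      by (simp add: DD bounded_clinearD[OF B'])
    also have "\<dots> = adj (mult a) (mult a (adj (mult b) h))"
      using ab(6)[of "adj (mult b) h"] by (simp add: algebra_simps)
    finally show ?thesis by (simp add: model_space_def Q_def)
  qed
  have Qinner: "inner (Q h) k = inner h (fst k)" if "k \<in> model_space a b" for h k
  proof -
    have "inner (Q h) k = inner h (fst k) - inner (adj (mult b) h) (adj (mult b) (fst k))
        + inner (adj (mult b) h) (adj (mult a) (snd k))"
      by (simp add: Q_def inner_prod_def DD inner_diff_left inner_adj[OF A] inner_adj[OF B])
    then show ?thesis using that by (simp add: model_space_def)
  qed
  have Qlin: "linear Q"
    unfolding Q_def
    by (intro linearI) (simp_all add: bounded_clinearD[OF A] bounded_clinearD[OF B']
        bounded_clinearD[OF D] scaleR_eq_scaleC)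
  define L where "L = range (\<lambda>h. (defect b h, Q h))"
  have L: "isometry_graph L"
    unfolding isometry_graph_def
  proof (intro conjI)
    have "linear (\<lambda>h. (defect b h, Q h))"
      using bounded_clinearD(2)[OF D] Qlin by (auto simp: linear_iff)
    then show "subspace L" unfolding L_def by (intro linear_subspace_image) auto
    have "inner (Q h) (Q h) = inner (defect b h) (defect b h)" for h
      using Qinner[OF QK, of h h] by (simp add: Q_def Dsym')
    then show "\<forall>(x, y)\<in>L. norm x = norm y" by (auto simp: L_def norm_eq_sqrt_inner)
  qed
  let ?G = "closure L"
  have G: "isometry_graph ?G" by (rule isometry_graph_closure[OF L])
  have Msub: "subspace M" "closed M" unfolding M_def by (rule closed_subspace_orthogonal_complement)+
  have fstL: "fst ` L = range (defect b)" by (auto simp: L_def image_image)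
  have sndL: "snd ` L = range Q" by (auto simp: L_def image_image)
  have "closure (range (defect b)) = M"
  proof (rule closure_eq_closed_subspace[OF Msub(2) _ _ _ Msub(1)])
    show "subspace (range (defect b))" by (intro linear_subspace_image bounded_clinearD(2)[OF D]) auto
    show "range (defect b) \<subseteq> M" by (auto simp: M_def Dsym')
    fix x assume x: "x \<in> M" "\<And>r. r \<in> range (defect b) \<Longrightarrow> inner x r = 0"
    have "inner (defect b x) (defect b x) = 0" using x(2) by (simp add: Dsym')
    then show "x = 0" using x(1) by (auto simp: M_def)
  qed
  then have fstG: "fst ` ?G = M" by (simp add: fst_closure_isometry_graph[OF L] fstL)
  have "closure (range Q) = model_space a b"
  proof (rule closure_eq_closed_subspace[OF model_space_subspace(2)[OF ab(3,4)] _ _ _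
        model_space_subspace(1)[OF ab(3,4)]])
    show "subspace (range Q)" by (intro linear_subspace_image Qlin) auto
    show "range Q \<subseteq> model_space a b" using QK by auto
    fix k assume k: "k \<in> model_space a b" "\<And>r. r \<in> range Q \<Longrightarrow> inner k r = 0"
    have "inner (fst k) (fst k) = 0"
      using k(2)[of "Q (fst k)"] Qinner[OF k(1), of "fst k"] by (simp add: inner_commute)
    then have k0: "fst k = 0" by simp
    then have "adj (mult a) (snd k) = 0"
      using k(1) by (simp add: model_space_def bounded_clinearD[OF B'])
    then have "snd k = 0" by (rule adj_mult_outer_injective[OF ab(5,3)])
    with k0 show "k = 0" by (simp add: prod_eq_iff)
  qed
  then have sndG: "snd ` ?G = model_space a b" by (simp add: snd_closure_isometry_graph[OF L] sndL)
  have "?G \<subseteq> {p. defect b (fst p) = fst (snd p)}"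
  proof (rule closure_minimal)
    show "L \<subseteq> {p. defect b (fst p) = fst (snd p)}" by (auto simp: L_def Q_def)
    show "closed {p :: ell2 \<times> ell2 \<times> ell2. defect b (fst p) = fst (snd p)}"
      by (intro closed_Collect_eq bounded_clinear_continuous_on[OF D] continuous_on_fst
          continuous_on_snd continuous_on_id)
  qed
  then have GD: "\<forall>(f, k)\<in>?G. defect b f = fst k" by auto
  have "(\<lambda>p. (\<i> *\<^sub>C fst p, pair_scaleC \<i> (snd p))) ` ?G \<subseteq> ?G"
  proof (rule image_closure_subset)
    have "(\<i> *\<^sub>C defect b h, pair_scaleC \<i> (Q h)) = (defect b (\<i> *\<^sub>C h), Q (\<i> *\<^sub>C h))" for h
      by (simp add: Q_def pair_scaleC_def bounded_clinearD[OF A] bounded_clinearD[OF B'] bounded_clinearD[OF D])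
    then have "(\<lambda>p. (\<i> *\<^sub>C fst p, pair_scaleC \<i> (snd p))) ` L \<subseteq> L" by (auto simp: L_def)
    then show "(\<lambda>p. (\<i> *\<^sub>C fst p, pair_scaleC \<i> (snd p))) ` L \<subseteq> ?G" using closure_subset by blast
  qed (intro continuous_intros closed_closure)+
  then have Gi: "(\<i> *\<^sub>C f, pair_scaleC \<i> k) \<in> ?G" if fk: "(f, k) \<in> ?G" for f k
    using imageI[OF fk, of "\<lambda>p. (\<i> *\<^sub>C fst p, pair_scaleC \<i> (snd p))"] by auto
  have "\<forall>(f, k) \<in> ?G. (\<i> *\<^sub>C f, pair_scaleC \<i> k) \<in> ?G"
  proof
    fix p assume "p \<in> ?G"
    then show "case p of (f, k) \<Rightarrow> (\<i> *\<^sub>C f, pair_scaleC \<i> k) \<in> ?G" by (cases p) (simp add: Gi)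
  qed
  with G fstG sndG GD show ?thesis by (intro exI[of _ ?G] conjI)
qed

text \<open>Sarason's description of \<open>\<H>(b)\<close> for non-extreme \<open>b\<close>: the graph of the previous lemma matches the vectors
  \<open>f\<close> that represent members \<open>D f\<close> of \<open>\<H>(b)\<close> isometrically with the model space.\<close>

theorem dBR_model:
  assumes pp: "pythagorean_pair a b"
  shows "dBR b = (\<lambda>k. fun_of (fst k)) ` model_space a b"
    and "k \<in> model_space a b \<Longrightarrow> k' \<in> model_space a b \<Longrightarrow>
      dBR_inner b (fun_of (fst k)) (fun_of (fst k')) = pair_cinner k k'"
proof -
  note ab = pythagorean_pairD[OF pp]
  note D = defect_properties(2)[OF ab(2)] and Dop = defect_properties(1)[OF ab(2)]
    and Dsym = defect_properties(3)[OF ab(2)]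
  define M where "M = {f. \<forall>g. defect b g = 0 \<longrightarrow> inner f g = 0}"
  obtain G where G: "isometry_graph G" "fst ` G = M" "snd ` G = model_space a b"
    and G': "\<forall>(f, k) \<in> G. defect b f = fst k"
    "\<forall>(f, k) \<in> G. (\<i> *\<^sub>C f, pair_scaleC \<i> k) \<in> G"
    using model_space_graph[OF pp, folded M_def] by (elim exE conjE)
  have GD: "defect b f = fst k" and Gi: "(\<i> *\<^sub>C f, pair_scaleC \<i> k) \<in> G" if "(f, k) \<in> G" for f k
    using bspec[OF G'(1) that] bspec[OF G'(2) that] by simp_all
  have Msub: "subspace M" by (auto simp: M_def subspace_def inner_add_left)
  have Mker: "H2_minus_ker (defect_op b) = fun_of ` M"
  proof -
    have z: "(\<lambda>z. 0) = fun_of 0" by auto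
    have "cinner f g = 0" if "f \<in> M" "defect b g = 0" for f g
    proof -
      have "defect b (\<i> *\<^sub>C g) = 0" using that by (simp add: bounded_clinearD(3)[OF D])
      then show ?thesis using that by (simp add: M_def cinner_eq_inner complex_eq_iff)
    qed
    moreover have "f \<in> M" if "\<And>g. defect b g = 0 \<Longrightarrow> cinner f g = 0" for f
      using that by (auto simp: M_def simp flip: Re_cinner)
    ultimately show ?thesis
      unfolding H2_minus_ker_def H2_eq_range z by (auto simp: Dop fun_of_inject)
  qed
  have inj: "inj_on (defect b) M"
  proof (rule inj_onI)
    fix f f' assume f: "f \<in> M" "f' \<in> M" "defect b f = defect b f'"
    then have "defect b (f - f') = 0" by (simp add: bounded_clinearD[OF D])
    moreover have "f - f' \<in> M" using f Msub subspace_diff by blast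
    ultimately have "inner (f - f') (f - f') = 0" by (auto simp: M_def)
    then show "f = f'" by simp
  qed
  have inj': "inj_on (defect_op b) (fun_of ` M)"
    using inj by (auto simp: inj_on_def Dop fun_of_inject)
  have inv: "the_inv_into (fun_of ` M) (defect_op b) (fun_of (defect b f)) = fun_of f" if "f \<in> M" for f
    by (rule the_inv_into_f_eq[OF inj']) (use that in \<open>auto simp: Dop\<close>)
  have range: "range (defect b) = defect b ` M"
  proof
    have "closed M" unfolding M_def by (rule closed_subspace_orthogonal_complement)
    then have dec: "\<exists>y z. x = y + z \<and> y \<in> M \<and> (\<forall>s\<in>M. inner z s = 0)" for x
      by (rule closed_subspace_orthogonal_decomposition[OF _ Msub])
    show "range (defect b) \<subseteq> defect b ` M"
    proof clarify
      fix x
      obtain y z where yz: "x = y + z" "y \<in> M" "\<forall>s\<in>M. inner z s = 0" using dec[of x] by blast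
      have "defect b (defect b z) \<in> M" by (auto simp: M_def simp flip: Re_cinner) (simp add: Dsym)
      then have "inner z (defect b (defect b z)) = 0" using yz(3) by blast
      then have "inner (defect b z) (defect b z) = 0" by (simp add: Dsym flip: Re_cinner)
      then have "defect b x = defect b y" by (simp add: yz(1) bounded_clinearD[OF D])
      then show "defect b x \<in> defect b ` M" using yz(2) by blast
    qed
  qed auto
  have "dBR b = fun_of ` defect b ` M"
    unfolding dBR_def H2_eq_range range[symmetric] by (auto simp: Dop image_image)
  moreover have "defect b ` M = fst ` model_space a b"
  proof -
    have "defect b ` fst ` G = fst ` snd ` G" using GD by (force simp: image_iff)
    then show ?thesis by (simp add: G)
  qed
  ultimately show "dBR b = (\<lambda>k. fun_of (fst k)) ` model_space a b" by (simp add: image_image)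
  assume k: "k \<in> model_space a b" "k' \<in> model_space a b"
  obtain f f' where f: "(f, k) \<in> G" "(f', k') \<in> G" using k unfolding G(3)[symmetric] by force
  then have fM: "f \<in> M" "f' \<in> M" using G(2) by force+
  have "dBR_inner b (fun_of (fst k)) (fun_of (fst k')) = cinner f f'"
    unfolding dBR_inner_def Mker GD[OF f(1), symmetric] GD[OF f(2), symmetric]
    by (simp add: inv fM)
  also have "\<dots> = pair_cinner k k'"
    unfolding cinner_eq_inner pair_cinner_eq_inner
    using isometry_graph_inner[OF G(1) f(1) f(2)] isometry_graph_inner[OF G(1) f(1) Gi[OF f(2)]]
    by simp
  finally show "dBR_inner b (fun_of (fst k)) (fun_of (fst k')) = pair_cinner k k'" .
qed

section \<open>Rigidity of the spherical derivative\<close>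

lemma zero_islimpt_Reals: "r > 0 \<Longrightarrow> (0::complex) islimpt (\<real> \<inter> ball 0 r)"
  unfolding islimpt_approachable
proof (intro allI impI)
  fix e :: real assume "r > 0" "e > 0"
  then show "\<exists>x'\<in>\<real> \<inter> ball 0 r. x' \<noteq> 0 \<and> dist x' (0::complex) < e"
    by (intro bexI[of _ "of_real (min r e / 2)"]) (auto simp del: of_real_divide)
qed

text \<open>Writing \<open>z = c + x + \<i> y\<close> and \<open>cnj z = cnj c + x - \<i> y\<close> turns the vanishing on the
  antidiagonal into vanishing for real \<open>x\<close> and \<open>y\<close>; the identity theorem frees the two
  variables one after the other. Joint holomorphy of \<open>F\<close> is expressed by substituting holomorphic functions.\<close>

lemma polarization:
  fixes F :: "complex \<Rightarrow> complex \<Rightarrow> complex"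
  assumes hol: "\<And>S f g. open S \<Longrightarrow> f holomorphic_on S \<Longrightarrow> g holomorphic_on S \<Longrightarrow>
      f ` S \<subseteq> ball c r \<Longrightarrow> g ` S \<subseteq> ball (cnj c) r \<Longrightarrow> (\<lambda>x. F (f x) (g x)) holomorphic_on S"
    and zero: "\<And>z. z \<in> ball c r \<Longrightarrow> F z (cnj z) = 0"
    and zw: "dist c z + dist (cnj c) w < r"
  shows "F z w = 0"
proof -
  let ?B = "ball (0::complex) (r / 2)"
  define G where "G x y = F (c + x + \<i> * y) (cnj c + x - \<i> * y)" for x y
  have r: "r > 0" using zw zero_le_dist[of c z] zero_le_dist[of "cnj c" w] by linarith
  have in1: "c + x + \<i> * y \<in> ball c r" and in2: "cnj c + x - \<i> * y \<in> ball (cnj c) r"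
    if "x \<in> ?B" "y \<in> ?B" for x y
  proof -
    have "cmod (x + \<i> * y) < r" "cmod (x - \<i> * y) < r"
      using that norm_triangle_ineq[of x "\<i> * y"] norm_triangle_ineq4[of x "\<i> * y"]
      by (auto simp: norm_mult)
    moreover have "cmod (- x - \<i> * y) = cmod (x + \<i> * y)" "cmod (\<i> * y - x) = cmod (x - \<i> * y)"
      by (metis norm_minus_cancel minus_add_distrib uminus_add_conv_diff add.commute diff_conv_add_uminus)
        (rule norm_minus_commute)
    ultimately show "c + x + \<i> * y \<in> ball c r" "cnj c + x - \<i> * y \<in> ball (cnj c) r"
      by (simp_all add: dist_norm)
  qed
  have hx: "(\<lambda>x. G x y) holomorphic_on ?B" if "y \<in> ?B" for y
    unfolding G_def using in1 in2 that by (intro hol) (auto intro!: holomorphic_intros)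
  have hy: "(\<lambda>y. G x y) holomorphic_on ?B" if "x \<in> ?B" for x
    unfolding G_def using in1 in2 that by (intro hol) (auto intro!: holomorphic_intros)
  have real: "G x y = 0" if "x \<in> \<real> \<inter> ?B" "y \<in> \<real> \<inter> ?B" for x y
  proof -
    have "cnj x = x" "cnj y = y" using that by (simp_all add: Reals_cnj_iff)
    then show ?thesis using zero[OF in1[of x y]] that by (simp add: G_def)
  qed
  have l: "(0::complex) islimpt (\<real> \<inter> ?B)" by (rule zero_islimpt_Reals) (use r in simp)
  have z0: "0 \<in> ?B" using r by simp
  have 1: "G x y = 0" if y: "y \<in> \<real> \<inter> ?B" and x: "x \<in> ?B" for x y
    by (rule analytic_continuation[OF hx open_ball connected_ball _ z0 l _ x])
      (use y real in auto)
  have 2: "G x y = 0" if x: "x \<in> ?B" and y: "y \<in> ?B" for x y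
    by (rule analytic_continuation[OF hy[OF x] open_ball connected_ball _ z0 l _ y])
      (use x 1 in auto)
  define x where "x = ((z - c) + (w - cnj c)) / 2"
  define y where "y = ((z - c) - (w - cnj c)) / (2 * \<i>)"
  have s: "cmod (z - c) + cmod (w - cnj c) < r" using zw by (simp add: dist_norm norm_minus_commute)
  have "x \<in> ?B" "y \<in> ?B"
    using norm_triangle_ineq[of "z - c" "w - cnj c"] norm_triangle_ineq4[of "z - c" "w - cnj c"] s
    by (simp_all add: x_def y_def norm_divide norm_mult)
  moreover have "c + x + \<i> * y = z" "cnj c + x - \<i> * y = w"
    by (simp_all add: x_def y_def field_simps)
  ultimately show ?thesis using 2[of x y] by (simp add: G_def)
qed

lemma holomorphic_reflection:
  assumes "f holomorphic_on ball 0 1"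
  shows "(\<lambda>z. cnj (f (cnj z))) holomorphic_on ball 0 1"
proof -
  have "cnj ` ball 0 1 = ball 0 1"
  proof
    show "ball 0 1 \<subseteq> cnj ` ball 0 1" by (rule subsetI, rule image_eqI[where x="cnj _"]) auto
  qed auto
  then show ?thesis
    using holomorphic_on_compose_cnj_cnj[of f "ball 0 1"] assms by (simp add: o_def)
qed

definition spherical_derivative :: "(complex \<Rightarrow> complex) \<Rightarrow> complex \<Rightarrow> real" where
  "spherical_derivative \<Phi> \<omega> = cmod (deriv \<Phi> \<omega>) / (1 + (cmod (\<Phi> \<omega>))\<^sup>2)"

lemma one_plus_norm_sq_pos: "0 < 1 + (cmod w)\<^sup>2"
  by (rule add_pos_nonneg) auto

text \<open>The relation in the conclusion is a rotation of the sphere, written without denominators so that it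
  extends analytically from a small disc around \<open>\<omega>\<close>. There \<open>\<psi>1\<close> and \<open>\<psi>2\<close> are the functions rotated to vanish
  at \<open>\<omega>\<close>, and the identity \<open>|\<Phi>1'|\<^sup>2 (1 + |\<Phi>2|\<^sup>2)\<^sup>2 = |\<Phi>2'|\<^sup>2 (1 + |\<Phi>1|\<^sup>2)\<^sup>2\<close>, polarized and with the
  conjugate variable frozen at \<open>cnj \<omega>\<close>, becomes \<open>\<psi>1' = \<kappa> \<psi>2'\<close>.\<close>

lemma spherical_derivative_rotation:
  assumes h1: "\<Phi>1 holomorphic_on ball 0 1" and h2: "\<Phi>2 holomorphic_on ball 0 1"
    and eq: "\<And>z. z \<in> ball 0 1 \<Longrightarrow> spherical_derivative \<Phi>1 z = spherical_derivative \<Phi>2 z"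
  shows "\<exists>A1 A2 \<kappa>. cmod \<kappa> = 1 \<and> (\<forall>z\<in>ball 0 1.
    (\<Phi>1 z - A1) * (1 + cnj A2 * \<Phi>2 z) = \<kappa> * ((\<Phi>2 z - A2) * (1 + cnj A1 * \<Phi>1 z)))"
proof (cases "\<forall>z\<in>ball 0 1. deriv \<Phi>1 z = 0")
  case True
  have d2: "\<forall>z\<in>ball 0 1. deriv \<Phi>2 z = 0"
  proof
    fix z :: complex assume z: "z \<in> ball 0 1"
    then have "cmod (deriv \<Phi>2 z) / (1 + (cmod (\<Phi>2 z))\<^sup>2) = 0"
      using eq[OF z] True by (simp add: spherical_derivative_def)
    then show "deriv \<Phi>2 z = 0" using one_plus_norm_sq_pos[of "\<Phi>2 z"] by simp
  qed
  have const: "\<exists>A. \<forall>z\<in>ball 0 1. f z = A"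
    if "f holomorphic_on ball 0 1" "\<forall>z\<in>ball 0 1. deriv f z = 0" for f :: "complex \<Rightarrow> complex"
  proof (rule has_field_derivative_zero_constant)
    fix x :: complex assume x: "x \<in> ball 0 1"
    have "(f has_field_derivative deriv f x) (at x)"
      using holomorphic_derivI[OF that(1) open_ball x] .
    then show "(f has_field_derivative 0) (at x within ball 0 1)"
      using that(2) x by (metis has_field_derivative_at_within)
  qed simp
  obtain A1 where "\<forall>z\<in>ball 0 1. \<Phi>1 z = A1" using const[OF h1 True] by blast
  moreover obtain A2 where "\<forall>z\<in>ball 0 1. \<Phi>2 z = A2" using const[OF h2 d2] by blast
  \<comment> \<open>For constants both sides of the relation vanish.\<close>
  ultimately show ?thesis by (intro exI[of _ A1] exI[of _ A2] exI[of _ 1]) simp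
next
  case False
  then obtain \<omega> where \<omega>: "\<omega> \<in> ball 0 1" and c1: "deriv \<Phi>1 \<omega> \<noteq> 0" by blast
  define A1 A2 where "A1 = \<Phi>1 \<omega>" and "A2 = \<Phi>2 \<omega>"
  define N1 N2 where "N1 = 1 + (cmod A1)\<^sup>2" and "N2 = 1 + (cmod A2)\<^sup>2"
  define c1 c2 where "c1 = deriv \<Phi>1 \<omega>" and "c2 = deriv \<Phi>2 \<omega>"
  define p1 p2 where "p1 z = 1 + cnj A1 * \<Phi>1 z" and "p2 z = 1 + cnj A2 * \<Phi>2 z" for z
  have N: "N1 > 0" "N2 > 0" using one_plus_norm_sq_pos by (auto simp: N1_def N2_def)
  have p\<omega>: "p1 \<omega> = N1" "p2 \<omega> = N2"
    by (simp_all add: p1_def p2_def N1_def N2_def A1_def A2_def complex_norm_square mult.commute del: of_real_power)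
  have c: "cmod c1 / N1 = cmod c2 / N2"
    using eq[OF \<omega>] by (simp add: spherical_derivative_def c1_def c2_def N1_def N2_def A1_def A2_def)
  have c1nz: "c1 \<noteq> 0" using c1 by (simp add: c1_def)
  have c2nz: "c2 \<noteq> 0" using c c1nz N by auto
  define \<kappa> where "\<kappa> = (cnj c2 * N1) / (cnj c1 * N2)"
  have \<kappa>: "cmod \<kappa> = 1" using c N c1nz c2nz
    by (simp add: \<kappa>_def norm_mult norm_divide field_simps)
  have dh: "deriv \<Phi>1 holomorphic_on ball 0 1" "deriv \<Phi>2 holomorphic_on ball 0 1"
    using h1 h2 by (auto intro: holomorphic_deriv)
  define r where "r = 1 - cmod \<omega>"
  have r: "r > 0" using \<omega> by (simp add: r_def)
  have Br: "ball \<omega> r \<subseteq> ball 0 1" "ball (cnj \<omega>) r \<subseteq> ball 0 1"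
  proof -
    have "ball v (1 - cmod v) \<subseteq> ball 0 1" for v :: complex
    proof
      fix x assume "x \<in> ball v (1 - cmod v)"
      then show "x \<in> ball 0 1" using norm_triangle_sub[of x v] by (simp add: dist_norm norm_minus_commute)
    qed
    from this[of \<omega>] this[of "cnj \<omega>"] show "ball \<omega> r \<subseteq> ball 0 1" "ball (cnj \<omega>) r \<subseteq> ball 0 1"
      by (simp_all add: r_def)
  qed
  define F where "F z w = deriv \<Phi>1 z * cnj (deriv \<Phi>1 (cnj w)) * (1 + \<Phi>2 z * cnj (\<Phi>2 (cnj w)))\<^sup>2
      - deriv \<Phi>2 z * cnj (deriv \<Phi>2 (cnj w)) * (1 + \<Phi>1 z * cnj (\<Phi>1 (cnj w)))\<^sup>2" for z w
  have pol: "deriv \<Phi>1 z * cnj c1 * (p2 z)\<^sup>2 = deriv \<Phi>2 z * cnj c2 * (p1 z)\<^sup>2" if z: "z \<in> ball \<omega> r" for z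
  proof -
    have "F z (cnj \<omega>) = 0"
    proof (rule polarization[of \<omega> r F z "cnj \<omega>"])
      fix S f g assume *: "open S" "f holomorphic_on S" "g holomorphic_on S" "f ` S \<subseteq> ball \<omega> r" "g ` S \<subseteq> ball (cnj \<omega>) r"
      have compf: "(\<lambda>x. h (f x)) holomorphic_on S" if "h holomorphic_on ball 0 1" for h
        using holomorphic_on_compose_gen[OF *(2) that] *(4) Br by (auto simp: o_def)
      have compg: "(\<lambda>x. cnj (h (cnj (g x)))) holomorphic_on S" if "h holomorphic_on ball 0 1" for h
        using holomorphic_on_compose_gen[OF *(3) holomorphic_reflection[OF that]] *(5) Br by (auto simp: o_def)
      show "(\<lambda>x. F (f x) (g x)) holomorphic_on S"
        unfolding F_def by (intro holomorphic_intros compf compg h1 h2 dh)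
    next
      fix v assume "v \<in> ball \<omega> r"
      then have v: "v \<in> ball 0 1" using Br by blast
      have "cmod (deriv \<Phi>1 v) * (1 + (cmod (\<Phi>2 v))\<^sup>2) = cmod (deriv \<Phi>2 v) * (1 + (cmod (\<Phi>1 v))\<^sup>2)"
        using eq[OF v] one_plus_norm_sq_pos[of "\<Phi>1 v"] one_plus_norm_sq_pos[of "\<Phi>2 v"]
        by (simp add: spherical_derivative_def frac_eq_eq less_imp_neq[symmetric] del: add_eq_0_iff)
      then have "(cmod (deriv \<Phi>1 v))\<^sup>2 * (1 + (cmod (\<Phi>2 v))\<^sup>2)\<^sup>2 = (cmod (deriv \<Phi>2 v))\<^sup>2 * (1 + (cmod (\<Phi>1 v))\<^sup>2)\<^sup>2"
        unfolding power_mult_distrib[symmetric] by (simp only:)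
      then have "complex_of_real ((cmod (deriv \<Phi>1 v))\<^sup>2 * (1 + (cmod (\<Phi>2 v))\<^sup>2)\<^sup>2)
          = complex_of_real ((cmod (deriv \<Phi>2 v))\<^sup>2 * (1 + (cmod (\<Phi>1 v))\<^sup>2)\<^sup>2)"
        by (simp only:)
      then have "complex_of_real ((cmod (deriv \<Phi>1 v))\<^sup>2) * (1 + complex_of_real ((cmod (\<Phi>2 v))\<^sup>2))\<^sup>2
          = complex_of_real ((cmod (deriv \<Phi>2 v))\<^sup>2) * (1 + complex_of_real ((cmod (\<Phi>1 v))\<^sup>2))\<^sup>2"
        unfolding of_real_mult of_real_power[of "1 + _"] of_real_add of_real_1 .
      then show "F v (cnj v) = 0" by (simp only: complex_norm_square F_def complex_cnj_cnj right_minus_eq)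
    next
      show "dist \<omega> z + dist (cnj \<omega>) (cnj \<omega>) < r" using z by simp
    qed
    then show ?thesis
      by (simp add: F_def p1_def p2_def A1_def A2_def c1_def c2_def mult.commute[of "cnj _"])
  qed
  have hp: "p1 holomorphic_on ball 0 1" "p2 holomorphic_on ball 0 1"
    unfolding p1_def p2_def by (intro holomorphic_intros h1 h2)+
  have "isCont p1 \<omega>" "isCont p2 \<omega>"
    using hp \<omega> by (auto intro: continuous_on_interior holomorphic_on_imp_continuous_on)
  then have t: "(p1 \<longlongrightarrow> p1 \<omega>) (nhds \<omega>)" "(p2 \<longlongrightarrow> p2 \<omega>) (nhds \<omega>)"
    by (simp_all only: isCont_def tendsto_at_iff_tendsto_nhds)
  have nz: "p1 \<omega> \<noteq> 0" "p2 \<omega> \<noteq> 0" using p\<omega> N by auto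
  have "\<forall>\<^sub>F z in nhds \<omega>. p1 z \<noteq> 0 \<and> p2 z \<noteq> 0"
    by (rule eventually_conj[OF tendsto_imp_eventually_ne[OF t(1) nz(1)] tendsto_imp_eventually_ne[OF t(2) nz(2)]])
  moreover have "\<forall>\<^sub>F z in nhds \<omega>. z \<in> ball \<omega> r" using r by (intro eventually_nhds_in_open) auto
  ultimately have "\<forall>\<^sub>F z in nhds \<omega>. p1 z \<noteq> 0 \<and> p2 z \<noteq> 0 \<and> z \<in> ball \<omega> r" by eventually_elim simp
  then obtain \<rho> where \<rho>: "\<rho> > 0" "\<And>z. dist z \<omega> < \<rho> \<Longrightarrow> p1 z \<noteq> 0 \<and> p2 z \<noteq> 0 \<and> z \<in> ball \<omega> r"
    unfolding eventually_nhds_metric by blast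
  have \<rho>': "p1 z \<noteq> 0" "p2 z \<noteq> 0" "z \<in> ball \<omega> r" "z \<in> ball 0 1" if "z \<in> ball \<omega> \<rho>" for z
    using \<rho>(2)[of z] that Br by (auto simp: dist_commute)
  define \<psi>1 \<psi>2 where "\<psi>1 z = (\<Phi>1 z - A1) / p1 z" and "\<psi>2 z = (\<Phi>2 z - A2) / p2 z" for z
  have "\<exists>C. \<forall>z\<in>ball \<omega> \<rho>. \<psi>1 z - \<kappa> * \<psi>2 z = C"
  proof (rule has_field_derivative_zero_constant)
    fix z assume z: "z \<in> ball \<omega> \<rho>"
    note z' = \<rho>'[OF z]
    have D: "(\<Phi>1 has_field_derivative deriv \<Phi>1 z) (at z)" "(\<Phi>2 has_field_derivative deriv \<Phi>2 z) (at z)"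
      using holomorphic_derivI[OF h1 open_ball z'(4)] holomorphic_derivI[OF h2 open_ball z'(4)] .
    have rotated: "((\<lambda>z. (f z - A) / (1 + cnj A * f z)) has_field_derivative
        D * (1 + (cmod A)\<^sup>2) / (1 + cnj A * f z)\<^sup>2) (at z)"
      if f: "(f has_field_derivative D) (at z)" and nz: "1 + cnj A * f z \<noteq> 0" for f A D
    proof -
      have "D * (1 + cnj A * f z) - (f z - A) * (cnj A * D) = D * (1 + (cmod A)\<^sup>2)"
        unfolding of_real_add complex_norm_square by (simp add: algebra_simps)
      moreover have "((\<lambda>z. (f z - A) / (1 + cnj A * f z)) has_field_derivative
          (D * (1 + cnj A * f z) - (f z - A) * (cnj A * D)) / ((1 + cnj A * f z) * (1 + cnj A * f z))) (at z)"
        using nz by (auto intro!: derivative_eq_intros f)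
      ultimately show ?thesis by (simp add: power2_eq_square)
    qed
    have d1: "(\<psi>1 has_field_derivative deriv \<Phi>1 z * N1 / (p1 z)\<^sup>2) (at z)"
      using rotated[OF D(1), of A1] z'(1) unfolding \<psi>1_def p1_def N1_def by simp
    have d2: "(\<psi>2 has_field_derivative deriv \<Phi>2 z * N2 / (p2 z)\<^sup>2) (at z)"
      using rotated[OF D(2), of A2] z'(2) unfolding \<psi>2_def p2_def N2_def by simp
    have q: "deriv \<Phi>1 z / (p1 z)\<^sup>2 = cnj c2 / cnj c1 * (deriv \<Phi>2 z / (p2 z)\<^sup>2)"
      using pol[OF z'(3)] z'(1,2) c1nz by (simp add: field_simps)
    have "deriv \<Phi>1 z * N1 / (p1 z)\<^sup>2 = N1 * (deriv \<Phi>1 z / (p1 z)\<^sup>2)" by simp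
    also have "\<dots> = \<kappa> * (deriv \<Phi>2 z * N2 / (p2 z)\<^sup>2)"
      unfolding q \<kappa>_def using N by simp
    finally have "deriv \<Phi>1 z * N1 / (p1 z)\<^sup>2 = \<kappa> * (deriv \<Phi>2 z * N2 / (p2 z)\<^sup>2)" .
    then have "((\<lambda>z. \<psi>1 z - \<kappa> * \<psi>2 z) has_field_derivative 0) (at z)"
      using DERIV_diff[OF d1 DERIV_cmult[OF d2, of \<kappa>]] by simp
    then show "((\<lambda>z. \<psi>1 z - \<kappa> * \<psi>2 z) has_field_derivative 0) (at z within ball \<omega> \<rho>)"
      by (rule has_field_derivative_at_within)
  qed simp
  then obtain C where C: "\<And>z. z \<in> ball \<omega> \<rho> \<Longrightarrow> \<psi>1 z - \<kappa> * \<psi>2 z = C" by blast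
  have "C = 0" using C[of \<omega>] \<rho>(1) by (simp add: \<psi>1_def \<psi>2_def A1_def A2_def)
  have loc: "(\<Phi>1 z - A1) * p2 z = \<kappa> * ((\<Phi>2 z - A2) * p1 z)" if z: "z \<in> ball \<omega> \<rho>" for z
    using C[OF z] \<rho>'(1,2)[OF z] unfolding \<open>C = 0\<close> \<psi>1_def \<psi>2_def by (simp add: field_simps)
  have "(\<Phi>1 z - A1) * p2 z = \<kappa> * ((\<Phi>2 z - A2) * p1 z)" if z: "z \<in> ball 0 1" for z
  proof (rule analytic_continuation_open[where s="ball \<omega> \<rho>" and s'="ball 0 1"
        and f="\<lambda>z. (\<Phi>1 z - A1) * p2 z" and g="\<lambda>z. \<kappa> * ((\<Phi>2 z - A2) * p1 z)"])
    show "(\<lambda>z. (\<Phi>1 z - A1) * p2 z) holomorphic_on ball 0 1"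
      "(\<lambda>z. \<kappa> * ((\<Phi>2 z - A2) * p1 z)) holomorphic_on ball 0 1"
      by (intro holomorphic_intros h1 h2 hp)+
    show "ball \<omega> \<rho> \<subseteq> ball 0 1" using \<rho>'(4) by blast
  qed (use \<rho>(1) loc z in auto)
  then show ?thesis using \<kappa> unfolding p1_def p2_def by blast
qed

text \<open>The Gram matrices of the eigenvectors belonging to \<open>\<Phi>1\<close> and \<open>\<Phi>2\<close> agree after rescaling by \<open>d\<close>; the
  common factor \<open>1 / (1 - cnj \<omega> z)\<close> has been cancelled.\<close>

definition kernel_equivalent :: "(complex \<Rightarrow> complex) \<Rightarrow> (complex \<Rightarrow> complex) \<Rightarrow> bool" where
  "kernel_equivalent \<Phi>1 \<Phi>2 \<longleftrightarrow> (\<exists>d. \<forall>z\<in>ball 0 1. \<forall>\<omega>\<in>ball 0 1.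
     1 + \<Phi>1 z * cnj (\<Phi>1 \<omega>) = d z * cnj (d \<omega>) * (1 + \<Phi>2 z * cnj (\<Phi>2 \<omega>)))"

lemma spherical_derivative_imp_kernel_equivalent:
  assumes h1: "\<Phi>1 holomorphic_on ball 0 1" and h2: "\<Phi>2 holomorphic_on ball 0 1"
    and eq: "\<And>z. z \<in> ball 0 1 \<Longrightarrow> spherical_derivative \<Phi>1 z = spherical_derivative \<Phi>2 z"
  shows "kernel_equivalent \<Phi>1 \<Phi>2"
proof -
  obtain A1 A2 \<kappa> where \<kappa>: "cmod \<kappa> = 1" and rot: "\<And>z. z \<in> ball 0 1 \<Longrightarrow>
    (\<Phi>1 z - A1) * (1 + cnj A2 * \<Phi>2 z) = \<kappa> * ((\<Phi>2 z - A2) * (1 + cnj A1 * \<Phi>1 z))"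
    using spherical_derivative_rotation[OF h1 h2 eq] by blast
  have \<kappa>\<kappa>: "\<kappa> * cnj \<kappa> = 1" using \<kappa> by (simp add: complex_norm_square[symmetric])
  \<comment> \<open>Solving the relation for \<open>\<Phi>1\<close> gives the rotation \<open>\<Phi>1 = n / e\<close>; its matrix is
    \<open>sqrt N\<close> times a unitary one.\<close>
  define e where "e z = (1 + cnj A2 * \<Phi>2 z) - \<kappa> * cnj A1 * (\<Phi>2 z - A2)" for z
  define n where "n z = A1 * (1 + cnj A2 * \<Phi>2 z) + \<kappa> * (\<Phi>2 z - A2)" for z
  define N where "N = (1 + (cmod A1)\<^sup>2) * (1 + (cmod A2)\<^sup>2)"
  have N: "N > 0" unfolding N_def by (intro mult_pos_pos one_plus_norm_sq_pos)
  have Nc: "complex_of_real N = (1 + A1 * cnj A1) * (1 + A2 * cnj A2)"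
    by (simp add: N_def complex_norm_square del: of_real_power)
  have en: "\<Phi>1 z * e z = n z" if "z \<in> ball 0 1" for z
    using rot[OF that] by (simp add: e_def n_def algebra_simps)
  have id: "e z * cnj (e w) + n z * cnj (n w) = N * (1 + \<Phi>2 z * cnj (\<Phi>2 w))" for z w
  proof -
    have "e z * cnj (e w) + n z * cnj (n w) - N * (1 + \<Phi>2 z * cnj (\<Phi>2 w))
      = (\<kappa> * cnj \<kappa> - 1) * ((\<Phi>2 z - A2) * (cnj (\<Phi>2 w) - cnj A2) * (1 + A1 * cnj A1))"
      unfolding Nc e_def n_def by (simp add: algebra_simps)
    then show ?thesis by (simp add: \<kappa>\<kappa>)
  qed
  have e0: "e z \<noteq> 0" if z: "z \<in> ball 0 1" for z
  proof
    assume "e z = 0"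
    then have "complex_of_real N * (1 + \<Phi>2 z * cnj (\<Phi>2 z)) = 0" using id[of z z] en[OF z] by simp
    then have "complex_of_real (N * (1 + (cmod (\<Phi>2 z))\<^sup>2)) = 0"
      by (simp add: complex_norm_square del: of_real_power)
    then show False using N one_plus_norm_sq_pos[of "\<Phi>2 z"] by (simp del: of_real_mult of_real_add)
  qed
  show ?thesis unfolding kernel_equivalent_def
  proof (intro exI[of _ "\<lambda>z. complex_of_real (sqrt N) / e z"] ballI)
    fix z w :: complex assume zw: "z \<in> ball 0 1" "w \<in> ball 0 1"
    have "complex_of_real (sqrt N) * complex_of_real (sqrt N) = N" using N by (simp flip: of_real_mult)
    moreover have "(1 + \<Phi>1 z * cnj (\<Phi>1 w)) * (e z * cnj (e w)) = N * (1 + \<Phi>2 z * cnj (\<Phi>2 w))"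
      unfolding id[symmetric] en[OF zw(1), symmetric] en[OF zw(2), symmetric] by (simp add: algebra_simps)
    ultimately show "1 + \<Phi>1 z * cnj (\<Phi>1 w) = complex_of_real (sqrt N) / e z * cnj (complex_of_real (sqrt N) / e w)
        * (1 + \<Phi>2 z * cnj (\<Phi>2 w))"
      using e0[OF zw(1)] e0[OF zw(2)] by (simp add: field_simps)
  qed
qed

lemma chordal_distance_identity:
  "(cmod (1 + u * cnj v))\<^sup>2 + (cmod (u - v))\<^sup>2 = (1 + (cmod u)\<^sup>2) * (1 + (cmod v)\<^sup>2)"
proof -
  have "complex_of_real ((cmod (1 + u * cnj v))\<^sup>2 + (cmod (u - v))\<^sup>2)
      = complex_of_real ((1 + (cmod u)\<^sup>2) * (1 + (cmod v)\<^sup>2))"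
    unfolding of_real_add of_real_mult complex_norm_square by (simp add: algebra_simps)
  then show ?thesis by (simp only: of_real_eq_iff)
qed

text \<open>Kernel equivalence preserves the chordal distances between values, and the spherical
  derivative is their infinitesimal form.\<close>

lemma kernel_equivalent_imp_spherical_derivative:
  assumes h1: "\<Phi>1 holomorphic_on ball 0 1" and h2: "\<Phi>2 holomorphic_on ball 0 1"
    and ke: "kernel_equivalent \<Phi>1 \<Phi>2" and \<omega>: "\<omega> \<in> ball 0 1"
  shows "spherical_derivative \<Phi>1 \<omega> = spherical_derivative \<Phi>2 \<omega>"
proof -
  obtain d where d: "\<And>z \<omega>. z \<in> ball 0 1 \<Longrightarrow> \<omega> \<in> ball 0 1 \<Longrightarrow>
     1 + \<Phi>1 z * cnj (\<Phi>1 \<omega>) = d z * cnj (d \<omega>) * (1 + \<Phi>2 z * cnj (\<Phi>2 \<omega>))"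
    using ke unfolding kernel_equivalent_def by blast
  define chord where "chord f z = (cmod (f z - f \<omega>))\<^sup>2 / ((1 + (cmod (f z))\<^sup>2) * (1 + (cmod (f \<omega>))\<^sup>2))"
    for f :: "complex \<Rightarrow> complex" and z
  have P: "(1 + (cmod u)\<^sup>2) * (1 + (cmod v)\<^sup>2) > 0" for u v
    by (intro mult_pos_pos one_plus_norm_sq_pos)
  have chord1: "chord f z = 1 - (cmod (1 + f z * cnj (f \<omega>)))\<^sup>2 / ((1 + (cmod (f z))\<^sup>2) * (1 + (cmod (f \<omega>))\<^sup>2))" for f z
    using chordal_distance_identity[of "f z" "f \<omega>"] P[of "f z" "f \<omega>"]
    by (simp add: chord_def field_simps)
  have n: "1 + (cmod (\<Phi>1 z))\<^sup>2 = (cmod (d z))\<^sup>2 * (1 + (cmod (\<Phi>2 z))\<^sup>2)" if "z \<in> ball 0 1" for z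
  proof -
    have "complex_of_real (1 + (cmod (\<Phi>1 z))\<^sup>2) = complex_of_real ((cmod (d z))\<^sup>2 * (1 + (cmod (\<Phi>2 z))\<^sup>2))"
      using d[OF that that] unfolding of_real_add of_real_mult complex_norm_square by simp
    then show ?thesis by (simp only: of_real_eq_iff)
  qed
  have chord_eq: "chord \<Phi>1 z = chord \<Phi>2 z" if z: "z \<in> ball 0 1" for z
  proof -
    have "cmod (d v) \<noteq> 0" if "v \<in> ball 0 1" for v
      using n[OF that] one_plus_norm_sq_pos[of "\<Phi>1 v"] by auto
    then have "d z \<noteq> 0" "d \<omega> \<noteq> 0" using z \<omega> by auto
    then show ?thesis
      unfolding chord1 n[OF z] n[OF \<omega>] d[OF z \<omega>] by (simp add: norm_mult power_mult_distrib)
  qed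
  have lim: "((\<lambda>z. chord f z / (cmod (z - \<omega>))\<^sup>2) \<longlongrightarrow> (spherical_derivative f \<omega>)\<^sup>2) (at \<omega>)"
    if f: "f holomorphic_on ball 0 1" for f
  proof -
    have D: "(f has_field_derivative deriv f \<omega>) (at \<omega>)" by (rule holomorphic_derivI[OF f open_ball \<omega>])
    have "((\<lambda>z. (f z - f \<omega>) / (z - \<omega>)) \<longlongrightarrow> deriv f \<omega>) (at \<omega>)"
      using D by (simp add: has_field_derivative_iff)
    moreover have "(f \<longlongrightarrow> f \<omega>) (at \<omega>)" using DERIV_isCont[OF D] by (simp add: isCont_def)
    ultimately have "((\<lambda>z. (cmod ((f z - f \<omega>) / (z - \<omega>)))\<^sup>2 / ((1 + (cmod (f z))\<^sup>2) * (1 + (cmod (f \<omega>))\<^sup>2)))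
        \<longlongrightarrow> (cmod (deriv f \<omega>))\<^sup>2 / ((1 + (cmod (f \<omega>))\<^sup>2) * (1 + (cmod (f \<omega>))\<^sup>2))) (at \<omega>)"
      using P[of "f \<omega>" "f \<omega>"] by (intro tendsto_intros) auto
    then show ?thesis
      by (simp add: chord_def spherical_derivative_def norm_divide power_divide power2_eq_square mult_ac)
  qed
  have "((\<lambda>z. chord \<Phi>2 z / (cmod (z - \<omega>))\<^sup>2) \<longlongrightarrow> (spherical_derivative \<Phi>1 \<omega>)\<^sup>2) (at \<omega>)"
  proof (rule Lim_transform_within_open[OF lim[OF h1] open_ball \<omega>])
    show "chord \<Phi>1 z / (cmod (z - \<omega>))\<^sup>2 = chord \<Phi>2 z / (cmod (z - \<omega>))\<^sup>2" if "z \<in> ball 0 1" for z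
      using chord_eq[OF that] by simp
  qed
  then have "(spherical_derivative \<Phi>1 \<omega>)\<^sup>2 = (spherical_derivative \<Phi>2 \<omega>)\<^sup>2"
    using tendsto_unique[OF _ _ lim[OF h2]] by auto
  then show ?thesis
    by (rule power2_eq_imp_eq) (simp_all add: spherical_derivative_def)
qed

section \<open>The model space and its eigenvectors\<close>

text \<open>Equality of Gram matrices extends from a set of pairs to its span, one argument at a time.\<close>

lemma isometry_graph_span:
  assumes W: "\<And>p q. p \<in> W \<Longrightarrow> q \<in> W \<Longrightarrow> inner (fst p) (fst q) = inner (snd p) (snd q)"
  shows "isometry_graph (span W)"
proof -
  have sub: "subspace {p. inner (fst p) (fst q) = inner (snd p) (snd q)}" for q :: "'a \<times> 'b"
    by (auto simp: subspace_def inner_add_left)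
  have 1: "inner (fst p) (fst q) = inner (snd p) (snd q)" if p: "p \<in> span W" and q: "q \<in> W" for p q
    using span_minimal[OF _ sub[of q], of W] W[OF _ q] p by blast
  have 2: "inner (fst p) (fst q) = inner (snd p) (snd q)" if p: "p \<in> span W" and q: "q \<in> span W" for p q
  proof -
    have "W \<subseteq> {q'. inner (fst q') (fst p) = inner (snd q') (snd p)}"
      using 1[OF p] by (auto simp: inner_commute)
    then show ?thesis using span_minimal[OF _ sub[of p], of W] q by (auto simp: inner_commute)
  qed
  have "norm (fst p) = norm (snd p)" if "p \<in> span W" for p
    using 2[OF that that] by (simp add: norm_eq_sqrt_inner)
  then show ?thesis by (force simp: isometry_graph_def subspace_span)
qed

definition eigenvector :: "(complex \<Rightarrow> complex) \<Rightarrow> complex \<Rightarrow> ell2 \<times> ell2" where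
  "eigenvector \<Phi> \<omega> = (szego \<omega>, cnj (\<Phi> \<omega>) *\<^sub>C szego \<omega>)"

definition pair_shift :: "ell2 \<times> ell2 \<Rightarrow> ell2 \<times> ell2" where
  "pair_shift p = (adj (mult disc_id) (fst p), adj (mult disc_id) (snd p))"

lemma pair_cinner_eigenvector:
  "pair_cinner (eigenvector \<Phi> \<omega>) (eigenvector \<Phi> z)
    = cinner (szego \<omega>) (szego z) * (1 + \<Phi> z * cnj (\<Phi> \<omega>))"
  by (simp add: pair_cinner_def eigenvector_def algebra_simps)

lemma pair_cinner_scaleC [simp]:
  "pair_cinner (pair_scaleC c p) q = c * pair_cinner p q"
  "pair_cinner p (pair_scaleC c q) = cnj c * pair_cinner p q"
  by (simp_all add: pair_cinner_def pair_scaleC_def algebra_simps)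

lemma inner_pair_eq_Re: "inner p q = Re (pair_cinner p q)"
  by (simp add: pair_cinner_eq_inner)

lemma pair_scaleC_scaleC [simp]: "pair_scaleC c (pair_scaleC d p) = pair_scaleC (c * d) p"
  by (simp add: pair_scaleC_def)

lemma linear_pair_scaleC: "linear (pair_scaleC c)"
  by (rule linearI) (simp_all add: pair_scaleC_def scaleR_eq_scaleC mult.commute)

lemma
  shows linear_pair_shift: "linear pair_shift"
    and continuous_on_pair_shift: "continuous_on S f \<Longrightarrow> continuous_on S (\<lambda>x. pair_shift (f x))"
    and pair_shift_scaleC: "pair_shift (pair_scaleC c p) = pair_scaleC c (pair_shift p)"
    and pair_shift_eigenvector: "pair_shift (eigenvector \<Phi> \<omega>) = pair_scaleC (cnj (disc_id \<omega>)) (eigenvector \<Phi> \<omega>)"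
proof -
  note S = bounded_clinear_adj[OF bounded_clinear_mult[OF disc_id_Hinf]]
  show "linear pair_shift"
    by (rule linearI) (simp_all add: pair_shift_def bounded_clinearD[OF S] scaleR_eq_scaleC)
  show "continuous_on S f \<Longrightarrow> continuous_on S (\<lambda>x. pair_shift (f x))"
    unfolding pair_shift_def
    by (intro continuous_intros bounded_clinear_continuous_on[OF S])
  show "pair_shift (pair_scaleC c p) = pair_scaleC c (pair_shift p)"
    by (simp add: pair_shift_def pair_scaleC_def bounded_clinearD[OF S])
  show "pair_shift (eigenvector \<Phi> \<omega>) = pair_scaleC (cnj (disc_id \<omega>)) (eigenvector \<Phi> \<omega>)"
    by (simp add: pair_shift_def pair_scaleC_def eigenvector_def bounded_clinearD[OF S]
        adj_mult_szego[OF disc_id_Hinf] mult.commute)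
qed

lemma model_space_closed_under:
  assumes "a \<in> Hinf" "b \<in> Hinf" and k: "k \<in> model_space a b"
  shows "pair_shift k \<in> model_space a b" "pair_scaleC c k \<in> model_space a b"
proof -
  note A' = bounded_clinear_adj[OF bounded_clinear_mult[OF assms(1)]]
  note B' = bounded_clinear_adj[OF bounded_clinear_mult[OF assms(2)]]
  show "pair_scaleC c k \<in> model_space a b"
    using k by (simp add: model_space_def pair_scaleC_def bounded_clinearD[OF A'] bounded_clinearD[OF B'])
  show "pair_shift k \<in> model_space a b"
    using k by (simp add: model_space_def pair_shift_def adj_mult_commute[OF _ disc_id_Hinf] assms(1,2))
qed

lemma eigenvector_in_model_space:
  assumes "a \<in> Hinf" "b \<in> Hinf" "a \<omega> \<noteq> 0"
  shows "eigenvector (\<lambda>z. b z / a z) \<omega> \<in> model_space a b"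
proof -
  note A' = bounded_clinear_adj[OF bounded_clinear_mult[OF assms(1)]]
  show ?thesis
    using assms by (simp add: model_space_def eigenvector_def bounded_clinearD[OF A'] adj_mult_szego)
qed

lemma model_space_eqI:
  assumes pp: "pythagorean_pair a b" and "k \<in> model_space a b" "k' \<in> model_space a b" "fst k = fst k'"
  shows "k = k'"
proof -
  note ab = pythagorean_pairD[OF pp]
  note A' = bounded_clinear_adj[OF bounded_clinear_mult[OF ab(3)]]
  have "adj (mult a) (snd k - snd k') = 0"
    using assms by (simp add: model_space_def bounded_clinearD[OF A'])
  then have "snd k - snd k' = 0" by (rule adj_mult_outer_injective[OF ab(5,3)])
  then show ?thesis using assms(4) by (simp add: prod_eq_iff)
qed

lemma outer_nonzero: "outer_function a \<Longrightarrow> cmod z < 1 \<Longrightarrow> a z \<noteq> 0"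
  using outer_function_approximate_inverse by blast

lemma holomorphic_quotient:
  assumes "pythagorean_pair a b"
  shows "(\<lambda>z. b z / a z) holomorphic_on ball 0 1"
  using pythagorean_pairD[OF assms] HinfD(1) outer_nonzero
  by (auto simp: disc_analytic_def intro!: holomorphic_intros)

text \<open>If \<open>(f, g)\<close> in the model space is orthogonal to the eigenvector at \<open>z\<close>, then
  \<open>f z + \<Phi> z * g z = 0\<close>; for all \<open>z\<close> together this is \<open>a f + b g = 0\<close>. The factors \<open>c\<close> make the real
  span complex, and \<open>d\<close> admits rescaled eigenvectors.\<close>

lemma closure_span_eigenvectors:
  assumes pp: "pythagorean_pair a b" and d: "\<And>\<omega>. cmod \<omega> < 1 \<Longrightarrow> d \<omega> \<noteq> 0"
  shows "closure (span {pair_scaleC (c * d \<omega>) (eigenvector (\<lambda>z. b z / a z) \<omega>) |c \<omega>. cmod \<omega> < 1})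
    = model_space a b" (is "closure (span ?E) = _")
proof -
  note ab = pythagorean_pairD[OF pp]
  let ?\<Phi> = "\<lambda>z. b z / a z"
  have E: "?E \<subseteq> model_space a b"
    using model_space_closed_under(2)[OF ab(3,4) eigenvector_in_model_space[OF ab(3,4) outer_nonzero[OF ab(5)]]]
    by blast
  show ?thesis
  proof (rule closure_eq_closed_subspace[OF model_space_subspace(2)[OF ab(3,4)] subspace_span _ _
        model_space_subspace(1)[OF ab(3,4)]])
    show "span ?E \<subseteq> model_space a b"
      by (rule span_minimal[OF E model_space_subspace(1)[OF ab(3,4)]])
    fix k assume k: "k \<in> model_space a b" and orth: "\<And>r. r \<in> span ?E \<Longrightarrow> inner k r = 0"
    have "mult a (fst k) + mult b (snd k) = 0"
    proof (rule fun_of_eqI)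
      fix z :: complex assume z: "cmod z < 1"
      have *: "inner k (pair_scaleC (c * d z) (eigenvector ?\<Phi> z)) = 0" for c
        by (rule orth, rule span_base) (use z in blast)
      have "inner k (pair_scaleC c (eigenvector ?\<Phi> z)) = 0" for c
        using *[of "c / d z"] d[OF z] by simp
      from this[of 1] this[of \<i>] have "pair_cinner k (eigenvector ?\<Phi> z) = 0"
        by (simp add: inner_pair_eq_Re complex_eq_iff)
      then have "fun_of (fst k) z + ?\<Phi> z * fun_of (snd k) z = 0"
        by (simp add: pair_cinner_def eigenvector_def fun_of_def)
      then show "fun_of (mult a (fst k) + mult b (snd k)) z = fun_of 0 z"
        using outer_nonzero[OF ab(5) z] by (simp add: ab(3,4) field_simps)
    qed
    from annihilator_of_eigenvectors_trivial[OF ab(5,3,4,6) _ this] k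
    show "k = 0" by (simp add: model_space_def prod_eq_iff)
  qed
qed

section \<open>Unitary equivalence and kernels\<close>

lemma shift_eigenvector_unique:
  assumes "adj (mult disc_id) y = cnj \<omega> *\<^sub>C y" "cmod \<omega> < 1"
  shows "y = coeff y 0 *\<^sub>C szego \<omega>"
proof (rule ell2_eqI)
  fix n
  have step: "coeff y (Suc n) = cnj \<omega> * coeff y n" for n
    using coeff_bshift[of y n] assms(1) by (simp add: coeff_simps)
  have "coeff y n = coeff y 0 * cnj \<omega> ^ n" by (induction n) (simp_all add: step)
  then show "coeff y n = coeff (coeff y 0 *\<^sub>C szego \<omega>) n"
    using assms(2) by (simp add: coeff_simps szego.rep_eq)
qed

lemma cinner_szego_nonzero:
  assumes "cmod \<omega> < 1" "cmod z < 1"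
  shows "cinner (szego \<omega>) (szego z) \<noteq> 0"
proof -
  have "cmod (cnj \<omega> * z) < 1" using mult_strict_mono[of "cmod \<omega>" 1 "cmod z" 1] assms
    by (simp add: norm_mult)
  then have "1 - cnj \<omega> * z \<noteq> 0" by auto
  then show ?thesis using fun_of_szego[OF assms] by (simp add: fun_of_def)
qed

text \<open>Eigenspaces of the backward shift are spanned by Szego kernels, so an intertwining unitary maps the
  kernel at \<open>\<omega>\<close> to a multiple \<open>c \<omega>\<close> of itself, and comparing inner products gives the identity with
  \<open>d = cnj \<circ> c\<close>.\<close>

lemma unitarily_equivalent_imp_kernel_equivalent:
  assumes pp1: "pythagorean_pair a1 b1" and pp2: "pythagorean_pair a2 b2"
    and ue: "unitarily_equivalent (dBR b1) (dBR_inner b1) (dBR_shift b1)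
                              (dBR b2) (dBR_inner b2) (dBR_shift b2)"
  shows "kernel_equivalent (\<lambda>z. b1 z / a1 z) (\<lambda>z. b2 z / a2 z)"
proof -
  let ?\<Phi>1 = "\<lambda>z. b1 z / a1 z" and ?\<Phi>2 = "\<lambda>z. b2 z / a2 z"
  note ab1 = pythagorean_pairD[OF pp1] and ab2 = pythagorean_pairD[OF pp2]
  obtain U where U: "bij_betw U (dBR b1) (dBR b2)" "linear_op_on (dBR b1) U"
    "\<forall>f\<in>dBR b1. \<forall>g\<in>dBR b1. dBR_inner b2 (U f) (U g) = dBR_inner b1 f g"
    "\<forall>f\<in>dBR b1. U (dBR_shift b1 f) = dBR_shift b2 (U f)"
    using ue unfolding unitarily_equivalent_def by blast
  let ?k = "\<lambda>\<omega>. fun_of (szego \<omega>)"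
  have e1: "eigenvector ?\<Phi>1 \<omega> \<in> model_space a1 b1" if "cmod \<omega> < 1" for \<omega>
    by (rule eigenvector_in_model_space[OF ab1(3,4) outer_nonzero[OF ab1(5) that]])
  have e2: "eigenvector ?\<Phi>2 \<omega> \<in> model_space a2 b2" if "cmod \<omega> < 1" for \<omega>
    by (rule eigenvector_in_model_space[OF ab2(3,4) outer_nonzero[OF ab2(5) that]])
  have kfst: "?k \<omega> = fun_of (fst (eigenvector ?\<Phi>1 \<omega>))" for \<omega> by (simp add: eigenvector_def)
  have k1: "?k \<omega> \<in> dBR b1" if "cmod \<omega> < 1" for \<omega>
    unfolding dBR_model(1)[OF pp1] kfst using e1[OF that] by (rule imageI)
  have "\<exists>c. U (?k \<omega>) = fun_of (c *\<^sub>C szego \<omega>)" if \<omega>: "cmod \<omega> < 1" for \<omega>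
  proof -
    have "U (?k \<omega>) \<in> dBR b2" using U(1) k1[OF \<omega>] by (auto simp: bij_betw_def)
    then obtain y where y: "U (?k \<omega>) = fun_of y" "fun_of y \<in> dBR b2" by (auto simp: dBR_model(1)[OF pp2])
    have "dBR_shift b1 (?k \<omega>) = fun_of (cnj \<omega> *\<^sub>C szego \<omega>)"
      using k1[OF \<omega>] \<omega> by (simp add: dBR_shift_def backward_shift_fun_of adj_mult_szego[OF disc_id_Hinf])
    also have "\<dots> = (\<lambda>z. cnj \<omega> * ?k \<omega> z)" by auto
    finally have "U (dBR_shift b1 (?k \<omega>)) = (\<lambda>z. cnj \<omega> * fun_of y z)"
      using U(2) k1[OF \<omega>] by (simp add: linear_op_on_def y(1))
    moreover have "U (dBR_shift b1 (?k \<omega>)) = dBR_shift b2 (U (?k \<omega>))" using U(4) k1[OF \<omega>] by blast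
    moreover have "\<dots> = fun_of (adj (mult disc_id) y)"
      using y by (simp add: dBR_shift_def backward_shift_fun_of)
    moreover have "(\<lambda>z. cnj \<omega> * fun_of y z) = fun_of (cnj \<omega> *\<^sub>C y)" by auto
    ultimately have "adj (mult disc_id) y = cnj \<omega> *\<^sub>C y" by (simp only: fun_of_inject)
    from shift_eigenvector_unique[OF this \<omega>] y(1) show ?thesis by metis
  qed
  then obtain c where c: "\<And>\<omega>. cmod \<omega> < 1 \<Longrightarrow> U (?k \<omega>) = fun_of (c \<omega> *\<^sub>C szego \<omega>)" by metis
  have rel: "1 + ?\<Phi>1 z * cnj (?\<Phi>1 \<omega>) = cnj (c z) * cnj (cnj (c \<omega>)) * (1 + ?\<Phi>2 z * cnj (?\<Phi>2 \<omega>))"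
    if \<omega>: "cmod \<omega> < 1" and z: "cmod z < 1" for \<omega> z
  proof -
    have cf: "c v *\<^sub>C szego v = fst (pair_scaleC (c v) (eigenvector ?\<Phi>2 v))" for v
      by (simp add: pair_scaleC_def eigenvector_def)
    have "pair_cinner (eigenvector ?\<Phi>1 \<omega>) (eigenvector ?\<Phi>1 z) = dBR_inner b1 (?k \<omega>) (?k z)"
      unfolding kfst by (rule dBR_model(2)[OF pp1 e1[OF \<omega>] e1[OF z], symmetric])
    also have "\<dots> = dBR_inner b2 (U (?k \<omega>)) (U (?k z))" using U(3) k1 \<omega> z by simp
    also have "\<dots> = pair_cinner (pair_scaleC (c \<omega>) (eigenvector ?\<Phi>2 \<omega>)) (pair_scaleC (c z) (eigenvector ?\<Phi>2 z))"
      unfolding c[OF \<omega>] c[OF z] cf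
      by (rule dBR_model(2)[OF pp2]) (intro model_space_closed_under ab2 e2 \<omega> z)+
    finally have "cinner (szego \<omega>) (szego z) * (1 + ?\<Phi>1 z * cnj (?\<Phi>1 \<omega>))
        = cinner (szego \<omega>) (szego z) * (cnj (c z) * cnj (cnj (c \<omega>)) * (1 + ?\<Phi>2 z * cnj (?\<Phi>2 \<omega>)))"
      unfolding pair_cinner_scaleC pair_cinner_eigenvector by (simp only: complex_cnj_cnj mult_ac)
    then show ?thesis using cinner_szego_nonzero[OF \<omega> z] by (simp only: mult_cancel_left simp_thms)
  qed
  show ?thesis unfolding kernel_equivalent_def
    by (intro exI[of _ "\<lambda>z. cnj (c z)"] ballI rel) auto
qed

lemma closure_span_invariant:
  assumes "linear J" "continuous_on UNIV J" and W: "\<And>k k'. (k, k') \<in> W \<Longrightarrow> (J k, J k') \<in> W"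
    and kk: "(k, k') \<in> closure (span W)"
  shows "(J k, J k') \<in> closure (span W)"
proof -
  let ?J = "\<lambda>p. (J (fst p), J (snd p))"
  have "linear ?J" using assms(1) by (auto simp: linear_iff)
  then have "?J ` span W = span (?J ` W)" by (rule linear_span_image[symmetric])
  also have "\<dots> \<subseteq> span W" by (rule span_mono) (auto intro: W)
  also have "\<dots> \<subseteq> closure (span W)" by (rule closure_subset)
  finally have "?J ` closure (span W) \<subseteq> closure (span W)"
    by (intro image_closure_subset closed_closure continuous_on_Pair
        continuous_on_compose2[OF assms(2)] continuous_on_fst continuous_on_snd continuous_on_id) auto
  then show ?thesis using imageI[OF kk, of ?J] by auto
qed

text \<open>Sending each eigenvector to the eigenvector at the same point, rescaled by \<open>cnj (d \<omega>)\<close>, preserves the Gram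
  matrix. It intertwines the shifts because both vectors have the eigenvalue \<open>cnj \<omega>\<close>.\<close>

lemma model_space_isometry:
  assumes pp1: "pythagorean_pair a1 b1" and pp2: "pythagorean_pair a2 b2"
    and ke: "kernel_equivalent (\<lambda>z. b1 z / a1 z) (\<lambda>z. b2 z / a2 z)"
  shows "\<exists>G. isometry_graph G \<and> fst ` G = model_space a1 b1 \<and> snd ` G = model_space a2 b2 \<and>
    (\<forall>k k'. (k, k') \<in> G \<longrightarrow> (pair_shift k, pair_shift k') \<in> G) \<and>
    (\<forall>c k k'. (k, k') \<in> G \<longrightarrow> (pair_scaleC c k, pair_scaleC c k') \<in> G)"
proof -
  let ?\<Phi>1 = "\<lambda>z. b1 z / a1 z" and ?\<Phi>2 = "\<lambda>z. b2 z / a2 z"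
  obtain d where "\<forall>z\<in>ball 0 1. \<forall>\<omega>\<in>ball 0 1.
     1 + ?\<Phi>1 z * cnj (?\<Phi>1 \<omega>) = d z * cnj (d \<omega>) * (1 + ?\<Phi>2 z * cnj (?\<Phi>2 \<omega>))"
    using ke unfolding kernel_equivalent_def by blast
  then have d: "1 + ?\<Phi>1 z * cnj (?\<Phi>1 \<omega>) = d z * cnj (d \<omega>) * (1 + ?\<Phi>2 z * cnj (?\<Phi>2 \<omega>))"
    if "cmod z < 1" "cmod \<omega> < 1" for z \<omega>
    using that by (simp only: mem_ball_0)
  have d0: "cnj (d \<omega>) \<noteq> 0" if "cmod \<omega> < 1" for \<omega>
  proof
    assume "cnj (d \<omega>) = 0"
    then have "complex_of_real (1 + (cmod (?\<Phi>1 \<omega>))\<^sup>2) = 0"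
      using d[OF that that] unfolding of_real_add complex_norm_square by simp
    then show False using one_plus_norm_sq_pos[of "?\<Phi>1 \<omega>"] by (simp only: of_real_eq_0_iff)
  qed
  \<comment> \<open>The factor \<open>1\<close> brings the first family into the form of \<open>closure_span_eigenvectors\<close>.\<close>
  let ?p = "\<lambda>c \<omega>. (pair_scaleC (c * 1) (eigenvector ?\<Phi>1 \<omega>), pair_scaleC (c * cnj (d \<omega>)) (eigenvector ?\<Phi>2 \<omega>))"
  define W where "W = {?p c \<omega> |c \<omega>. cmod \<omega> < 1}"
  have "inner (fst p) (fst q) = inner (snd p) (snd q)" if pW: "p \<in> W" and qW: "q \<in> W" for p q
  proof -
    obtain c \<omega> where p: "p = ?p c \<omega>" "cmod \<omega> < 1" using pW unfolding W_def by blast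
    obtain c' z where q: "q = ?p c' z" "cmod z < 1" using qW unfolding W_def by blast
    show ?thesis
      unfolding inner_pair_eq_Re p(1) q(1) fst_conv snd_conv pair_cinner_scaleC pair_cinner_eigenvector
      unfolding d[OF q(2) p(2)] by (simp add: mult_ac)
  qed
  then have iso: "isometry_graph (span W)" by (rule isometry_graph_span)
  let ?G = "closure (span W)"
  have fstW: "fst ` W = {pair_scaleC (c * 1) (eigenvector ?\<Phi>1 \<omega>) |c \<omega>. cmod \<omega> < 1}"
    and sndW: "snd ` W = {pair_scaleC (c * cnj (d \<omega>)) (eigenvector ?\<Phi>2 \<omega>) |c \<omega>. cmod \<omega> < 1}"
    unfolding W_def by (force simp: image_iff)+
  have "fst ` ?G = model_space a1 b1"
    unfolding fst_closure_isometry_graph[OF iso] linear_span_image[OF linear_fst, symmetric] fstW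
    by (rule closure_span_eigenvectors[OF pp1]) simp
  moreover have "snd ` ?G = model_space a2 b2"
    unfolding snd_closure_isometry_graph[OF iso] linear_span_image[OF linear_snd, symmetric] sndW
    by (rule closure_span_eigenvectors[OF pp2 d0])
  moreover have "(pair_shift k, pair_shift k') \<in> ?G" if "(k, k') \<in> ?G" for k k'
  proof (rule closure_span_invariant[OF linear_pair_shift _ _ that])
    fix l l' assume "(l, l') \<in> W"
    then obtain c \<omega> where l: "l = fst (?p c \<omega>)" "l' = snd (?p c \<omega>)" "cmod \<omega> < 1" unfolding W_def by auto
    then have "(pair_shift l, pair_shift l') = ?p (c * cnj \<omega>) \<omega>"
      by (simp add: pair_shift_scaleC pair_shift_eigenvector mult_ac)
    then show "(pair_shift l, pair_shift l') \<in> W" using l(3) unfolding W_def by blast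
  qed (intro continuous_on_pair_shift continuous_on_id)
  moreover have "(pair_scaleC c k, pair_scaleC c k') \<in> ?G" if "(k, k') \<in> ?G" for c k k'
  proof (rule closure_span_invariant[OF linear_pair_scaleC _ _ that])
    fix l l' assume "(l, l') \<in> W"
    then obtain c' \<omega> where l: "l = fst (?p c' \<omega>)" "l' = snd (?p c' \<omega>)" "cmod \<omega> < 1" unfolding W_def by auto
    then have "(pair_scaleC c l, pair_scaleC c l') = ?p (c * c') \<omega>" by (simp add: mult_ac)
    then show "(pair_scaleC c l, pair_scaleC c l') \<in> W" using l(3) unfolding W_def by blast
  qed (intro continuous_intros)
  ultimately show ?thesis using isometry_graph_closure[OF iso] by (intro exI[of _ ?G]) simp
qed

lemma kernel_equivalent_imp_unitarily_equivalent:
  assumes pp1: "pythagorean_pair a1 b1" and pp2: "pythagorean_pair a2 b2"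
    and ke: "kernel_equivalent (\<lambda>z. b1 z / a1 z) (\<lambda>z. b2 z / a2 z)"
  shows "unitarily_equivalent (dBR b1) (dBR_inner b1) (dBR_shift b1)
                              (dBR b2) (dBR_inner b2) (dBR_shift b2)"
proof -
  note ab1 = pythagorean_pairD[OF pp1] and ab2 = pythagorean_pairD[OF pp2]
  obtain G where G: "isometry_graph G" "fst ` G = model_space a1 b1" "snd ` G = model_space a2 b2"
    and Gshift: "\<And>k k'. (k, k') \<in> G \<Longrightarrow> (pair_shift k, pair_shift k') \<in> G"
    and Gscale: "\<And>c k k'. (k, k') \<in> G \<Longrightarrow> (pair_scaleC c k, pair_scaleC c k') \<in> G"
    using model_space_isometry[OF assms] by (elim exE conjE) metis
  have Gm: "k \<in> model_space a1 b1" "k' \<in> model_space a2 b2" if "(k, k') \<in> G" for k k'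
    using imageI[OF that, of fst] imageI[OF that, of snd] G by simp_all
  have Gsub: "subspace G" and Gnorm: "\<And>k k'. (k, k') \<in> G \<Longrightarrow> norm k = norm k'"
    using G(1) by (auto simp: isometry_graph_def)
  have Gdiff: "(k - l, k' - l') \<in> G" and Gadd: "(k + l, k' + l') \<in> G"
    if "(k, k') \<in> G" "(l, l') \<in> G" for k k' l l'
    using subspace_diff[OF Gsub that] subspace_add[OF Gsub that] by simp_all
  have Geq: "k = l \<longleftrightarrow> k' = l'" if "(k, k') \<in> G" "(l, l') \<in> G" for k k' l l'
    using Gnorm[OF Gdiff[OF that]] by (metis norm_eq_zero right_minus_eq)
  have Gc: "pair_cinner k l = pair_cinner k' l'" if "(k, k') \<in> G" "(l, l') \<in> G" for k k' l l'
    unfolding pair_cinner_eq_inner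
    using isometry_graph_inner[OF G(1) that] isometry_graph_inner[OF G(1) that(1) Gscale[OF that(2)]] by simp
  define U where "U f = (THE g. \<exists>k k'. (k, k') \<in> G \<and> f = fun_of (fst k) \<and> g = fun_of (fst k'))" for f
  have U: "U (fun_of (fst k)) = fun_of (fst k')" if kk: "(k, k') \<in> G" for k k'
    unfolding U_def
  proof (rule the_equality)
    show "\<exists>l l'. (l, l') \<in> G \<and> fun_of (fst k) = fun_of (fst l) \<and> fun_of (fst k') = fun_of (fst l')"
      using kk by blast
    fix g assume "\<exists>l l'. (l, l') \<in> G \<and> fun_of (fst k) = fun_of (fst l) \<and> g = fun_of (fst l')"
    then obtain l l' where l: "(l, l') \<in> G" "fst k = fst l" "g = fun_of (fst l')" by (auto simp: fun_of_inject)
    have "k = l" by (rule model_space_eqI[OF pp1 Gm(1)[OF kk] Gm(1)[OF l(1)] l(2)])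
    then show "g = fun_of (fst k')" using Geq[OF kk l(1)] l(3) by simp
  qed
  have dom: "\<exists>k k'. (k, k') \<in> G \<and> f = fun_of (fst k)" if "f \<in> dBR b1" for f
    using that unfolding dBR_model(1)[OF pp1] G(2)[symmetric] by force
  have ran: "\<exists>k k'. (k, k') \<in> G \<and> f = fun_of (fst k')" if "f \<in> dBR b2" for f
    using that unfolding dBR_model(1)[OF pp2] G(3)[symmetric] by force
  have in1: "fun_of (fst k) \<in> dBR b1" and in2: "fun_of (fst k') \<in> dBR b2" if "(k, k') \<in> G" for k k'
    unfolding dBR_model(1)[OF pp1] dBR_model(1)[OF pp2] using Gm[OF that] by auto
  show ?thesis unfolding unitarily_equivalent_def
  proof (intro exI[of _ U] conjI ballI)
    show "bij_betw U (dBR b1) (dBR b2)"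
      unfolding bij_betw_def
    proof
      show "inj_on U (dBR b1)"
      proof (rule inj_onI)
        fix f g assume fg: "f \<in> dBR b1" "g \<in> dBR b1" "U f = U g"
        obtain k k' where k: "(k, k') \<in> G" "f = fun_of (fst k)" using dom[OF fg(1)] by blast
        obtain l l' where l: "(l, l') \<in> G" "g = fun_of (fst l)" using dom[OF fg(2)] by blast
        have "fst k' = fst l'" using fg(3) U[OF k(1)] U[OF l(1)] k(2) l(2) by (simp add: fun_of_inject)
        then have "k' = l'" by (rule model_space_eqI[OF pp2 Gm(2)[OF k(1)] Gm(2)[OF l(1)]])
        then show "f = g" using Geq[OF k(1) l(1)] k(2) l(2) by simp
      qed
      show "U ` dBR b1 = dBR b2"
      proof
        show "U ` dBR b1 \<subseteq> dBR b2" using dom U in2 by fastforce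
        show "dBR b2 \<subseteq> U ` dBR b1"
        proof
          fix g assume "g \<in> dBR b2"
          then obtain k k' where k: "(k, k') \<in> G" "g = fun_of (fst k')" using ran by blast
          then show "g \<in> U ` dBR b1" using U[OF k(1)] in1[OF k(1)] by force
        qed
      qed
    qed
    show "linear_op_on (dBR b1) U"
      unfolding linear_op_on_def
    proof (intro conjI ballI allI)
      fix f g assume fg: "f \<in> dBR b1" "g \<in> dBR b1"
      obtain k k' where k: "(k, k') \<in> G" "f = fun_of (fst k)" using dom[OF fg(1)] by blast
      obtain l l' where l: "(l, l') \<in> G" "g = fun_of (fst l)" using dom[OF fg(2)] by blast
      have "(\<lambda>z. f z + g z) = fun_of (fst (k + l))" by (auto simp: k l)
      then show "U (\<lambda>z. f z + g z) = (\<lambda>z. U f z + U g z)"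
        using U[OF Gadd[OF k(1) l(1)]] U[OF k(1)] U[OF l(1)] k(2) l(2) by auto
    next
      fix c f assume f: "f \<in> dBR b1"
      obtain k k' where k: "(k, k') \<in> G" "f = fun_of (fst k)" using dom[OF f] by blast
      have "(\<lambda>z. c * f z) = fun_of (fst (pair_scaleC c k))" by (auto simp: k pair_scaleC_def)
      then show "U (\<lambda>z. c * f z) = (\<lambda>z. c * U f z)"
        using U[OF Gscale[OF k(1), of c]] U[OF k(1)] k(2) by (auto simp: pair_scaleC_def)
    qed
    fix f assume f: "f \<in> dBR b1"
    obtain k k' where k: "(k, k') \<in> G" "f = fun_of (fst k)" using dom[OF f] by blast
    show "U (dBR_shift b1 f) = dBR_shift b2 (U f)"
      using U[OF Gshift[OF k(1)]] U[OF k(1)] in1[OF k(1)] in2[OF k(1)] k(2)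
      by (simp add: dBR_shift_def backward_shift_fun_of pair_shift_def)
    fix g assume g: "g \<in> dBR b1"
    obtain l l' where l: "(l, l') \<in> G" "g = fun_of (fst l)" using dom[OF g] by blast
    show "dBR_inner b2 (U f) (U g) = dBR_inner b1 f g"
      unfolding k(2) l(2) U[OF k(1)] U[OF l(1)]
      by (simp add: dBR_model(2)[OF pp2 Gm(2)[OF k(1)] Gm(2)[OF l(1)]]
          dBR_model(2)[OF pp1 Gm(1)[OF k(1)] Gm(1)[OF l(1)]] Gc[OF k(1) l(1)])
  qed
qed

theorem theorem3p3:
  fixes a1 b1 a2 b2 \<Phi>1 \<Phi>2 :: "complex \<Rightarrow> complex"
  assumes "b1 \<in> Hinf1" and "\<not> extreme_Hinf1 b1"
    and "b2 \<in> Hinf1" and "\<not> extreme_Hinf1 b2"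
    and "pythagorean_pair a1 b1" and "pythagorean_pair a2 b2"
    and "\<Phi>1 = (\<lambda>z. b1 z / a1 z)" and "\<Phi>2 = (\<lambda>z. b2 z / a2 z)"
  shows "unitarily_equivalent (dBR b1) (dBR_inner b1) (dBR_shift b1)
                              (dBR b2) (dBR_inner b2) (dBR_shift b2) \<longleftrightarrow>
         (\<forall>\<omega>\<in>ball 0 1. cmod (deriv \<Phi>1 \<omega>) / (1 + (cmod (\<Phi>1 \<omega>))\<^sup>2) =
                        cmod (deriv \<Phi>2 \<omega>) / (1 + (cmod (\<Phi>2 \<omega>))\<^sup>2))"
proof -
  note pp = \<open>pythagorean_pair a1 b1\<close> \<open>pythagorean_pair a2 b2\<close>
  have h: "\<Phi>1 holomorphic_on ball 0 1" "\<Phi>2 holomorphic_on ball 0 1"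
    unfolding assms(7,8) by (intro holomorphic_quotient pp)+
  have "unitarily_equivalent (dBR b1) (dBR_inner b1) (dBR_shift b1) (dBR b2) (dBR_inner b2) (dBR_shift b2)
      \<longleftrightarrow> kernel_equivalent \<Phi>1 \<Phi>2"
    unfolding assms(7,8)
    using unitarily_equivalent_imp_kernel_equivalent[OF pp] kernel_equivalent_imp_unitarily_equivalent[OF pp]
    by blast
  also have "\<dots> \<longleftrightarrow> (\<forall>\<omega>\<in>ball 0 1. spherical_derivative \<Phi>1 \<omega> = spherical_derivative \<Phi>2 \<omega>)"
    using kernel_equivalent_imp_spherical_derivative[OF h] spherical_derivative_imp_kernel_equivalent[OF h]
    by blast
  finally show ?thesis unfolding spherical_derivative_def .
qed

end
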